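(* Let $F$ be a finitely generated group that is virtually non-abelian free. For all $\Gamma,\Gamma',\Gamma''\in\mathscr{PT}(F)$, with $d$ the Lipschitz metric: 1. $d(\Gamma,\Gamma')\ge0$, and $d(\Gamma,\Gamma')=0$ implies that $\Gamma$ and $\Gamma'$ are $F$-equivariantly isometric. 2. $d(\Gamma,\Gamma'')\le d(\Gamma,\Gamma')+d(\Gamma',\Gamma'')$.
   Context: $\mathscr{T}(F)$ is the set of minimal isometric actions of $F$ on simplicial $\mathbb{R}$-trees $\Gamma$ with all stabilizers finite, up to $F$-equivariant isometry. After subdividing at midpoints of inverted edges, $F$ acts on $\Gamma$ without inversions. Set $\mathrm{vol}(\Gamma)=\sum_e\ell(e)/|\mathcal{G}_e|$, where the sum runs over the edges $e$ of $F\backslash\Gamma$, $\ell(e)$ is the length of $e$, and $\mathcal{G}_e$ is the stabilizer in $F$ of a lift of $e$ to $\Gamma$. $\mathscr{PT}(F)$ is the set of $\Gamma\in\mathscr{T}(F)$ with $\mathrm{vol}(\Gamma)=1$. For $\Gamma,\Gamma'\in\mathscr{T}(F)$, $\mathrm{Lip}(\Gamma,\Gamma')$ is the infimum of the Lipschitz constants of $F$-equivariant Lipschitz maps $\Gamma\to\Gamma'$, and $d(\Gamma,\Gamma')=\log\mathrm{Lip}(\Gamma,\Gamma')$ for $\Gamma,\Gamma'\in\mathscr{PT}(F)$. *)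

theory Defs
  imports "HOL-Analysis.Analysis" "HOL-Algebra.Group_Action" "HOL-Algebra.Generated_Groups"
begin

definition finitely_generated :: "('g, 'm) monoid_scheme \<Rightarrow> bool" where
  "finitely_generated G \<longleftrightarrow>
     (\<exists>S. finite S \<and> S \<subseteq> carrier G \<and> generate G S = carrier G)"

(* A word is a list of signed letters; (True, s) stands for s and (False, s) for its inverse. *)

definition word_value :: "('g, 'm) monoid_scheme \<Rightarrow> (bool \<times> 'g) list \<Rightarrow> 'g" where
  "word_value G w =
     foldr (\<lambda>(pos, s) y. (if pos then s else inv\<^bsub>G\<^esub> s) \<otimes>\<^bsub>G\<^esub> y) w \<one>\<^bsub>G\<^esub>"

definition reduced_word :: "(bool \<times> 'g) list \<Rightarrow> bool" where
  "reduced_word = successively (\<lambda>a b. \<not> (fst a \<noteq> fst b \<and> snd a = snd b))"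

definition free_basis :: "('g, 'm) monoid_scheme \<Rightarrow> 'g set \<Rightarrow> bool" where
  "free_basis G S \<longleftrightarrow> S \<subseteq> carrier G \<and> generate G S = carrier G \<and>
     (\<forall>w. w \<noteq> [] \<and> snd ` set w \<subseteq> S \<and> reduced_word w \<longrightarrow> word_value G w \<noteq> \<one>\<^bsub>G\<^esub>)"

definition free_group :: "('g, 'm) monoid_scheme \<Rightarrow> bool" where
  "free_group G \<longleftrightarrow> group G \<and> (\<exists>S. free_basis G S)"

definition virtually_nonabelian_free :: "('g, 'm) monoid_scheme \<Rightarrow> bool" where
  "virtually_nonabelian_free G \<longleftrightarrow>
     (\<exists>H. subgroup H G \<and> finite (rcosets\<^bsub>G\<^esub> H) \<and>
          free_group (G\<lparr>carrier := H\<rparr>) \<and> \<not> comm_group (G\<lparr>carrier := H\<rparr>))"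

definition arc_joining :: "'a topology \<Rightarrow> 'a \<Rightarrow> 'a \<Rightarrow> 'a set \<Rightarrow> bool" where
  "arc_joining X x y A \<longleftrightarrow>
     (\<exists>g. pathin X g \<and> inj_on g {0..1} \<and> g 0 = x \<and> g 1 = y \<and> g ` {0..1} = A)"

definition geodesic_segment :: "'a metric \<Rightarrow> 'a \<Rightarrow> 'a \<Rightarrow> 'a set \<Rightarrow> bool" where
  "geodesic_segment m x y A \<longleftrightarrow> x \<in> mspace m \<and> y \<in> mspace m \<and>
     (\<exists>\<gamma>. \<gamma> \<in> {0..mdist m x y} \<rightarrow> mspace m \<and>
          \<gamma> 0 = x \<and> \<gamma> (mdist m x y) = y \<and>
          (\<forall>s\<in>{0..mdist m x y}. \<forall>t\<in>{0..mdist m x y}. mdist m (\<gamma> s) (\<gamma> t) = \<bar>s - t\<bar>) \<and>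
          \<gamma> ` {0..mdist m x y} = A)"

definition real_tree :: "'a metric \<Rightarrow> bool" where
  "real_tree m \<longleftrightarrow> mspace m \<noteq> {} \<and>
     (\<forall>x\<in>mspace m. \<forall>y\<in>mspace m. x \<noteq> y \<longrightarrow>
        (\<exists>A. geodesic_segment m x y A \<and>
             (\<forall>B. arc_joining (mtopology_of m) x y B \<longrightarrow> B = A)))"

(* Edges are closed segments joining two distinct vertices and meeting no other vertex. *)

definition edge_joining :: "'a metric \<Rightarrow> 'a set \<Rightarrow> 'a \<Rightarrow> 'a \<Rightarrow> 'a set \<Rightarrow> bool" where
  "edge_joining m V u v e \<longleftrightarrow> u \<in> V \<and> v \<in> V \<and> u \<noteq> v \<and>
     geodesic_segment m u v e \<and> e \<inter> V = {u, v}"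

definition tree_edges :: "'a metric \<Rightarrow> 'a set \<Rightarrow> 'a set set" where
  "tree_edges m V = {e. \<exists>u v. edge_joining m V u v e}"

(* V is the vertex set of a simplicial structure inducing the metric: any two points are joined
   by an edge path with finitely many vertices, and every other point lies inside exactly one
   edge.  In particular every branch point belongs to V. *)

definition simplicial_real_tree :: "'a metric \<Rightarrow> 'a set \<Rightarrow> bool" where
  "simplicial_real_tree m V \<longleftrightarrow> real_tree m \<and> V \<subseteq> mspace m \<and>
     (\<forall>x y A. geodesic_segment m x y A \<longrightarrow> finite (A \<inter> V)) \<and>
     (\<forall>x\<in>mspace m - V. \<exists>!e. e \<in> tree_edges m V \<and> x \<in> e)"

definition subtree :: "'a metric \<Rightarrow> 'a set \<Rightarrow> bool" where
  "subtree m T \<longleftrightarrow> T \<noteq> {} \<and> T \<subseteq> mspace m \<and>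
     (\<forall>x\<in>T. \<forall>y\<in>T. \<forall>A. geodesic_segment m x y A \<longrightarrow> A \<subseteq> T)"

record ('g, 'a) acted_tree =
  metr :: "'a metric"
  verts :: "'a set"
  act :: "'g \<Rightarrow> 'a \<Rightarrow> 'a"

abbreviation points :: "('g, 'a, 'r) acted_tree_scheme \<Rightarrow> 'a set" where
  "points \<Gamma> \<equiv> mspace (metr \<Gamma>)"

definition isometric_tree_action ::
    "('g, 'm) monoid_scheme \<Rightarrow> ('g, 'a) acted_tree \<Rightarrow> bool" where
  "isometric_tree_action F \<Gamma> \<longleftrightarrow>
     simplicial_real_tree (metr \<Gamma>) (verts \<Gamma>) \<and>
     group_action F (points \<Gamma>) (act \<Gamma>) \<and>
     (\<forall>g\<in>carrier F. \<forall>x\<in>points \<Gamma>. \<forall>y\<in>points \<Gamma>.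
        mdist (metr \<Gamma>) (act \<Gamma> g x) (act \<Gamma> g y) = mdist (metr \<Gamma>) x y) \<and>
     (\<forall>g\<in>carrier F. act \<Gamma> g ` verts \<Gamma> = verts \<Gamma>)"

definition minimal_action ::
    "('g, 'm) monoid_scheme \<Rightarrow> ('g, 'a) acted_tree \<Rightarrow> bool" where
  "minimal_action F \<Gamma> \<longleftrightarrow>
     (\<forall>T. subtree (metr \<Gamma>) T \<and> (\<forall>g\<in>carrier F. act \<Gamma> g ` T \<subseteq> T) \<longrightarrow> T = points \<Gamma>)"

(* Trees are not quotiented by equivariant isometry: elements of outer_trees F are
   representatives, and equality of classes is equivariantly_isometric. *)

definition outer_trees :: "('g, 'm) monoid_scheme \<Rightarrow> ('g, 'a) acted_tree set" where
  "outer_trees F = {\<Gamma>. isometric_tree_action F \<Gamma> \<and> minimal_action F \<Gamma> \<and>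
     (\<forall>x\<in>points \<Gamma>. finite (stabilizer F (act \<Gamma>) x))}"

definition equivariantly_isometric ::
    "('g, 'm) monoid_scheme \<Rightarrow> ('g, 'a) acted_tree \<Rightarrow> ('g, 'b) acted_tree \<Rightarrow> bool" where
  "equivariantly_isometric F \<Gamma> \<Gamma>' \<longleftrightarrow>
     (\<exists>f. bij_betw f (points \<Gamma>) (points \<Gamma>') \<and>
          (\<forall>x\<in>points \<Gamma>. \<forall>y\<in>points \<Gamma>. mdist (metr \<Gamma>') (f x) (f y) = mdist (metr \<Gamma>) x y) \<and>
          (\<forall>g\<in>carrier F. \<forall>x\<in>points \<Gamma>. f (act \<Gamma> g x) = act \<Gamma>' g (f x)))"

definition inverted_midpoints ::
    "('g, 'm) monoid_scheme \<Rightarrow> ('g, 'a) acted_tree \<Rightarrow> 'a set" where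
  "inverted_midpoints F \<Gamma> =
     {p. \<exists>u v e. edge_joining (metr \<Gamma>) (verts \<Gamma>) u v e \<and>
           (\<exists>g\<in>carrier F. act \<Gamma> g u = v \<and> act \<Gamma> g v = u) \<and>
           p \<in> e \<and> mdist (metr \<Gamma>) u p = mdist (metr \<Gamma>) p v}"

definition subdivided_edges ::
    "('g, 'm) monoid_scheme \<Rightarrow> ('g, 'a) acted_tree \<Rightarrow> 'a set set" where
  "subdivided_edges F \<Gamma> = tree_edges (metr \<Gamma>) (verts \<Gamma> \<union> inverted_midpoints F \<Gamma>)"

definition edge_act :: "('g, 'a) acted_tree \<Rightarrow> 'g \<Rightarrow> 'a set \<Rightarrow> 'a set" where
  "edge_act \<Gamma> g e = act \<Gamma> g ` e"

definition edge_length :: "('g, 'a) acted_tree \<Rightarrow> 'a set \<Rightarrow> real" where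
  "edge_length \<Gamma> e = (SUP (x, y)\<in>e \<times> e. mdist (metr \<Gamma>) x y)"

(* The sum ranges over the edges of the quotient graph, i.e. orbits of edges; each summand is
   computed on an arbitrary lift. *)

definition vol :: "('g, 'm) monoid_scheme \<Rightarrow> ('g, 'a) acted_tree \<Rightarrow> real" where
  "vol F \<Gamma> =
     (\<Sum>\<^sub>\<infinity>Q\<in>orbits F (subdivided_edges F \<Gamma>) (edge_act \<Gamma>).
        let e = (SOME e. e \<in> Q)
        in edge_length \<Gamma> e / real (card (stabilizer F (edge_act \<Gamma>) e)))"

definition unit_outer_trees :: "('g, 'm) monoid_scheme \<Rightarrow> ('g, 'a) acted_tree set" where
  "unit_outer_trees F = {\<Gamma> \<in> outer_trees F. vol F \<Gamma> = 1}"

definition Lip ::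
    "('g, 'm) monoid_scheme \<Rightarrow> ('g, 'a) acted_tree \<Rightarrow> ('g, 'b) acted_tree \<Rightarrow> real" where
  "Lip F \<Gamma> \<Gamma>' = Inf {L. L \<ge> 0 \<and>
     (\<exists>f. f \<in> points \<Gamma> \<rightarrow> points \<Gamma>' \<and>
          (\<forall>g\<in>carrier F. \<forall>x\<in>points \<Gamma>. f (act \<Gamma> g x) = act \<Gamma>' g (f x)) \<and>
          (\<forall>x\<in>points \<Gamma>. \<forall>y\<in>points \<Gamma>.
             mdist (metr \<Gamma>') (f x) (f y) \<le> L * mdist (metr \<Gamma>) x y))}"

definition lip_dist ::
    "('g, 'm) monoid_scheme \<Rightarrow> ('g, 'a) acted_tree \<Rightarrow> ('g, 'b) acted_tree \<Rightarrow> real" where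
  "lip_dist F \<Gamma> \<Gamma>' = ln (Lip F \<Gamma> \<Gamma>')"

end

theory Submission
  imports Defs
begin

text \<open>An equivariant map between the two trees is surjective by minimality. Up to a factor
  2, the volume of a tree is the growth rate, in \<open>1 / \<epsilon>\<close> as \<open>\<epsilon>\<close> tends to 0, of the number of orbits of points needed for an
  \<open>\<epsilon>\<close>-dense set, weighted by the reciprocals of the orders of the stabilizers. This description makes
  sense under arbitrary Lipschitz maps, and an equivariant \<open>L\<close>-Lipschitz map from \<open>\<Gamma>\<close> onto \<open>\<Gamma>'\<close> gives
  \<open>vol \<Gamma>' \<le> L * vol \<Gamma>\<close>, so \<open>L \<ge> 1\<close> if both volumes are 1. If the infimum of the Lipschitz constants
  is 1, it is attained: displacements of a base point by the generators bound the maps up to central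
  elements, and balls are compact. A 1-Lipschitz map between trees of equal volume cannot shorten an
  edge or identify two points in the interiors of edges, since either would save volume; hence it is
  an isometry.\<close>

section \<open>Geodesics in real trees\<close>

text \<open>The obstacle is that a map competing in \<open>Lip\<close> is merely Lipschitz, so edges
  cannot be compared with their images piece by piece. Counting covering points avoids this, and the
  weights 1/|stabilizer| go the right way because equivariance can only enlarge stabilizers. The
  factor 2 is the length 2*\<epsilon> of an interval of radius \<epsilon>; a bounded error absorbs
  rounding and the ends of edges. Rigidity comes from one accounting principle: if a piece of
  weighted length \<xi> is removed, the image of the rest has content at most 1 - \<xi>, so the
  image of the piece has content at least \<xi>. Two points with the same image would then force two
  pieces into one ball; if they lie in one orbit, the piece counts only once, but the stabilizer of
  the image has at least twice the order. Finally, \<open>Lip\<close> is an infimum of reals, which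
  says nothing for an empty set, so some equivariant Lipschitz map must be constructed. Its values
  are weighted circumcentres, which makes it equivariant without a choice of orbit
  representatives.\<close>

definition seg :: "'a metric \<Rightarrow> 'a \<Rightarrow> 'a \<Rightarrow> 'a set" where
  "seg m x y = {z \<in> mspace m. mdist m x z + mdist m z y = mdist m x y}"

lemma mdist_refl [simp]: "x \<in> mspace m \<Longrightarrow> mdist m x x = 0"
  by simp

lemma seg_commute: "seg m x y = seg m y x"
  by (auto simp: seg_def mdist_commute)

lemma seg_subset_mspace: "seg m x y \<subseteq> mspace m"
  by (auto simp: seg_def)

lemma seg_ends: "x \<in> mspace m \<Longrightarrow> y \<in> mspace m \<Longrightarrow> x \<in> seg m x y \<and> y \<in> seg m x y"
  by (auto simp: seg_def)

lemma seg_refl [simp]: "x \<in> mspace m \<Longrightarrow> seg m x x = {x}"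
  by (auto simp: seg_def mdist_commute)

lemma segD:
  assumes "z \<in> seg m x y"
  shows "z \<in> mspace m" "mdist m x z + mdist m z y = mdist m x y"
  using assms by (auto simp: seg_def)

lemma seg_trans:
  assumes "z \<in> seg m x y" "w \<in> seg m x z" "x \<in> mspace m" "y \<in> mspace m"
  shows "w \<in> seg m x y" "z \<in> seg m w y"
proof -
  have in_M: "z \<in> mspace m" "w \<in> mspace m" using assms by (auto simp: seg_def)
  have "mdist m x y \<le> mdist m x w + mdist m w y" "mdist m w y \<le> mdist m w z + mdist m z y"
    using in_M assms mdist_triangle by metis+
  then show "w \<in> seg m x y" "z \<in> seg m w y"
    using in_M assms by (auto simp: seg_def)
qed

lemma geodesic_segment_subset_seg:
  assumes "geodesic_segment m x y A" shows "A \<subseteq> seg m x y"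
proof
  fix z assume "z \<in> A"
  obtain \<gamma> where g: "\<gamma> \<in> {0..mdist m x y} \<rightarrow> mspace m" "\<gamma> 0 = x" "\<gamma> (mdist m x y) = y"
    "\<And>s t. s \<in> {0..mdist m x y} \<Longrightarrow> t \<in> {0..mdist m x y} \<Longrightarrow> mdist m (\<gamma> s) (\<gamma> t) = \<bar>s - t\<bar>"
    "\<gamma> ` {0..mdist m x y} = A"
    using assms by (auto simp: geodesic_segment_def)
  obtain t where t: "t \<in> {0..mdist m x y}" "z = \<gamma> t" using g(5) \<open>z \<in> A\<close> by blast
  have "mdist m x z = t" "mdist m z y = mdist m x y - t"
    using g(4)[of 0 t] g(4)[of t "mdist m x y"] g(2,3) t by auto
  then show "z \<in> seg m x y" using g(1) t by (auto simp: seg_def)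
qed

lemma geodesic_segment_glue:
  assumes "geodesic_segment m x z A" "geodesic_segment m z y B" "z \<in> seg m x y"
  shows "geodesic_segment m x y (A \<union> B)"
proof -
  define a b where "a = mdist m x z" and "b = mdist m z y"
  obtain \<alpha> where al: "\<alpha> \<in> {0..a} \<rightarrow> mspace m" "\<alpha> 0 = x" "\<alpha> a = z"
    "\<And>s t. s \<in> {0..a} \<Longrightarrow> t \<in> {0..a} \<Longrightarrow> mdist m (\<alpha> s) (\<alpha> t) = \<bar>s - t\<bar>"
    "\<alpha> ` {0..a} = A"
    using assms(1) by (auto simp: geodesic_segment_def a_def)
  obtain \<beta> where be: "\<beta> \<in> {0..b} \<rightarrow> mspace m" "\<beta> 0 = z" "\<beta> b = y"
    "\<And>s t. s \<in> {0..b} \<Longrightarrow> t \<in> {0..b} \<Longrightarrow> mdist m (\<beta> s) (\<beta> t) = \<bar>s - t\<bar>"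
    "\<beta> ` {0..b} = B"
    using assms(2) by (auto simp: geodesic_segment_def b_def)
  have M: "x \<in> mspace m" "y \<in> mspace m" "z \<in> mspace m"
    using assms by (auto simp: geodesic_segment_def)
  have ab: "mdist m x y = a + b" "0 \<le> a" "0 \<le> b"
    using assms(3) by (auto simp: seg_def a_def b_def)
  define \<gamma> where "\<gamma> t = (if t \<le> a then \<alpha> t else \<beta> (t - a))" for t
  \<comment> \<open>The upper bound passes through \<open>z\<close>; any shorter way would give a
    path from \<open>x\<close> to \<open>y\<close> of length less than \<open>a + b\<close>.\<close>
  have cross: "mdist m (\<alpha> s) (\<beta> t) = a - s + t" if "s \<in> {0..a}" "t \<in> {0..b}" for s t
  proof -
    have p: "\<alpha> s \<in> mspace m" "\<beta> t \<in> mspace m" using that al(1) be(1) by auto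
    have 1: "mdist m x (\<alpha> s) = s" using al(4)[of 0 s] al(2) that ab by auto
    have 2: "mdist m (\<alpha> s) z = a - s" using al(4)[of s a] al(3) that ab by auto
    have 3: "mdist m z (\<beta> t) = t" using be(4)[of 0 t] be(2) that ab by auto
    have 4: "mdist m (\<beta> t) y = b - t" using be(4)[of t b] be(3) that ab by auto
    have "mdist m (\<alpha> s) (\<beta> t) \<le> mdist m (\<alpha> s) z + mdist m z (\<beta> t)"
      "mdist m x y \<le> mdist m x (\<beta> t) + mdist m (\<beta> t) y"
      "mdist m x (\<beta> t) \<le> mdist m x (\<alpha> s) + mdist m (\<alpha> s) (\<beta> t)"
      using mdist_triangle p M by metis+
    then show ?thesis using 1 2 3 4 ab by linarith
  qed
  have iso: "mdist m (\<gamma> s) (\<gamma> t) = \<bar>s - t\<bar>" if "s \<in> {0..a+b}" "t \<in> {0..a+b}" for s t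
  proof -
    consider "s \<le> a" "t \<le> a" | "s \<le> a" "t > a" | "s > a" "t \<le> a" | "s > a" "t > a" by linarith
    then show ?thesis
    proof cases
      case 1 then show ?thesis using al(4) that by (auto simp: \<gamma>_def)
    next
      case 2 then show ?thesis using cross[of s "t-a"] that by (auto simp: \<gamma>_def)
    next
      case 3 then show ?thesis using cross[of t "s-a"] that by (auto simp: \<gamma>_def mdist_commute)
    next
      case 4 then show ?thesis using be(4)[of "s-a" "t-a"] that by (auto simp: \<gamma>_def)
    qed
  qed
  have "\<gamma> ` {0..a+b} = A \<union> B"
  proof -
    have "\<gamma> ` {0..a} = A" using al(5) by (auto simp: \<gamma>_def image_def)
    moreover have "\<gamma> ` {a..a+b} = B"
    proof -
      have "\<gamma> t = \<beta> (t - a)" if "t \<in> {a..a+b}" for t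
        using that al(3) be(2) by (auto simp: \<gamma>_def)
      then have "\<gamma> ` {a..a+b} = (\<lambda>t. \<beta> (t - a)) ` {a..a+b}" by auto
      also have "\<dots> = \<beta> ` ((\<lambda>t. t - a) ` {a..a+b})" by (simp only: image_image)
      also have "(\<lambda>t. t - a) ` {a..a+b} = {0..b}"
        using image_add_atLeastAtMost'[of "-a" a "a+b"] by simp
      finally show ?thesis using be(5) by simp
    qed
    moreover have "{0..a+b} = {0..a} \<union> {a..a+b}" using ab by auto
    ultimately show ?thesis by (metis image_Un)
  qed
  moreover have "\<gamma> 0 = x" using al ab by (simp add: \<gamma>_def)
  moreover have "\<gamma> (a + b) = y"
    using al be ab by (cases "b = 0") (auto simp: \<gamma>_def)
  moreover have "\<gamma> \<in> {0..a+b} \<rightarrow> mspace m" using al(1) be(1) by (auto simp: \<gamma>_def Pi_iff)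
  ultimately show ?thesis
    unfolding geodesic_segment_def ab(1) using iso M by (intro conjI exI[of _ \<gamma>]) auto
qed

lemma pathin_Lipschitz:
  assumes "c \<in> {0..1} \<rightarrow> mspace m"
    and "\<And>s t. s \<in> {0..1} \<Longrightarrow> t \<in> {0..1} \<Longrightarrow> mdist m (c s) (c t) \<le> L * \<bar>s - t\<bar>"
  shows "pathin (mtopology_of m) c"
proof -
  have "Lipschitz_continuous_map (submetric euclidean_metric {0..1}) m c"
    unfolding Lipschitz_continuous_map_def using assms
    by (auto simp: dist_real_def intro!: exI[of _ L])
  then show ?thesis
    unfolding pathin_def mtopology_of_euclidean[symmetric] mtopology_of_submetric[symmetric]
    by (simp add: Lipschitz_continuous_imp_continuous_map)
qed

lemma geodesic_segment_imp_arc: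
  assumes "geodesic_segment m x y A" "x \<noteq> y"
  shows "arc_joining (mtopology_of m) x y A"
proof -
  define D where "D = mdist m x y"
  obtain \<gamma> where g: "\<gamma> \<in> {0..D} \<rightarrow> mspace m" "\<gamma> 0 = x" "\<gamma> D = y"
    "\<And>s t. s \<in> {0..D} \<Longrightarrow> t \<in> {0..D} \<Longrightarrow> mdist m (\<gamma> s) (\<gamma> t) = \<bar>s - t\<bar>"
    "\<gamma> ` {0..D} = A" "x \<in> mspace m" "y \<in> mspace m"
    using assms by (auto simp: geodesic_segment_def D_def)
  have D: "D > 0"
    by (metis D_def assms(2) g(6,7) linorder_not_le mdist_nonneg mdist_zero order_antisym)
  have rng: "D * t \<in> {0..D}" if "t \<in> {0..1}" for t
    using that D by (auto simp: mult_left_le)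
  have im: "(\<lambda>t. D * t) ` {0..1} = {0..D}"
    using D by (simp add: image_mult_atLeastAtMost)
  have iso: "mdist m (\<gamma> (D * s)) (\<gamma> (D * t)) = D * \<bar>s - t\<bar>" if "s \<in> {0..1}" "t \<in> {0..1}" for s t
    using g(4)[OF rng rng] that D by (simp add: abs_mult right_diff_distrib[symmetric])
  have "pathin (mtopology_of m) (\<lambda>t. \<gamma> (D * t))"
    using g(1) rng iso by (intro pathin_Lipschitz[where L = D]) auto
  moreover have "inj_on (\<lambda>t. \<gamma> (D * t)) {0..1}"
  proof (rule inj_onI)
    fix s t :: real assume st: "s \<in> {0..1}" "t \<in> {0..1}" "\<gamma> (D * s) = \<gamma> (D * t)"
    then have "mdist m (\<gamma> (D * s)) (\<gamma> (D * t)) = 0"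
      using g(1) rng[OF st(2)] by (metis Pi_mem mdist_refl)
    then have "D * \<bar>s - t\<bar> = 0" using iso[OF st(1,2)] by simp
    then show "s = t" using D by simp
  qed
  moreover have "(\<lambda>t. \<gamma> (D * t)) ` {0..1} = A"
    using im g(5) by (metis image_image)
  ultimately show ?thesis unfolding arc_joining_def
    using g by (intro exI[of _ "\<lambda>t. \<gamma> (D * t)"]) auto
qed

locale rtree =
  fixes m :: "'a metric"
  assumes tree: "real_tree m"
begin

abbreviation "M \<equiv> mspace m"
abbreviation "d \<equiv> mdist m"
abbreviation "sg \<equiv> seg m"

lemma tri: "x \<in> M \<Longrightarrow> y \<in> M \<Longrightarrow> z \<in> M \<Longrightarrow> d x z \<le> d x y + d y z"
  by (rule mdist_triangle)

lemma ex_geodesic: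
  assumes "x \<in> M" "y \<in> M" shows "\<exists>A. geodesic_segment m x y A"
proof (cases "x = y")
  case True
  have "geodesic_segment m x x {x}"
    unfolding geodesic_segment_def using assms by (auto intro!: exI[of _ "\<lambda>_. x"])
  then show ?thesis using True by blast
next
  case False then show ?thesis using tree assms unfolding real_tree_def by blast
qed

text \<open>A point \<open>z\<close> of the metric interval lies on the path glued from geodesics
  from \<open>x\<close> to \<open>z\<close> and from \<open>z\<close> to \<open>y\<close>; this path
  is an arc, hence equal to \<open>A\<close>. From here on \<open>seg\<close> stands for geodesics,
  and incidence becomes arithmetic with distances.\<close>

lemma geodesic_unique:
  assumes "geodesic_segment m x y A" shows "A = sg x y"
proof
  show "A \<subseteq> sg x y" using assms by (rule geodesic_segment_subset_seg)
  have M: "x \<in> M" "y \<in> M" using assms by (auto simp: geodesic_segment_def)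
  show "sg x y \<subseteq> A"
  proof
    fix z assume z: "z \<in> sg x y"
    then have "z \<in> M" by (simp add: seg_def)
    obtain B C where BC: "geodesic_segment m x z B" "geodesic_segment m z y C"
      using ex_geodesic M \<open>z \<in> M\<close> by blast
    have g: "geodesic_segment m x y (B \<union> C)" using geodesic_segment_glue[OF BC z] .
    have "B \<noteq> {} \<and> z \<in> B"
    proof -
      obtain \<gamma> where "\<gamma> (d x z) = z" "\<gamma> ` {0..d x z} = B"
        using BC(1) by (auto simp: geodesic_segment_def)
      then show ?thesis by (metis atLeastAtMost_iff empty_iff imageI mdist_nonneg order_refl)
    qed
    show "z \<in> A"
    proof (cases "x = y")
      case True
      then have "z = x" using z M by auto
      moreover obtain \<gamma> where "\<gamma> (d x y) = y" "\<gamma> ` {0..d x y} = A"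
        using assms by (auto simp: geodesic_segment_def)
      ultimately show ?thesis using True by (metis atLeastAtMost_iff imageI mdist_nonneg order_refl)
    next
      case False
      then have "B \<union> C = A"
        using tree M geodesic_segment_imp_arc[OF g] geodesic_segment_imp_arc[OF assms]
        by (metis real_tree_def)
      then show ?thesis using \<open>B \<noteq> {} \<and> z \<in> B\<close> by blast
    qed
  qed
qed

lemma geodesic_segment_iff: "geodesic_segment m x y A \<longleftrightarrow> x \<in> M \<and> y \<in> M \<and> A = sg x y"
  using geodesic_unique ex_geodesic by (metis geodesic_segment_def)

lemma geodesic_param:
  assumes "x \<in> M" "y \<in> M"
  obtains \<gamma> where "\<gamma> \<in> {0..d x y} \<rightarrow> M" "\<gamma> 0 = x" "\<gamma> (d x y) = y"
    "\<And>s t. s \<in> {0..d x y} \<Longrightarrow> t \<in> {0..d x y} \<Longrightarrow> d (\<gamma> s) (\<gamma> t) = \<bar>s - t\<bar>"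
    "\<gamma> ` {0..d x y} = sg x y"
proof -
  have "geodesic_segment m x y (sg x y)" using assms geodesic_segment_iff by blast
  then show thesis using that unfolding geodesic_segment_def by blast
qed
text \<open>Let \<open>w\<close> be the first point of the geodesic from \<open>x\<close> to
  \<open>y\<close> that lies on \<open>sg y z\<close>. Following \<open>sg x y\<close> up to
  \<open>w\<close> and then \<open>sg y z\<close> on to \<open>z\<close> never returns to a point
  already passed, so this path is an arc and, by uniqueness of arcs, the geodesic from
  \<open>x\<close> to \<open>z\<close>. If \<open>x\<close> lies on \<open>sg y z\<close> or
  \<open>w\<close> is \<open>z\<close>, one half degenerates; these cases are separate.\<close>

lemma median:
  assumes "x \<in> M" "y \<in> M" "z \<in> M"
  shows "\<exists>w. w \<in> sg x y \<and> w \<in> sg y z \<and> w \<in> sg x z"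
proof (cases "x \<in> sg y z")
  case True then show ?thesis using assms seg_ends by metis
next
  case xyz: False
  define D where "D = d x y"
  define E where "E = d y z"
  obtain \<gamma> where g: "\<gamma> \<in> {0..D} \<rightarrow> M" "\<gamma> 0 = x" "\<gamma> D = y"
    "\<And>s t. s \<in> {0..D} \<Longrightarrow> t \<in> {0..D} \<Longrightarrow> d (\<gamma> s) (\<gamma> t) = \<bar>s - t\<bar>"
    "\<gamma> ` {0..D} = sg x y"
    using geodesic_param[OF assms(1,2)] unfolding D_def by metis
  obtain \<delta> where dl: "\<delta> \<in> {0..E} \<rightarrow> M" "\<delta> 0 = y" "\<delta> E = z"
    "\<And>s t. s \<in> {0..E} \<Longrightarrow> t \<in> {0..E} \<Longrightarrow> d (\<delta> s) (\<delta> t) = \<bar>s - t\<bar>"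
    "\<delta> ` {0..E} = sg y z"
    using geodesic_param[OF assms(2,3)] unfolding E_def by metis
  \<comment> \<open>The defect in the triangle inequality vanishes exactly on \<open>sg y z\<close>
    and is 2-Lipschitz, so the set \<open>K\<close> of parameters hitting \<open>sg y z\<close> is
    compact and has a least element.\<close>
  define h where "h p = d y p + d p z - d y z" for p
  have h_lip: "\<bar>h p - h q\<bar> \<le> 2 * d p q" if "p \<in> M" "q \<in> M" for p q
    using tri[of y p q] tri[of y q p] tri[of p q z] tri[of q p z] that assms mdist_commute[of m p q]
    by (simp add: h_def)
  have h0: "p \<in> sg y z \<longleftrightarrow> h p = 0" if "p \<in> M" for p using that by (auto simp: seg_def h_def)
  have cont: "continuous_on {0..D} (\<lambda>t. h (\<gamma> t))"
  proof (rule lipschitz_on_continuous_on[where L = 2], rule lipschitz_onI)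
    fix s t assume st: "s \<in> {0..D}" "t \<in> {0..D}"
    then have "\<gamma> s \<in> M" "\<gamma> t \<in> M" using g(1) by auto
    then show "dist (h (\<gamma> s)) (h (\<gamma> t)) \<le> 2 * dist s t"
      using h_lip[of "\<gamma> s" "\<gamma> t"] g(4)[OF st] by (simp only: dist_real_def)
  qed simp
  define K where "K = {t \<in> {0..D}. h (\<gamma> t) = 0}"
  have "D \<in> K" using g(3) assms by (auto simp: K_def h_def D_def)
  moreover have "compact K"
  proof -
    have "closed ({0..D} \<inter> (\<lambda>t. h (\<gamma> t)) -` {0})"
      using cont by (intro continuous_closed_preimage) auto
    moreover have "K = {0..D} \<inter> ((\<lambda>t. h (\<gamma> t)) -` {0}) \<inter> {0..D}" by (auto simp: K_def)
    ultimately show ?thesis by (simp add: closed_Int_compact)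
  qed
  ultimately obtain t0 where t0: "t0 \<in> K" "\<And>t. t \<in> K \<Longrightarrow> t0 \<le> t"
    using compact_attains_inf[of K] by blast
  have t0D: "t0 \<in> {0..D}" using t0 by (simp add: K_def)
  define w where "w = \<gamma> t0"
  have wM: "w \<in> M" using g(1) t0D by (auto simp: w_def)
  have wy: "w \<in> sg x y" using g(5) t0D by (auto simp: w_def)
  have wz: "w \<in> sg y z" using h0[OF wM] t0(1) by (auto simp: K_def w_def)
  have "t0 \<noteq> 0" using xyz wz g(2) by (auto simp: w_def)
  then have t0pos: "t0 > 0" using t0D by auto
  obtain s0 where s0: "s0 \<in> {0..E}" "w = \<delta> s0" using wz dl(5) by blast
  show ?thesis
  proof (cases "s0 = E")
    case True then show ?thesis using wy dl(3) s0 assms seg_ends by metis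
  next
    case False
    then have s0E: "s0 < E" using s0 by auto
    \<comment> \<open>The concatenation, with one half of the unit interval for each leg because
      \<open>arc_joining\<close> prescribes the domain \<open>{0..1}\<close>.\<close>
    define c where "c t = (if t \<le> 1/2 then \<gamma> (2 * t0 * t) else \<delta> (s0 + (2 * t - 1) * (E - s0)))" for t
    have r1: "2 * t0 * t \<in> {0..D}" "2 * t0 * t \<le> t0" if "t \<in> {0..1/2}" for t
    proof -
      have "t0 * (2 * t) \<le> t0 * 1" using that t0pos by (intro mult_left_mono) auto
      then show "2 * t0 * t \<le> t0" by (simp add: algebra_simps)
      moreover have "0 \<le> 2 * t0 * t" using t0pos that by simp
      ultimately show "2 * t0 * t \<in> {0..D}" using t0D by auto
    qed
    have r2: "s0 + (2 * t - 1) * (E - s0) \<in> {0..E}" if "t \<in> {1/2..1}" for t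
    proof -
      have "(2 * t - 1) * (E - s0) \<le> 1 * (E - s0)" "0 \<le> (2 * t - 1) * (E - s0)"
        using that s0E by (auto intro!: mult_right_mono)
      then show ?thesis using s0 by auto
    qed
    define L where "L = 2 * t0 + 2 * (E - s0)"
    have L: "L \<ge> 0" using s0E t0pos by (simp add: L_def)
    have cM: "c t \<in> M" if "t \<in> {0..1}" for t
      using that g(1) dl(1) r1[of t] r2[of t] by (fastforce simp: c_def)
    have half: "c (1/2) = w" using s0 by (simp add: c_def w_def)
    have half': "c t = \<delta> (s0 + (2 * t - 1) * (E - s0))" if "t \<in> {1/2..1}" for t
    proof (cases "t = 1/2")
      case True show ?thesis unfolding True using half s0(2) by simp
    next
      case False then show ?thesis using that by (simp add: c_def)
    qed
    have half'': "c t = \<gamma> (2 * t0 * t)" if "t \<in> {0..1/2}" for t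
      using that by (auto simp: c_def)
    have l1: "d (c s) (c t) = 2 * t0 * \<bar>s - t\<bar>" if "s \<in> {0..1/2}" "t \<in> {0..1/2}" for s t
    proof -
      have "d (c s) (c t) = \<bar>2 * t0 * s - 2 * t0 * t\<bar>"
        using g(4)[OF r1(1) r1(1)] that half'' by simp
      also have "\<dots> = \<bar>2 * t0\<bar> * \<bar>s - t\<bar>" by (simp only: abs_mult[symmetric] right_diff_distrib)
      finally show ?thesis using t0pos by simp
    qed
    have l2: "d (c s) (c t) = 2 * (E - s0) * \<bar>s - t\<bar>" if "s \<in> {1/2..1}" "t \<in> {1/2..1}" for s t
    proof -
      have "d (c s) (c t) = \<bar>(s0 + (2 * s - 1) * (E - s0)) - (s0 + (2 * t - 1) * (E - s0))\<bar>"
        using dl(4)[OF r2[OF that(1)] r2[OF that(2)]] half'[OF that(1)] half'[OF that(2)] by simp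
      also have "\<dots> = \<bar>(2 * (E - s0)) * (s - t)\<bar>" by (simp add: algebra_simps)
      finally have "d (c s) (c t) = \<bar>(2 * (E - s0)) * (s - t)\<bar>" .
      then show ?thesis using s0E by (simp add: abs_mult)
    qed
    have lip: "d (c s) (c t) \<le> L * \<bar>s - t\<bar>" if st: "s \<in> {0..1}" "t \<in> {0..1}" for s t
    proof -
      have *: "d (c s) (c t) \<le> L * \<bar>s - t\<bar>" if "s \<in> {0..1}" "t \<in> {0..1}" "s \<le> t" for s t
      proof -
        have e1: "2 * t0 * r \<le> L * r" "2 * (E - s0) * r \<le> L * r" if "r \<ge> 0" for r
          using that s0E t0pos by (auto simp: L_def intro!: mult_right_mono)
        consider "t \<le> 1/2" | "s \<ge> 1/2" | "s < 1/2" "t > 1/2" by linarith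
        then show ?thesis
        proof cases
          case 1 then show ?thesis using l1[of s t] that e1(1)[of "\<bar>s - t\<bar>"] by auto
        next
          case 2 then show ?thesis using l2[of s t] that e1(2)[of "\<bar>s - t\<bar>"] by auto
        next
          case 3
          have "d (c s) (c t) \<le> d (c s) (c (1/2)) + d (c (1/2)) (c t)"
            using cM that by (intro tri) auto
          also have "\<dots> \<le> L * (1/2 - s) + L * (t - 1/2)"
          proof (intro add_mono)
            show "d (c s) (c (1/2)) \<le> L * (1/2 - s)"
              using l1[of s "1/2"] that 3 e1(1)[of "1/2 - s"] by auto
            show "d (c (1/2)) (c t) \<le> L * (t - 1/2)"
              using l2[of "1/2" t] that 3 e1(2)[of "t - 1/2"] by auto
          qed
          finally show ?thesis using that by (simp add: algebra_simps)
        qed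
      qed
      show ?thesis
      proof (cases "s \<le> t")
        case True then show ?thesis using *[OF st] by blast
      next
        case False
        then have "d (c t) (c s) \<le> L * \<bar>t - s\<bar>" using *[OF st(2,1)] by linarith
        then show ?thesis using mdist_commute[of m "c s" "c t"] abs_minus_commute[of s t] by simp
      qed
    qed
    have "pathin (mtopology_of m) c" using cM lip by (intro pathin_Lipschitz) auto
    moreover have "inj_on c {0..1}"
    proof -
      have *: "s = t" if "s \<in> {0..1}" "t \<in> {0..1}" "s \<le> t" "c s = c t" for s t
      proof -
        have z: "d (c s) (c t) = 0" unfolding that(4) using cM[OF that(2)] by (rule mdist_refl)
        consider "t \<le> 1/2" | "s \<ge> 1/2" | "s < 1/2" "t > 1/2" by linarith
        then show ?thesis
        proof cases
          case 1
          then have "2 * t0 * \<bar>s - t\<bar> = 0" using l1[of s t] that(1-3) z by simp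
          then show ?thesis using t0pos by simp
        next
          case 2
          then have "2 * (E - s0) * \<bar>s - t\<bar> = 0" using l2[of s t] that(1-3) z by simp
          then show ?thesis using s0E by simp
        next
          case 3
          have "c t = \<delta> (s0 + (2 * t - 1) * (E - s0))" using half' 3 that(2) by simp
          moreover have "s0 + (2 * t - 1) * (E - s0) \<in> {0..E}" using r2 3 that(2) by simp
          ultimately have "c t \<in> sg y z" using dl(5) by blast
          moreover have s: "c s = \<gamma> (2 * t0 * s)" "2 * t0 * s \<in> {0..D}"
            using half''[of s] r1[of s] 3 that(1) by simp_all
          moreover have "c s \<in> M" using cM that(1) by blast
          ultimately have "h (\<gamma> (2 * t0 * s)) = 0" using h0 that(4) by metis
          then have "2 * t0 * s \<in> K" using s(2) by (simp add: K_def)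
          then have "t0 \<le> 2 * t0 * s" by (rule t0(2))
          moreover have "t0 * (2 * s) < t0 * 1" using 3 t0pos by (intro mult_strict_left_mono) auto
          ultimately show ?thesis by (simp add: algebra_simps)
        qed
      qed
      show ?thesis
      proof (rule inj_onI)
        fix s t :: real assume "s \<in> {0..1}" "t \<in> {0..1}" "c s = c t"
        then show "s = t" using *[of s t] *[of t s] by (metis linear)
      qed
    qed
    moreover have "c 0 = x" using g(2) by (simp add: c_def)
    moreover have "c 1 = z" using dl(3) by (simp add: c_def)
    ultimately have arc: "arc_joining (mtopology_of m) x z (c ` {0..1})"
      unfolding arc_joining_def by blast
    have "x \<noteq> z" using xyz seg_ends[OF assms(2,3)] by auto
    then have "\<exists>A. geodesic_segment m x z A \<and> (\<forall>B. arc_joining (mtopology_of m) x z B \<longrightarrow> B = A)"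
      using tree assms(1,3) by (simp add: real_tree_def)
    then have "geodesic_segment m x z (c ` {0..1})" using arc by auto
    then have "c ` {0..1} = sg x z" using geodesic_unique by blast
    moreover have "c (1/2) \<in> c ` {0..1}" by (intro imageI) simp
    ultimately have "w \<in> sg x z" using half by simp
    then show ?thesis using wy wz by blast
  qed
qed

section \<open>The four-point condition and its consequences\<close>

lemma seg_same_dist:
  assumes "z \<in> sg x y" "w \<in> sg x y" "x \<in> M" "y \<in> M"
  shows "d z w = \<bar>d x z - d x w\<bar>"
proof -
  obtain \<gamma> where g: "\<gamma> \<in> {0..d x y} \<rightarrow> M" "\<gamma> 0 = x" "\<gamma> (d x y) = y"
    "\<And>s t. s \<in> {0..d x y} \<Longrightarrow> t \<in> {0..d x y} \<Longrightarrow> d (\<gamma> s) (\<gamma> t) = \<bar>s - t\<bar>"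
    "\<gamma> ` {0..d x y} = sg x y"
    using geodesic_param[OF assms(3,4)] by metis
  obtain s t where st: "s \<in> {0..d x y}" "z = \<gamma> s" "t \<in> {0..d x y}" "w = \<gamma> t"
    using assms(1,2) unfolding g(5)[symmetric] by blast
  then show ?thesis using g(4)[of s t] g(4)[of 0 s] g(4)[of 0 t] g(2) by auto
qed

text \<open>Trees are 0-hyperbolic. The medians \<open>w\<close> of \<open>a\<close>,
  \<open>b\<close>, \<open>c\<close> and \<open>v\<close> of \<open>a\<close>, \<open>b\<close>,
  \<open>p\<close> both lie on \<open>sg a b\<close>, which reduces the inequality to the positions
  of two points on a line.\<close>

lemma four_point:
  assumes "a \<in> M" "b \<in> M" "c \<in> M" "p \<in> M"
  shows "d a b + d c p \<le> max (d a c + d b p) (d a p + d b c)"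
proof -
  obtain w where w: "w \<in> sg a b" "w \<in> sg b c" "w \<in> sg a c" using median assms by blast
  obtain v where v: "v \<in> sg a b" "v \<in> sg b p" "v \<in> sg a p" using median assms by blast
  have M: "w \<in> M" "v \<in> M" using w v by (auto simp: seg_def)
  have "d w v = \<bar>d a w - d a v\<bar>" using seg_same_dist w v assms by blast
  moreover have "d c p \<le> d c w + d w v + d v p"
    using tri[of c w p] tri[of w v p] M assms by auto
  moreover have "d a w + d w b = d a b" "d a v + d v b = d a b" "d b w + d w c = d b c"
    "d a w + d w c = d a c" "d b v + d v p = d b p" "d a v + d v p = d a p"
    using w v by (auto simp: seg_def)
  moreover have "d w b = d b w" "d v b = d b v" "d c w = d w c"
    using mdist_commute by metis+
  ultimately show ?thesis by linarith
qed

lemma seg_point: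
  assumes "x \<in> M" "y \<in> M" "0 \<le> t" "t \<le> d x y"
  shows "\<exists>z\<in>sg x y. d x z = t"
proof -
  obtain \<gamma> where g: "\<gamma> \<in> {0..d x y} \<rightarrow> M" "\<gamma> 0 = x" "\<gamma> (d x y) = y"
    "\<And>s t. s \<in> {0..d x y} \<Longrightarrow> t \<in> {0..d x y} \<Longrightarrow> d (\<gamma> s) (\<gamma> t) = \<bar>s - t\<bar>"
    "\<gamma> ` {0..d x y} = sg x y"
    using geodesic_param[OF assms(1,2)] by metis
  then show ?thesis using assms g(4)[of 0 t] by (intro bexI[of _ "\<gamma> t"]) auto
qed

text \<open>Triangles are tripods: the four-point inequality for \<open>x\<close>, \<open>y\<close>,
  \<open>w\<close>, \<open>z\<close> leaves no room for a third possibility. This is the device for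
  cutting a path at an intermediate point that need not lie on it.\<close>

lemma seg_split:
  assumes "w \<in> sg x y" "x \<in> M" "y \<in> M" "z \<in> M"
  shows "w \<in> sg x z \<or> w \<in> sg z y"
proof -
  have "w \<in> M" "d x w + d w y = d x y" using assms by (auto simp: seg_def)
  moreover have "d x y + d w z \<le> max (d x w + d y z) (d x z + d y w)"
    using four_point assms \<open>w \<in> M\<close> by blast
  moreover have "d x z \<le> d x w + d w z" "d z y \<le> d z w + d w y"
    using tri assms \<open>w \<in> M\<close> by auto
  moreover have "d z w = d w z" "d y z = d z y" "d y w = d w y" using mdist_commute by metis+
  ultimately show ?thesis by (auto simp: seg_def max_def split: if_splits)
qed

text \<open>Two geodesics that share a nondegenerate piece continue each other. With
  \<open>x = y\<close> they could fold back at the common point; the strict inequality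
  \<open>d x y > 0\<close> rules out one of the two alternatives in the four-point
  condition.\<close>

lemma seg_overlap:
  assumes "x \<in> sg a y" "y \<in> sg x b" "x \<noteq> y" "a \<in> M" "b \<in> M"
  shows "x \<in> sg a b" "y \<in> sg a b"
proof -
  have M: "x \<in> M" "y \<in> M" and e: "d a x + d x y = d a y" "d x y + d y b = d x b"
    using assms by (auto simp: seg_def)
  have "d x y > 0" using M assms(3) by (metis mdist_nonneg mdist_zero order_le_less)
  moreover have "d a y + d x b \<le> max (d a x + d y b) (d a b + d y x)"
    using four_point assms M by blast
  moreover have "d a b \<le> d a x + d x b" "d a b \<le> d a y + d y b"
    using tri assms M by auto
  moreover have "d y x = d x y" using mdist_commute by metis
  ultimately show "x \<in> sg a b" "y \<in> sg a b" using e M by (auto simp: seg_def)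
qed

lemma seg_subset:
  assumes "z \<in> sg x y" "w \<in> sg x y" "x \<in> M" "y \<in> M"
  shows "sg z w \<subseteq> sg x y"
proof -
  have *: "sg z w \<subseteq> sg x y" if le: "d x z \<le> d x w" and z: "z \<in> sg x y" and w: "w \<in> sg x y" for z w
  proof
    fix p assume p: "p \<in> sg z w"
    have M: "z \<in> M" "w \<in> M" "p \<in> M" using segD(1)[OF z] segD(1)[OF w] segD(1)[OF p] by auto
    have "d z w = d x w - d x z" using seg_same_dist[OF z w assms(3,4)] le by linarith
    then have "d w z + d z x = d w x"
      using mdist_commute[of m w z] mdist_commute[of m z x] mdist_commute[of m w x] by linarith
    then have "z \<in> sg w x" using M(1) unfolding seg_def by blast
    moreover have "p \<in> sg w z" using p by (subst seg_commute)
    ultimately have "p \<in> sg w x" using seg_trans(1) M(2) assms(3) by fast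
    then have "p \<in> sg x w" by (subst seg_commute)
    then show "p \<in> sg x y" using seg_trans(1)[OF w] assms by blast
  qed
  show ?thesis
  proof (cases "d x z \<le> d x w")
    case True then show ?thesis using * assms by blast
  next
    case False
    then have "sg w z \<subseteq> sg x y" using *[of w z] assms by linarith
    then show ?thesis by (subst seg_commute)
  qed
qed

lemma seg_dist_sum: "z \<in> sg x y \<Longrightarrow> d x z + d z y = d x y"
  by (rule segD)

lemma seg_in_M: "z \<in> sg x y \<Longrightarrow> z \<in> M"
  by (rule segD)

lemma dist_zeroD: "x \<in> M \<Longrightarrow> y \<in> M \<Longrightarrow> d x y \<le> 0 \<Longrightarrow> x = y"
  by (metis mdist_nonneg mdist_zero order_antisym)

lemma seg_dist_le:
  assumes "z \<in> sg x y" shows "d x z \<le> d x y"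
  using seg_dist_sum[OF assms] mdist_nonneg[of m z y] by linarith

lemma seg_antisym:
  assumes "x \<in> sg u v" "v \<in> sg u x" shows "x = v"
proof (rule dist_zeroD)
  show "d x v \<le> 0"
    using seg_dist_sum[OF assms(1)] seg_dist_sum[OF assms(2)] mdist_nonneg[of m x v]
      mdist_nonneg[of m v x] by linarith
qed (use assms seg_in_M in blast)+

lemma seg_interval:
  assumes "z \<in> sg x y" "w \<in> sg x y" "p \<in> sg x y" "x \<in> M" "y \<in> M"
    and "d x z \<le> d x p" "d x p \<le> d x w"
  shows "p \<in> sg z w"
proof -
  have "d z p + d p w = d z w"
    using seg_same_dist[OF assms(1,3,4,5)] seg_same_dist[OF assms(3,2,4,5)]
      seg_same_dist[OF assms(1,2,4,5)] assms(6,7) by linarith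
  then show ?thesis using seg_in_M[OF assms(3)] by (simp add: seg_def)
qed

lemma seg_eqI_dist:
  assumes "z \<in> sg x y" "w \<in> sg x y" "x \<in> M" "y \<in> M" "d x z = d x w"
  shows "z = w"
proof (rule dist_zeroD)
  show "d z w \<le> 0" using seg_same_dist[OF assms(1-4)] assms(5) by simp
qed (use assms seg_in_M in blast)+

text \<open>Parametrisation of \<open>sg x y\<close> by the distance from \<open>x\<close>; the
  value is unspecified for \<open>t\<close> outside \<open>{0..d x y}\<close>.\<close>

definition pt :: "'a \<Rightarrow> 'a \<Rightarrow> real \<Rightarrow> 'a" where
  "pt x y t = (SOME z. z \<in> sg x y \<and> d x z = t)"

lemma pt:
  assumes "x \<in> M" "y \<in> M" "t \<in> {0..d x y}"
  shows "pt x y t \<in> sg x y" "d x (pt x y t) = t"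
proof -
  have "\<exists>z. z \<in> sg x y \<and> d x z = t" using seg_point[OF assms(1,2), of t] assms(3) by auto
  from someI_ex[OF this] show "pt x y t \<in> sg x y" "d x (pt x y t) = t"
    by (simp_all add: pt_def)
qed

lemma pt_dist:
  assumes "x \<in> M" "y \<in> M" "s \<in> {0..d x y}" "t \<in> {0..d x y}"
  shows "d (pt x y s) (pt x y t) = \<bar>s - t\<bar>"
  using seg_same_dist[OF pt(1) pt(1)] pt(2) assms by simp

lemma pt_seg:
  assumes "z \<in> sg x y" "x \<in> M" "y \<in> M"
  shows "pt x y (d x z) = z" "d x z \<in> {0..d x y}"
proof -
  show *: "d x z \<in> {0..d x y}" using seg_dist_le[OF assms(1)] by simp
  show "pt x y (d x z) = z" using seg_eqI_dist[OF pt(1)[OF assms(2,3) *] assms] pt(2)[OF assms(2,3) *] by simp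
qed

lemma seg_image_pt:
  assumes "x \<in> M" "y \<in> M" shows "pt x y ` {0..d x y} = sg x y"
proof
  show "pt x y ` {0..d x y} \<subseteq> sg x y" using pt(1)[OF assms] by blast
  show "sg x y \<subseteq> pt x y ` {0..d x y}"
  proof
    fix z assume "z \<in> sg x y"
    from pt_seg[OF this assms] show "z \<in> pt x y ` {0..d x y}" by (metis imageI)
  qed
qed

lemma seg_nearest:
  assumes "finite (sg x y \<inter> W)" "w0 \<in> sg x y" "w0 \<in> W" "x \<in> M" "y \<in> M"
  shows "\<exists>w\<in>sg x y. w \<in> W \<and> sg x w \<inter> W = {w}"
proof -
  let ?S = "sg x y \<inter> W"
  have "?S \<noteq> {}" using assms by blast
  then have "Min (d x ` ?S) \<in> d x ` ?S" using assms(1) by (intro Min_in) auto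
  then obtain w where w: "w \<in> ?S" "d x w = Min (d x ` ?S)" by force
  have w_min: "d x w \<le> d x p" if "p \<in> ?S" for p
    unfolding w(2) using assms(1) that by (intro Min_le) auto
  have "p = w" if "p \<in> sg x w" "p \<in> W" for p
  proof -
    have wxy: "w \<in> sg x y" using w(1) by simp
    have p: "p \<in> sg x y" using seg_trans(1)[OF wxy that(1) assms(4,5)] .
    have "d x w \<le> d x p" using w_min p that by simp
    then have "d x p = d x w" using seg_dist_le[OF that(1)] by linarith
    then show ?thesis by (rule seg_eqI_dist[OF p wxy assms(4,5)])
  qed
  moreover have "w \<in> sg x w" using seg_ends[of x m w] assms(4) seg_in_M[of w x y] w(1) by simp
  ultimately show ?thesis using w(1) by blast
qed

end

text \<open>Every point of a geodesic in a tree separates its ends, so a continuous path cannot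
  avoid it. In detail, if the path \<open>c\<close> misses \<open>z\<close>, then whether
  \<open>z\<close> lies between \<open>f x\<close> and \<open>c t\<close> is locally constant in
  \<open>t\<close>, yet it changes from false at 0 to true at \<open>D\<close>.\<close>

lemma lipschitz_seg_image:
  assumes "real_tree m" "real_tree m'" "f \<in> mspace m \<rightarrow> mspace m'"
    and lip: "\<And>x y. x \<in> mspace m \<Longrightarrow> y \<in> mspace m \<Longrightarrow> mdist m' (f x) (f y) \<le> L * mdist m x y"
    and x: "x \<in> mspace m" and y: "y \<in> mspace m"
  shows "seg m' (f x) (f y) \<subseteq> f ` seg m x y"
proof (rule ccontr)
  interpret A: rtree m using assms by (simp add: rtree_def)
  interpret B: rtree m' using assms by (simp add: rtree_def)
  assume "\<not> ?thesis"
  then obtain z where z: "z \<in> B.sg (f x) (f y)" "z \<notin> f ` A.sg x y" by blast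
  define D where "D = A.d x y"
  define c where "c t = f (A.pt x y t)" for t
  have ptM: "A.pt x y t \<in> A.sg x y" if "t \<in> {0..D}" for t using A.pt(1) that x y D_def by blast
  have cM: "c t \<in> B.M" if "t \<in> {0..D}" for t
    unfolding c_def using ptM[OF that] A.seg_in_M assms(3) by blast
  have cz: "c t \<noteq> z" if "t \<in> {0..D}" for t
    unfolding c_def using ptM[OF that] z(2) by blast
  have zM: "z \<in> B.M" using z(1) B.seg_in_M by blast
  have fx: "f x \<in> B.M" using assms(3) x by blast
  have D0: "0 \<le> D" by (simp add: D_def)
  have c0: "c 0 = f x" and cD: "c D = f y"
    using A.pt_seg(1)[OF _ x y, of x] A.pt_seg(1)[OF _ x y, of y] seg_ends[OF x y] x
    by (simp_all add: c_def D_def)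
  have lc: "B.d (c s) (c t) \<le> L * \<bar>s - t\<bar>" if "s \<in> {0..D}" "t \<in> {0..D}" for s t
    using lip[OF A.seg_in_M[OF ptM[OF that(1)]] A.seg_in_M[OF ptM[OF that(2)]]]
      A.pt_dist[OF x y] that by (simp add: c_def D_def)
  \<comment> \<open>As long as the path moves by less than its distance to \<open>z\<close>, it
    cannot cross \<open>z\<close>; by \<open>seg_split\<close> this preserves
    \<open>Q\<close>.\<close>
  define Q where "Q t \<longleftrightarrow> z \<in> B.sg (f x) (c t)" for t
  have step: "Q t" if "Q s" "s \<in> {0..D}" "t \<in> {0..D}" "B.d (c s) (c t) < B.d z (c s)" for s t
  proof (rule ccontr)
    assume "\<not> Q t"
    then have "z \<in> B.sg (c t) (c s)"
      using B.seg_split[of z "f x" "c s" "c t"] that fx cM by (auto simp: Q_def)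
    then have "B.d (c t) z + B.d z (c s) = B.d (c t) (c s)" by (rule B.seg_dist_sum)
    then show False using that(4) mdist_nonneg[of m' "c t" z] mdist_commute[of m' "c t" "c s"] by linarith
  qed
  have "Q 0 = Q D"
  proof (rule connected_local_const[of "{0..D}"])
    show "\<forall>t\<in>{0..D}. \<forall>\<^sub>F s in at t within {0..D}. Q t = Q s"
    proof
      fix t assume t: "t \<in> {0..D}"
      define r where "r = B.d z (c t)"
      have r: "r > 0" using cz[OF t] cM[OF t] zM
        by (metis mdist_nonneg mdist_zero order_le_less r_def)
      \<comment> \<open>\<open>L\<close> may be negative, hence \<open>\<bar>L\<bar> + 1\<close>.
        With the factor 3 the displacement is at most a third of the distance \<open>r\<close> from
        \<open>c t\<close> to \<open>z\<close> and thus also less than the distance from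
        \<open>c s\<close> to \<open>z\<close>, so that \<open>step\<close> applies in both
        directions.\<close>
      define \<delta> where "\<delta> = r / (3 * (\<bar>L\<bar> + 1))"
      have "\<delta> > 0" using r by (simp add: \<delta>_def)
      moreover have "Q t = Q s" if s: "s \<in> {0..D}" "dist s t < \<delta>" for s
      proof -
        have "B.d (c s) (c t) \<le> (\<bar>L\<bar> + 1) * \<bar>s - t\<bar>"
          using lc[OF s(1) t] by (smt (verit) abs_ge_self mult_right_mono abs_ge_zero)
        also have "\<dots> \<le> (\<bar>L\<bar> + 1) * \<delta>" using s(2) by (intro mult_left_mono) (auto simp: dist_real_def)
        also have "\<dots> = r / 3" by (simp add: \<delta>_def field_simps)
        finally have *: "B.d (c s) (c t) \<le> r / 3" .
        then have "B.d (c t) (c s) < B.d z (c t)" using r mdist_commute[of m' "c t" "c s"] r_def by simp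
        moreover have "B.d (c s) (c t) < B.d z (c s)"
        proof -
          have "r \<le> B.d z (c s) + B.d (c s) (c t)"
            unfolding r_def using B.tri zM cM s(1) t by blast
          then show ?thesis using * r by linarith
        qed
        ultimately show ?thesis using step s(1) t by blast
      qed
      ultimately show "\<forall>\<^sub>F s in at t within {0..D}. Q t = Q s"
        unfolding eventually_at by blast
    qed
  qed (use D0 in auto)
  moreover have "Q D" using z(1) cD by (simp add: Q_def)
  moreover have "\<not> Q 0" using cz[of 0] c0 fx D0 by (auto simp: Q_def)
  ultimately show False by blast
qed

section \<open>Edges of simplicial trees\<close>

context rtree begin

text \<open>The nearest points of \<open>W\<close> on both sides of \<open>x\<close>. The statement
  is about an arbitrary set \<open>W\<close>, because \<open>stree_refine\<close> applies it to a
  vertex set that is not yet known to be simplicial.\<close>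

lemma vertices_around:
  assumes "u \<in> W" "v \<in> W" "W \<subseteq> M" "x \<in> sg u v" "x \<notin> W"
    and fin: "\<And>x y. x \<in> M \<Longrightarrow> y \<in> M \<Longrightarrow> finite (sg x y \<inter> W)"
  obtains u' v' where "u' \<in> W" "v' \<in> W" "u' \<noteq> v'" "u' \<in> sg u v" "v' \<in> sg u v" "x \<in> sg u' v'"
    "sg u' v' \<inter> W = {u', v'}"
proof -
  have M: "u \<in> M" "v \<in> M" "x \<in> M" using assms(1-3) seg_in_M[OF assms(4)] by auto
  have near: "\<exists>w\<in>sg x a. w \<in> W \<and> sg x w \<inter> W = {w}" if a: "a \<in> W" for a
  proof -
    have aM: "a \<in> M" using a assms(3) by auto
    show ?thesis
      by (rule seg_nearest[OF fin[OF M(3) aM] _ _ M(3) aM, of a])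
        (use seg_ends[OF M(3) aM] a in auto)
  qed
  obtain u' where u': "u' \<in> sg x u" "u' \<in> W" "sg x u' \<inter> W = {u'}" using near[OF assms(1)] by auto
  obtain v' where v': "v' \<in> sg x v" "v' \<in> W" "sg x v' \<inter> W = {v'}" using near[OF assms(2)] by auto
  have M': "u' \<in> M" "v' \<in> M" using u' v' assms(3) by auto
  have u'x: "u' \<in> sg u x" using u'(1) by (subst seg_commute)
  have v'x: "v' \<in> sg v x" using v'(1) by (subst seg_commute)
  have xu: "x \<in> sg v u" using assms(4) by (subst seg_commute)
  have "x \<in> sg u' v" using seg_trans(2)[OF assms(4) u'x M(1,2)] .
  then have 1: "x \<in> sg v u'" by (subst seg_commute)
  have "x \<in> sg v' u'" using seg_trans(2)[OF 1 v'x M(2) M'(1)] .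
  then have xuv: "x \<in> sg u' v'" by (subst seg_commute)
  have ne: "u' \<noteq> v'" using xuv M' u'(2) assms(5) by auto
  have "sg u' v' \<inter> W = {u', v'}"
  proof
    show "sg u' v' \<inter> W \<subseteq> {u', v'}"
    proof
      fix p assume p: "p \<in> sg u' v' \<inter> W"
      then have "p \<in> sg u' x \<or> p \<in> sg x v'" using seg_split[OF _ M' M(3)] by simp
      then have "p \<in> sg x u' \<inter> W \<or> p \<in> sg x v' \<inter> W"
        using p unfolding seg_commute[of m u' x] by simp
      then show "p \<in> {u', v'}" unfolding u'(3) v'(3) by simp
    qed
    show "{u', v'} \<subseteq> sg u' v' \<inter> W" using u'(2) v'(2) seg_ends[OF M'] by simp
  qed
  moreover have "v' \<in> sg v u" using seg_trans(1)[OF xu v'x M(2,1)] .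
  then have "v' \<in> sg u v" by (subst seg_commute)
  ultimately show thesis
    using that u'(2) v'(2) ne xuv seg_trans(1)[OF assms(4) u'x M(1,2)] by blast
qed

end

locale stree = rtree +
  fixes V :: "'a set"
  assumes simplicial: "simplicial_real_tree m V"
begin

abbreviation "E \<equiv> tree_edges m V"

lemma V_subset: "V \<subseteq> M"
  using simplicial by (simp add: simplicial_real_tree_def)

lemma V_in_M: "v \<in> V \<Longrightarrow> v \<in> M"
  using V_subset by blast

lemma finite_seg_V: "finite (sg x y \<inter> V)" if "x \<in> M" "y \<in> M" for x y
  using simplicial that by (simp add: simplicial_real_tree_def geodesic_segment_iff)

lemma edge_iff: "e \<in> E \<longleftrightarrow> (\<exists>u v. u \<in> V \<and> v \<in> V \<and> u \<noteq> v \<and> e = sg u v \<and> e \<inter> V = {u, v})"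
  using V_in_M by (auto simp: tree_edges_def edge_joining_def geodesic_segment_iff)

lemma edgeE:
  assumes "e \<in> E"
  obtains u v where "u \<in> V" "v \<in> V" "u \<noteq> v" "e = sg u v" "e \<inter> V = {u, v}" "u \<in> M" "v \<in> M"
  using assms edge_iff V_in_M by auto

lemma edge_in_M: "e \<in> E \<Longrightarrow> x \<in> e \<Longrightarrow> x \<in> M"
  using edge_iff seg_in_M by auto

lemma edge_exists: "x \<in> M \<Longrightarrow> x \<notin> V \<Longrightarrow> \<exists>e\<in>E. x \<in> e"
  using simplicial unfolding simplicial_real_tree_def by blast

lemma edge_unique: "e \<in> E \<Longrightarrow> e' \<in> E \<Longrightarrow> x \<in> e \<Longrightarrow> x \<in> e' \<Longrightarrow> x \<notin> V \<Longrightarrow> e = e'"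
  using simplicial edge_in_M[of e x] unfolding simplicial_real_tree_def by blast

text \<open>Prolongs the geodesic from \<open>y\<close> to \<open>x\<close> to an end of the edge:
  by \<open>seg_split\<close>, one of the two ends lies behind \<open>x\<close> as seen from
  \<open>y\<close>.\<close>

lemma edge_end_beyond:
  assumes "e \<in> E" "x \<in> e" "x \<notin> V" "y \<in> M"
  shows "\<exists>a\<in>V. x \<in> sg a y \<and> sg a x \<inter> V = {a} \<and> sg a x \<subseteq> e"
proof -
  obtain u v where e: "u \<in> V" "v \<in> V" "u \<noteq> v" "e = sg u v" "e \<inter> V = {u, v}" "u \<in> M" "v \<in> M"
    using edgeE[OF assms(1)] .
  have x: "x \<in> sg u v" "x \<in> sg v u" using assms e(4) seg_commute[of m u v] by auto
  have *: "sg a x \<inter> V = {a}" "sg a x \<subseteq> e"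
    if a: "a \<in> M" "b \<in> M" "a \<in> V" "x \<in> sg a b" "e = sg a b" "e \<inter> V = {a, b}" for a b
  proof -
    have sub: "sg a x \<subseteq> sg a b" using seg_subset[OF _ a(4) a(1,2)] seg_ends[OF a(1,2)] by blast
    have "b \<notin> sg a x" using seg_antisym[OF a(4)] assms(3) a(6) by blast
    moreover have "a \<in> sg a x" using seg_ends[OF a(1) seg_in_M[OF a(4)]] by blast
    ultimately show "sg a x \<inter> V = {a}" using sub a by blast
    show "sg a x \<subseteq> e" using sub a by simp
  qed
  have "x \<in> sg u y \<or> x \<in> sg y v" using seg_split[OF x(1) e(6,7) assms(4)] .
  then show ?thesis
  proof
    assume "x \<in> sg u y"
    then show ?thesis using *[OF e(6,7,1) x(1) e(4,5)] e(1) by blast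
  next
    assume "x \<in> sg y v"
    then have "x \<in> sg v y" by (subst seg_commute)
    moreover have "e = sg v u" "e \<inter> V = {v, u}" using e(4,5) seg_commute[of m u v] by auto
    ultimately show ?thesis using *[OF e(7,6,2) x(2)] e(2) by blast
  qed
qed

text \<open>Prolonging a vertex-free segment to the far ends of the edges at its two end points gives an
  edge, so uniqueness of the edge through a point keeps such a segment inside a single edge.\<close>

lemma edge_vertex_free_seg:
  assumes "e \<in> E" "x \<in> e" "x \<notin> V" "y \<in> M" "sg x y \<inter> V = {}"
  shows "y \<in> e"
proof (cases "x = y")
  case True then show ?thesis using assms by simp
next
  case False
  have xM: "x \<in> M" using edge_in_M assms by blast
  have yV: "y \<notin> V" using seg_ends[OF xM assms(4)] assms(5) by blast
  obtain e' where e': "e' \<in> E" "y \<in> e'" using edge_exists assms(4) yV by blast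
  obtain a where a: "a \<in> V" "x \<in> sg a y" "sg a x \<inter> V = {a}"
    using edge_end_beyond[OF assms(1-4)] by blast
  obtain b where b: "b \<in> V" "y \<in> sg b x" "sg b y \<inter> V = {b}"
    using edge_end_beyond[OF e' yV xM] by blast
  have abM: "a \<in> M" "b \<in> M" using a b V_in_M by auto
  have "y \<in> sg x b" using b(2) by (subst seg_commute)
  note ov = seg_overlap[OF a(2) this False abM]
  have "sg a b \<subseteq> sg a x \<union> sg x y \<union> sg b y"
  proof
    fix p assume p: "p \<in> sg a b"
    then have "p \<in> sg a x \<or> p \<in> sg x b" using seg_split abM xM by blast
    moreover have "p \<in> sg x y \<or> p \<in> sg y b" if "p \<in> sg x b"
      using seg_split[OF that xM abM(2) assms(4)] .
    ultimately show "p \<in> sg a x \<union> sg x y \<union> sg b y" using seg_commute[of m b y] by blast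
  qed
  then have "sg a b \<inter> V \<subseteq> {a, b}" using a(3) b(3) assms(5) by blast
  moreover have "{a, b} \<subseteq> sg a b" using seg_ends[OF abM] by blast
  ultimately have "sg a b \<inter> V = {a, b}" using a(1) b(1) by blast
  moreover have "a \<noteq> b"
  proof
    assume "a = b"
    then have "x \<in> {a}" using ov(1) abM by simp
    then show False using a(1) assms(3) by simp
  qed
  ultimately have "sg a b \<in> E" using edge_iff a(1) b(1) by blast
  then have "e = sg a b" using edge_unique[OF assms(1) _ assms(2) ov(1) assms(3)] by blast
  then show ?thesis using ov(2) by simp
qed

text \<open>The first vertex \<open>w\<close> on the way must belong to \<open>e\<close>: all points
  before it do, by \<open>edge_vertex_free_seg\<close>, and an edge, being a metric interval, is
  closed.\<close>

lemma edge_exit: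
  assumes "e \<in> E" "x \<in> e" "x \<notin> V" "y \<in> M" "y \<notin> e"
  shows "\<exists>w\<in>sg x y. w \<in> e \<and> w \<in> V"
proof -
  have xM: "x \<in> M" using edge_in_M assms by blast
  obtain w0 where w0: "w0 \<in> sg x y" "w0 \<in> V" using edge_vertex_free_seg[OF assms(1-4)] assms(5) by auto
  then obtain w where w: "w \<in> sg x y" "w \<in> V" "sg x w \<inter> V = {w}"
    using seg_nearest[OF finite_seg_V[OF xM assms(4)] w0 xM assms(4)] by auto
  have wM: "w \<in> M" using w V_in_M by blast
  obtain u v where e: "u \<in> V" "v \<in> V" "u \<noteq> v" "e = sg u v" "e \<inter> V = {u, v}" "u \<in> M" "v \<in> M"
    using edgeE[OF assms(1)] .
  have "d u w + d w v \<le> d u v + \<epsilon>" if "\<epsilon> > 0" for \<epsilon>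
  proof -
    \<comment> \<open>A point of the segment strictly before \<open>w\<close> and at most
      \<open>\<epsilon> / 2\<close> away from it. It is used for the distances to both ends of the
      edge, so the error is at most \<open>\<epsilon>\<close>.\<close>
    define t where "t = max 0 (d x w - \<epsilon> / 2)"
    have "x \<noteq> w" using w(2) assms(3) by auto
    then have xw: "d x w > 0" using dist_zeroD[OF xM wM] by linarith
    have t: "t \<in> {0..d x w}" "t < d x w" "d x w - t \<le> \<epsilon> / 2"
      using that xw by (auto simp: t_def max_def)
    define p where "p = pt x w t"
    have p: "p \<in> sg x w" "d x p = t" using pt[OF xM wM t(1)] by (simp_all add: p_def)
    have pM: "p \<in> M" using seg_in_M p(1) .
    have "sg x p \<subseteq> sg x w" using seg_subset[OF _ p(1) xM wM] seg_ends[OF xM wM] by blast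
    moreover have "w \<notin> sg x p" using seg_dist_le[of w x p] p(2) t(2) by auto
    ultimately have "sg x p \<inter> V = {}" using w(3) by auto
    then have "p \<in> e" by (rule edge_vertex_free_seg[OF assms(1-3) pM])
    then have "d u p + d p v = d u v" using e(4) seg_dist_sum by simp
    moreover have "d u w \<le> d u p + d p w" "d w v \<le> d w p + d p v" using tri e pM wM by auto
    moreover have "d p w \<le> \<epsilon> / 2" using seg_dist_sum[OF p(1)] p(2) t(3) by linarith
    ultimately show ?thesis using mdist_commute[of m w p] by linarith
  qed
  then have "d u w + d w v \<le> d u v" by (rule field_le_epsilon)
  moreover have "d u v \<le> d u w + d w v" using tri e wM by blast
  ultimately have "w \<in> e" using e(4) wM by (simp add: seg_def)
  then show ?thesis using w by blast
qed

text \<open>If an end \<open>a\<close> of the new edge \<open>e1\<close> lay outside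
  \<open>e\<close>, the way from \<open>x\<close> to \<open>a\<close> would leave \<open>e\<close>
  at an old vertex. The only points of \<open>W\<close> on \<open>e1\<close> are its ends, so this
  vertex is the other end; but \<open>x\<close> lies between the two ends.\<close>

lemma refined_edge_subset:
  assumes W: "V \<subseteq> W" "W \<subseteq> M" and e: "e \<in> E" "x \<in> e" and x: "x \<notin> W"
    and e1': "e1 \<in> tree_edges m W" "x \<in> e1"
  shows "e1 \<subseteq> e"
proof -
  obtain u1 v1 where e1'': "u1 \<in> W" "v1 \<in> W" "e1 = sg u1 v1" "e1 \<inter> W = {u1, v1}"
    using e1'(1) by (auto simp: tree_edges_def edge_joining_def geodesic_segment_iff)
  note e1 = e1'' e1'(2)
  have uvM: "u1 \<in> M" "v1 \<in> M" using e1 W(2) by auto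
  have xM: "x \<in> M" using e edge_in_M by blast
  have xV: "x \<notin> V" using x W(1) by blast
  have end_in: "a \<in> e" if a: "a \<in> W" "b \<in> W" "a \<in> M" "b \<in> M" "e1 = sg a b" "e1 \<inter> W = {a, b}" for a b
  proof (rule ccontr)
    assume "a \<notin> e"
    then obtain w where w: "w \<in> sg x a" "w \<in> e" "w \<in> V"
      using edge_exit[OF e xV a(3)] by auto
    have xab: "x \<in> sg a b" "x \<in> sg b a" using e1(5) unfolding a(5) seg_commute[of m b a] by simp_all
    have "sg x a \<subseteq> sg a b" using seg_subset[OF xab(1) _ a(3,4)] seg_ends[OF a(3,4)] by blast
    then have "w = a \<or> w = b" using w W(1) a(5,6) by blast
    then have "b \<in> sg x a" using w \<open>a \<notin> e\<close> by auto
    then have "b \<in> sg a x" by (subst seg_commute)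
    then have "x = b" using seg_antisym[OF xab(1)] by simp
    then show False using x a by simp
  qed
  have "u1 \<in> e" using end_in[OF e1(1,2) uvM e1(3,4)] .
  moreover have "v1 \<in> e"
    using end_in[OF e1(2,1) uvM(2,1)] e1(3,4) seg_commute[of m u1 v1] by (simp add: insert_commute)
  moreover obtain u v where "e = sg u v" "u \<in> M" "v \<in> M" using edgeE[OF e(1)] by metis
  ultimately show ?thesis using seg_subset e1(3) by simp
qed

text \<open>Only uniqueness of the new edge through \<open>x\<close> needs work. All candidates lie
  in the old edge through \<open>x\<close>, hence on one line; their ends are the points of
  \<open>W\<close> next to \<open>x\<close> on either side and therefore agree.\<close>

lemma stree_refine:
  assumes "V \<subseteq> W" "W \<subseteq> M" and fin: "\<And>x y. x \<in> M \<Longrightarrow> y \<in> M \<Longrightarrow> finite (sg x y \<inter> W)"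
  shows "simplicial_real_tree m W"
proof -
  have ex: "\<exists>e. e \<in> tree_edges m W \<and> x \<in> e" if x: "x \<in> M" "x \<notin> W" for x
  proof -
    have "x \<notin> V" using x(2) assms(1) by auto
    then obtain e where e: "e \<in> E" "x \<in> e" using edge_exists[OF x(1)] by auto
    obtain u v where uv: "u \<in> V" "v \<in> V" "u \<noteq> v" "e = sg u v" "e \<inter> V = {u, v}" "u \<in> M" "v \<in> M"
      using edgeE[OF e(1)] .
    have "u \<in> W" "v \<in> W" "x \<in> sg u v" using uv assms(1) e(2) by auto
    from vertices_around[OF this(1,2) assms(2) this(3) x(2) fin]
    obtain u' v' where "u' \<in> W" "v' \<in> W" "u' \<noteq> v'" "x \<in> sg u' v'" "sg u' v' \<inter> W = {u', v'}"
      by metis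
    then have "edge_joining m W u' v' (sg u' v')" "x \<in> sg u' v'"
      using assms(2) by (auto simp add: edge_joining_def geodesic_segment_iff)
    then show ?thesis by (auto simp: tree_edges_def)
  qed
  have uniq: "e1 = e2"
    if e12: "e1 \<in> tree_edges m W" "e2 \<in> tree_edges m W" "x \<in> e1" "x \<in> e2" and xM: "x \<in> M" and "x \<notin> W" for e1 e2 x
  proof -
    have "x \<notin> V" using that(6) assms(1) by auto
    then obtain e where e: "e \<in> E" "x \<in> e" using edge_exists[OF xM] by auto
    obtain u v where uv: "u \<in> V" "v \<in> V" "u \<noteq> v" "e = sg u v" "e \<inter> V = {u, v}" "u \<in> M" "v \<in> M"
      using edgeE[OF e(1)] .
    \<comment> \<open>Orients a new edge along the old one, so that \<open>a\<close> comes before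
      \<open>x\<close> and \<open>b\<close> after it.\<close>
    have norm: "\<exists>a b. a \<in> W \<and> b \<in> W \<and> e' = sg a b \<and> e' \<inter> W = {a, b} \<and> a \<in> sg u v \<and> b \<in> sg u v
        \<and> d u a < d u x \<and> d u x < d u b"
      if e': "e' \<in> tree_edges m W" "x \<in> e'" for e'
    proof -
      obtain a b where ab: "a \<in> W" "b \<in> W" "e' = sg a b" "e' \<inter> W = {a, b}"
        using e' by (auto simp: tree_edges_def edge_joining_def geodesic_segment_iff)
      have abM: "a \<in> M" "b \<in> M" using ab assms(2) by auto
      have sub: "e' \<subseteq> sg u v" using refined_edge_subset[OF assms(1,2) e \<open>x \<notin> W\<close> e'] uv(4) by simp
      have au: "a \<in> sg u v" "b \<in> sg u v" using sub ab by auto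
      have x': "x \<in> sg u v" using sub e' by auto
      have nab: "x \<noteq> a" "x \<noteq> b" using ab \<open>x \<notin> W\<close> by auto
      have ne: "d u a \<noteq> d u x" "d u b \<noteq> d u x"
        using seg_eqI_dist[OF au(1) x' uv(6,7)] seg_eqI_dist[OF au(2) x' uv(6,7)] nab by auto
      have "d a x + d x b = d a b" using e'(2) ab(3) seg_dist_sum by simp
      then have "\<bar>d u a - d u x\<bar> + \<bar>d u x - d u b\<bar> = \<bar>d u a - d u b\<bar>"
        using seg_same_dist[OF au(1) x' uv(6,7)] seg_same_dist[OF x' au(2) uv(6,7)]
          seg_same_dist[OF au(1) au(2) uv(6,7)] by simp
      then consider "d u a < d u x" "d u x < d u b" | "d u b < d u x" "d u x < d u a"
        using ne by linarith
      then show ?thesis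
      proof cases
        case 1 then show ?thesis using ab au by (intro exI[of _ a] exI[of _ b]) simp
      next
        case 2
        have "e' = sg b a" "e' \<inter> W = {b, a}" using ab(3,4) seg_commute[of m a b] by auto
        then show ?thesis using ab au 2 by (intro exI[of _ b] exI[of _ a]) simp
      qed
    qed
    obtain a b where 1: "a \<in> W" "b \<in> W" "e1 = sg a b" "e1 \<inter> W = {a, b}" "a \<in> sg u v" "b \<in> sg u v"
      "d u a < d u x" "d u x < d u b" using norm[OF e12(1,3)] by auto
    obtain a' b' where 2: "a' \<in> W" "b' \<in> W" "e2 = sg a' b'" "e2 \<inter> W = {a', b'}" "a' \<in> sg u v" "b' \<in> sg u v"
      "d u a' < d u x" "d u x < d u b'" using norm[OF e12(2,4)] by auto
    have key: "p = a \<or> p = b"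
      if "p \<in> W" "p \<in> sg u v" "a \<in> sg u v" "b \<in> sg u v" "d u a \<le> d u p" "d u p \<le> d u b" "sg a b \<inter> W = {a, b}" for p a b
      using seg_interval[OF that(3,4,2) uv(6,7) that(5,6)] that(1,7) by auto
    have "a = a'"
    proof (cases "d u a \<le> d u a'")
      case True
      then show ?thesis using key[OF 2(1,5) 1(5,6)] 1(3,4,7,8) 2(7,8) by auto
    next
      case False
      then show ?thesis using key[OF 1(1,5) 2(5,6)] 2(3,4,7,8) 1(7,8) by auto
    qed
    moreover have "b = b'"
    proof (cases "d u b \<le> d u b'")
      case True
      then show ?thesis using key[OF 1(2,6) 2(5,6)] 2(3,4,7,8) 1(7,8) by auto
    next
      case False
      then show ?thesis using key[OF 2(2,6) 1(5,6)] 1(3,4,7,8) 2(7,8) by auto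
    qed
    ultimately show ?thesis using 1(3) 2(3) by simp
  qed
  show ?thesis
    unfolding simplicial_real_tree_def
  proof (intro conjI allI impI ballI)
    show "real_tree m" by (rule tree)
    show "W \<subseteq> M" by (rule assms(2))
    show "finite (A \<inter> W)" if "geodesic_segment m x y A" for x y A
      using that fin by (simp add: geodesic_segment_iff)
    show "\<exists>!e. e \<in> tree_edges m W \<and> x \<in> e" if "x \<in> M - W" for x
      using ex[of x] uniq[of _ _ x] that by (intro ex_ex1I) auto
  qed
qed

text \<open>The vertices on \<open>sg a b\<close> next to \<open>k\<close> bound an edge through
  \<open>k\<close>, and there is only one such edge.\<close>

lemma edge_subset_seg:
  assumes "a \<in> V" "b \<in> V" "e \<in> E" "k \<in> e" "k \<notin> V" "k \<in> sg a b"
  shows "e \<subseteq> sg a b"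
proof -
  obtain u v where uv: "u \<in> V" "v \<in> V" "u \<noteq> v" "u \<in> sg a b" "v \<in> sg a b" "k \<in> sg u v"
    "sg u v \<inter> V = {u, v}"
    using vertices_around[OF assms(1,2) V_subset assms(6,5) finite_seg_V] by metis
  then have "sg u v \<in> E" using edge_iff by auto
  then have "e = sg u v" using edge_unique assms(3-5) uv(6) by blast
  then show ?thesis using seg_subset[OF uv(4,5)] V_in_M assms(1,2) by simp
qed

lemma edge_eqI:
  assumes "e \<in> E" "e' \<in> E" "e \<inter> V = e' \<inter> V" shows "e = e'"
proof -
  obtain u v where 1: "e = sg u v" "e \<inter> V = {u, v}" using edgeE[OF assms(1)] by metis
  obtain u' v' where 2: "e' = sg u' v'" "e' \<inter> V = {u', v'}" using edgeE[OF assms(2)] by metis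
  have "{u, v} = {u', v'}" using 1(2) 2(2) assms(3) by simp
  then have "u = u' \<and> v = v' \<or> u = v' \<and> v = u'" by (simp only: doubleton_eq_iff)
  then show ?thesis using 1(1) 2(1) seg_commute[of m u v] by auto
qed

end

section \<open>Group actions on trees\<close>

locale gtree =
  fixes F :: "('g, 'm) monoid_scheme" (structure) and \<Gamma> :: "('g, 'a) acted_tree"
  assumes grp: "group F" and fg: "finitely_generated F" and outer: "\<Gamma> \<in> outer_trees F"
begin

abbreviation "G \<equiv> carrier F"
abbreviation "ac \<equiv> act \<Gamma>"
abbreviation "W \<equiv> verts \<Gamma> \<union> inverted_midpoints F \<Gamma>"

lemma isometric_action: "isometric_tree_action F \<Gamma>"
  using outer by (simp add: outer_trees_def)

sublocale rtree "metr \<Gamma>"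
  using isometric_action
  by unfold_locales (simp add: isometric_tree_action_def simplicial_real_tree_def)

sublocale V: stree "metr \<Gamma>" "verts \<Gamma>"
  using isometric_action
  by unfold_locales (simp add: isometric_tree_action_def)

sublocale F: group F by (rule grp)

lemma group_action: "group_action F (M) ac"
  using isometric_action by (simp add: isometric_tree_action_def)

lemma act_closed: "g \<in> G \<Longrightarrow> x \<in> M \<Longrightarrow> ac g x \<in> M"
  using group_action.element_image[OF group_action] by blast

lemma act_mult: "g \<in> G \<Longrightarrow> h \<in> G \<Longrightarrow> x \<in> M \<Longrightarrow> ac (g \<otimes> h) x = ac g (ac h x)"
  using group_action.composition_rule[OF group_action] by blast

lemma act_one: "x \<in> M \<Longrightarrow> ac \<one> x = x"
  using group_action.id_eq_one[OF group_action] by (metis restrict_apply')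

lemma act_inv1: "g \<in> G \<Longrightarrow> x \<in> M \<Longrightarrow> ac (inv g) (ac g x) = x"
  using act_mult[of "inv g" g x] act_one[of x] by simp

lemma act_inv2: "g \<in> G \<Longrightarrow> x \<in> M \<Longrightarrow> ac g (ac (inv g) x) = x"
  using act_mult[of g "inv g" x] act_one[of x] by simp

lemma act_isom:
  "g \<in> G \<Longrightarrow> x \<in> M \<Longrightarrow> y \<in> M \<Longrightarrow> d (ac g x) (ac g y) = d x y"
  using isometric_action by (simp add: isometric_tree_action_def)

lemma act_seg_mem:
  assumes "g \<in> G" "x \<in> M" "y \<in> M" "z \<in> sg x y"
  shows "ac g z \<in> sg (ac g x) (ac g y)"
  using assms act_closed act_isom by (auto simp: seg_def)

lemma act_seg:
  assumes "g \<in> G" "x \<in> M" "y \<in> M"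
  shows "ac g ` sg x y = sg (ac g x) (ac g y)"
proof
  show "ac g ` sg x y \<subseteq> sg (ac g x) (ac g y)"
    using act_seg_mem[OF assms] by auto
  show "sg (ac g x) (ac g y) \<subseteq> ac g ` sg x y"
  proof
    fix z assume z: "z \<in> sg (ac g x) (ac g y)"
    have "ac (inv g) z \<in> sg x y"
      using act_seg_mem[OF _ act_closed act_closed z, of "inv g"] assms
      by (simp add: act_inv1)
    moreover have "z = ac g (ac (inv g) z)" using act_inv2 assms(1) seg_in_M[OF z] by simp
    ultimately show "z \<in> ac g ` sg x y" by blast
  qed
qed

lemma act_inj: "g \<in> G \<Longrightarrow> x \<in> M \<Longrightarrow> y \<in> M \<Longrightarrow> ac g x = ac g y \<Longrightarrow> x = y"
  by (metis act_inv1)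

lemma act_verts: "g \<in> G \<Longrightarrow> v \<in> verts \<Gamma> \<Longrightarrow> ac g v \<in> verts \<Gamma>"
  using isometric_action unfolding isometric_tree_action_def by blast

lemma act_invariant_iff:
  assumes "\<And>g v. g \<in> G \<Longrightarrow> v \<in> U \<Longrightarrow> ac g v \<in> U" "g \<in> G" "x \<in> M"
  shows "ac g x \<in> U \<longleftrightarrow> x \<in> U"
  using assms(1)[of "inv g" "ac g x"] assms act_inv1 by auto

lemma act_tree_edges:
  assumes inv: "\<And>g v. g \<in> G \<Longrightarrow> v \<in> U \<Longrightarrow> ac g v \<in> U" and "U \<subseteq> M" and g: "g \<in> G"
    and "edge_joining (metr \<Gamma>) U u v e"
  shows "edge_joining (metr \<Gamma>) U (ac g u) (ac g v) (ac g ` e)"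
proof -
  have e: "u \<in> U" "v \<in> U" "u \<noteq> v" "e = sg u v" "e \<inter> U = {u, v}" "u \<in> M" "v \<in> M"
    using assms(4) by (auto simp: edge_joining_def geodesic_segment_iff)
  have "ac g ` e \<inter> U = ac g ` (e \<inter> U)"
    using act_invariant_iff[OF inv g] seg_in_M e(4) by auto
  then have "ac g ` e \<inter> U = {ac g u, ac g v}" using e(5) by simp
  moreover have "ac g u \<noteq> ac g v" using act_inj g e by blast
  moreover have "ac g ` e = sg (ac g u) (ac g v)" using act_seg[OF g e(6,7)] e(4) by simp
  ultimately show ?thesis
    using inv[OF g] e act_closed[OF g] by (simp add: edge_joining_def geodesic_segment_iff)
qed

section \<open>Inverted edges and the subdivided tree\<close>

lemma inverted_midpointE:
  assumes "p \<in> inverted_midpoints F \<Gamma>"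
  obtains u v e g where "edge_joining (metr \<Gamma>) (verts \<Gamma>) u v e" "g \<in> G" "ac g u = v" "ac g v = u"
    "p \<in> e" "d u p = d p v"
    "e = sg u v" "u \<in> M" "v \<in> M" "p \<in> M" "e \<inter> verts \<Gamma> = {u, v}" "u \<noteq> v"
proof -
  obtain u v e g where 1: "edge_joining (metr \<Gamma>) (verts \<Gamma>) u v e" "g \<in> G" "ac g u = v" "ac g v = u"
    "p \<in> e" "d u p = d p v"
    using assms unfolding inverted_midpoints_def by blast
  have e: "u \<in> verts \<Gamma>" "v \<in> verts \<Gamma>" "u \<noteq> v" "e = sg u v" "e \<inter> verts \<Gamma> = {u, v}"
    "u \<in> M" "v \<in> M"
    using 1(1) by (auto simp: edge_joining_def geodesic_segment_iff)
  have "p \<in> M" using seg_in_M 1(5) e(4) by auto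
  then show thesis using that 1 e by blast
qed

lemma act_midpoints:
  assumes g: "g \<in> G" and p: "p \<in> inverted_midpoints F \<Gamma>"
  shows "ac g p \<in> inverted_midpoints F \<Gamma>"
proof -
  obtain u v e h where e: "edge_joining (metr \<Gamma>) (verts \<Gamma>) u v e" and h: "h \<in> G" "ac h u = v" "ac h v = u"
    and p: "p \<in> e" "d u p = d p v"
    and M: "u \<in> M" "v \<in> M" "p \<in> M"
    by (rule inverted_midpointE[OF p])
  let ?k = "g \<otimes> h \<otimes> inv g"
  have k: "ac ?k (ac g x) = ac g (ac h x)" if "x \<in> M" for x
  proof -
    have "ac ?k (ac g x) = ac (g \<otimes> h) (ac (inv g) (ac g x))"
      using act_mult[of "g \<otimes> h" "inv g" "ac g x"] g h act_closed[OF g that] by simp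
    then show ?thesis using act_inv1[OF g that] act_mult[OF g h(1) that] by simp
  qed
  have "edge_joining (metr \<Gamma>) (verts \<Gamma>) (ac g u) (ac g v) (ac g ` e)"
    using act_tree_edges[OF act_verts V.V_subset g e] .
  moreover have "?k \<in> G" using g h by simp
  moreover have "ac ?k (ac g u) = ac g v" "ac ?k (ac g v) = ac g u" using k M h by auto
  moreover have "ac g p \<in> ac g ` e" using p by blast
  moreover have "d (ac g u) (ac g p) = d (ac g p) (ac g v)"
    using act_isom[OF g] M p by simp
  ultimately show ?thesis unfolding inverted_midpoints_def by blast
qed

lemma act_W: "g \<in> G \<Longrightarrow> v \<in> W \<Longrightarrow> ac g v \<in> W"
  using act_verts act_midpoints by blast

lemma midpoint_notin_verts:
  assumes "p \<in> inverted_midpoints F \<Gamma>" shows "p \<notin> verts \<Gamma>"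
proof
  assume pv: "p \<in> verts \<Gamma>"
  obtain u v e g where e: "edge_joining (metr \<Gamma>) (verts \<Gamma>) u v e" "g \<in> G" "ac g u = v" "ac g v = u"
    "p \<in> e" "d u p = d p v"
    "e = sg u v" "u \<in> M" "v \<in> M" "p \<in> M" "e \<inter> verts \<Gamma> = {u, v}" "u \<noteq> v"
    by (rule inverted_midpointE[OF assms])
  have "p = u \<or> p = v" using e pv by blast
  then have "d u v = 0" using e(6,8,9) by auto
  then show False using e(8,9,12) by simp
qed

lemma midpoint_unique:
  assumes "p \<in> inverted_midpoints F \<Gamma>" "p' \<in> inverted_midpoints F \<Gamma>"
    and "e \<in> V.E" "p \<in> e" "p' \<in> e"
  shows "p = p'"
proof -
  have *: "\<exists>u v. e \<inter> verts \<Gamma> = {u, v} \<and> u \<in> M \<and> v \<in> M \<and> q \<in> sg u v \<and>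
      d u q = d q v"
    if q: "q \<in> inverted_midpoints F \<Gamma>" "q \<in> e" for q
  proof -
    obtain u v e' g where e': "edge_joining (metr \<Gamma>) (verts \<Gamma>) u v e'" "g \<in> G" "ac g u = v" "ac g v = u"
      "q \<in> e'" "d u q = d q v"
      "e' = sg u v" "u \<in> M" "v \<in> M" "q \<in> M" "e' \<inter> verts \<Gamma> = {u, v}" "u \<noteq> v"
      by (rule inverted_midpointE[OF q(1)])
    have "e' \<in> V.E" using e'(1) by (auto simp: tree_edges_def)
    then have "e' = e"
      using V.edge_unique[OF _ assms(3) e'(5) q(2) midpoint_notin_verts[OF q(1)]] by simp
    then show ?thesis using e' by blast
  qed
  obtain u v where 1: "e \<inter> verts \<Gamma> = {u, v}" "u \<in> M" "v \<in> M" "p \<in> sg u v"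
      "d u p = d p v" using *[OF assms(1,4)] by auto
  obtain u' v' where 2: "e \<inter> verts \<Gamma> = {u', v'}" "p' \<in> sg u' v'"
      "d u' p' = d p' v'" using *[OF assms(2,5)] by auto
  have "{u, v} = {u', v'}" using 1(1) 2(1) by simp
  then consider "u = u'" "v = v'" | "u = v'" "v = u'" by (auto simp only: doubleton_eq_iff)
  then have "p' \<in> sg u v \<and> d u p' = d p' v"
  proof cases
    case 1
    then show ?thesis using 2 by simp
  next
    case c: 2
    have "p' \<in> sg u v" using 2(2) c by (subst seg_commute) simp
    moreover have "d u p' = d p' v"
      using 2(3) c mdist_commute[of "metr \<Gamma>" u p'] mdist_commute[of "metr \<Gamma>" v p'] by simp
    ultimately show ?thesis ..
  qed
  then have 3: "p' \<in> sg u v" "d u p' = d p' v" by simp_all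
  show ?thesis
    using seg_eqI_dist[OF 1(4) 3(1) 1(2,3)] seg_dist_sum[OF 1(4)] seg_dist_sum[OF 3(1)] 1(5) 3(2)
    by simp
qed

text \<open>Two inverted midpoints on a segment lie in different edges, hence are separated by a vertex.\<close>

lemma finite_seg_midpoints:
  assumes "x \<in> M" "y \<in> M"
  shows "finite (sg x y \<inter> inverted_midpoints F \<Gamma>)"
proof -
  let ?\<phi> = "\<lambda>p. sg x p \<inter> verts \<Gamma>"
  let ?S = "sg x y \<inter> inverted_midpoints F \<Gamma>"
  have *: "p = q" if pq: "p \<in> ?S" "q \<in> ?S" "?\<phi> p = ?\<phi> q" "d x p \<le> d x q" for p q
  proof -
    have pM: "p \<in> M" and qM: "q \<in> M" using seg_in_M pq(1,2) by auto
    have px: "p \<in> sg x y" "q \<in> sg x y" using pq by auto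
    have xx: "x \<in> sg x y" using seg_ends[OF assms] by simp
    have p_xq: "p \<in> sg x q"
      using seg_interval[OF xx px(2,1) assms] assms pq(4) by simp
    have "sg p q \<inter> verts \<Gamma> = {}"
    proof (rule ccontr)
      assume "\<not> ?thesis"
      then obtain r where r: "r \<in> sg p q" "r \<in> verts \<Gamma>" by auto
      have "p \<in> sg q x" using p_xq by (subst seg_commute)
      moreover have "r \<in> sg q p" using r(1) by (subst seg_commute)
      ultimately have "r \<in> sg q x" and prx: "p \<in> sg r x"
        using seg_trans[of p _ q x r] qM assms(1) by blast+
      then have "r \<in> sg x q" by (subst seg_commute)
      then have "r \<in> ?\<phi> q" using r(2) by simp
      then have "r \<in> ?\<phi> p" using pq(3) by simp
      then have "r \<in> sg x p" by simp
      moreover have "p \<in> sg x r" using prx by (subst seg_commute)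
      ultimately have "p = r" using seg_antisym[of p x r] by simp
      then show False using midpoint_notin_verts pq(1) r(2) by auto
    qed
    moreover obtain e where e: "e \<in> V.E" "p \<in> e"
      using V.edge_exists[OF pM] midpoint_notin_verts pq(1) by auto
    ultimately have "q \<in> e"
      using V.edge_vertex_free_seg[OF e _ qM] midpoint_notin_verts pq(1) by auto
    then show "p = q" using midpoint_unique[OF _ _ e(1,2)] pq by simp
  qed
  have "inj_on ?\<phi> ?S"
  proof (rule inj_onI)
    fix p q assume pq: "p \<in> ?S" "q \<in> ?S" "?\<phi> p = ?\<phi> q"
    show "p = q"
    proof (cases "d x p \<le> d x q")
      case True then show ?thesis using *[OF pq] by simp
    next
      case False then show ?thesis using *[OF pq(2,1) pq(3)[symmetric]] by simp
    qed
  qed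
  moreover have "?\<phi> ` ?S \<subseteq> Pow (sg x y \<inter> verts \<Gamma>)"
  proof -
    have "sg x p \<subseteq> sg x y" if "p \<in> ?S" for p
      using seg_subset[OF _ _ assms] seg_ends[OF assms] that by simp
    then show ?thesis by blast
  qed
  ultimately show ?thesis
    using V.finite_seg_V[OF assms] by (meson finite_Pow_iff finite_imageD finite_subset)
qed

lemma W_subset: "W \<subseteq> M"
  using V.V_subset inverted_midpointE by blast

lemma finite_seg_W:
  assumes "x \<in> M" "y \<in> M"
  shows "finite (sg x y \<inter> W)"
  using finite_seg_midpoints[OF assms] V.finite_seg_V[OF assms] by (simp add: Int_Un_distrib)

text \<open>From here on the unprefixed facts and \<open>E\<close> refer to the subdivided tree; the
  prefix \<open>V.\<close> marks those of the given simplicial structure.\<close>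

sublocale stree "metr \<Gamma>" W
  using V.stree_refine[OF _ W_subset finite_seg_W] by unfold_locales simp

lemma subdivided_edges: "subdivided_edges F \<Gamma> = E"
  by (simp add: subdivided_edges_def)

lemma act_edge:
  assumes "g \<in> G" "e \<in> E" shows "ac g ` e \<in> E"
  using assms act_tree_edges[OF act_W W_subset assms(1)] unfolding tree_edges_def by blast

lemma act_verts_edge:
  assumes "g \<in> G" "e \<in> V.E" shows "ac g ` e \<in> V.E"
  using assms act_tree_edges[OF act_verts V.V_subset assms(1)] unfolding tree_edges_def by blast

lemma fixes_edge_pointwise_or_swaps:
  assumes "g \<in> G" "u \<in> M" "v \<in> M" "e = sg u v" "e \<inter> U = {u, v}" "ac g ` e = e"
    and inv: "\<And>g v. g \<in> G \<Longrightarrow> v \<in> U \<Longrightarrow> ac g v \<in> U"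
  shows "(\<forall>x\<in>e. ac g x = x) \<or> (ac g u = v \<and> ac g v = u)"
proof -
  have U: "u \<in> U" "v \<in> U" "u \<in> e" "v \<in> e" using assms(5) by auto
  have gu: "ac g u \<in> {u, v}" "ac g v \<in> {u, v}"
    using inv[OF assms(1)] U assms(5,6) by blast+
  show ?thesis
  proof (cases "ac g u = u")
    case True
    have "ac g x = x" if "x \<in> e" for x
    proof (rule seg_eqI_dist[OF _ _ assms(2,3)])
      show "x \<in> sg u v" "ac g x \<in> sg u v" using that assms(4,6) by auto
      have "d (ac g u) (ac g x) = d u x" using act_isom[OF assms(1,2)] that edge_in_M assms(4) seg_in_M by auto
      then show "d u (ac g x) = d u x" using True by simp
    qed
    then show ?thesis by blast
  next
    case False
    then have 1: "ac g u = v" using gu by auto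
    moreover have "ac g v = u"
    proof (rule ccontr)
      assume "ac g v \<noteq> u"
      then have "ac g v = ac g u" using gu 1 by auto
      then have "v = u" using act_inj assms(1-3) by blast
      then show False using 1 False by simp
    qed
    ultimately show ?thesis by blast
  qed
qed

text \<open>An element swapping the ends of \<open>e\<close> fixes its midpoint \<open>p\<close>,
  which is no vertex, and so preserves the original edge \<open>e0\<close> through \<open>p\<close>.
  It cannot fix \<open>e0\<close> pointwise, since \<open>e0\<close> contains \<open>e\<close>. So
  it inverts \<open>e0\<close>, and \<open>p\<close> is the midpoint of \<open>e0\<close>; but then
  \<open>p\<close> was made a vertex by the subdivision.\<close>

lemma no_inversion:
  assumes g: "g \<in> G" and e: "e \<in> E" "ac g ` e = e" and x: "x \<in> e"
  shows "ac g x = x"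
proof -
  obtain u v where uv: "u \<in> W" "v \<in> W" "u \<noteq> v" "e = sg u v" "e \<inter> W = {u, v}" "u \<in> M" "v \<in> M"
    using edgeE[OF e(1)] .
  have "\<not> (ac g u = v \<and> ac g v = u)"
  proof
    assume sw: "ac g u = v \<and> ac g v = u"
    have h: "d u v / 2 \<in> {0..d u v}" by simp
    define p where "p = pt u v (d u v / 2)"
    have p: "p \<in> sg u v" "d u p = d u v / 2" using pt[OF uv(6,7) h] by (simp_all add: p_def)
    have pM: "p \<in> M" using seg_in_M[OF p(1)] .
    have pv: "d p v = d u v / 2" using seg_dist_sum[OF p(1)] p(2) by simp
    have uvpos: "d u v > 0" using dist_zeroD[OF uv(6,7)] uv(3) by linarith
    have gp: "ac g p \<in> sg u v" using e(2) p(1) uv(4) by blast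
    have "d v (ac g p) = d u v / 2" using act_isom[OF g uv(6) pM] sw p(2) by simp
    then have "d u (ac g p) = d u p"
      using seg_dist_sum[OF gp] mdist_commute[of "metr \<Gamma>" v "ac g p"] p(2) by simp
    then have gpp: "ac g p = p" by (rule seg_eqI_dist[OF gp p(1) uv(6,7)])
    have pW: "p \<notin> W"
    proof
      assume "p \<in> W"
      then have "p = u \<or> p = v" using uv(4,5) p(1) by blast
      then show False using p(2) pv uvpos uv(6,7) by auto
    qed
    then obtain e0 where e0: "e0 \<in> V.E" "p \<in> e0" using V.edge_exists[OF pM] by auto
    obtain u0 v0 where uv0: "u0 \<in> verts \<Gamma>" "v0 \<in> verts \<Gamma>" "u0 \<noteq> v0" "e0 = sg u0 v0" "e0 \<inter> verts \<Gamma> = {u0, v0}" "u0 \<in> M" "v0 \<in> M"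
      using V.edgeE[OF e0(1)] .
    have "p \<in> ac g ` e0" using gpp e0(2) by (metis imageI)
    then have ge0: "ac g ` e0 = e0"
      using V.edge_unique[OF act_verts_edge[OF g e0(1)] e0(1) _ e0(2)] pW by simp
    have sub: "e \<subseteq> e0"
      using V.refined_edge_subset[OF _ W_subset e0 pW e(1)] p(1) uv(4) by simp
    consider "\<forall>x\<in>e0. ac g x = x" | "ac g u0 = v0" "ac g v0 = u0"
      using fixes_edge_pointwise_or_swaps[OF g uv0(6,7,4,5) ge0 act_verts] by blast
    then show False
    proof cases
      case 1
      moreover have "u \<in> e0" using sub uv(5) by blast
      ultimately show False using sw uv(3) by auto
    next
      case 2
      have "d u0 p = d v0 p" using act_isom[OF g uv0(6) pM] 2 gpp by simp
      then have "d u0 p = d p v0" using mdist_commute[of "metr \<Gamma>" v0 p] by simp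
      moreover have "edge_joining (metr \<Gamma>) (verts \<Gamma>) u0 v0 e0"
        using uv0 by (simp add: edge_joining_def geodesic_segment_iff)
      ultimately have "p \<in> inverted_midpoints F \<Gamma>"
        unfolding inverted_midpoints_def using g 2 e0(2) by blast
      then show False using pW by simp
    qed
  qed
  then show ?thesis using fixes_edge_pointwise_or_swaps[OF g uv(6,7,4,5) e(2) act_W] x by blast
qed

text \<open>Finite generation makes the translates of the segments from \<open>x0\<close> to
  \<open>ac s x0\<close> hang together: their union \<open>T\<close> is an invariant subtree, just
  as a Cayley graph is connected. Minimality then leaves nothing outside \<open>T\<close>.\<close>

lemma cocompact:
  assumes x0: "x0 \<in> M"
  obtains S where "finite S" "S \<subseteq> G" "generate F S = G"
    "\<And>x. x \<in> M \<Longrightarrow> \<exists>g\<in>G. \<exists>s\<in>insert \<one> S. ac g x \<in> sg x0 (ac s x0)"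
proof -
  obtain S where S: "finite S" "S \<subseteq> G" "generate F S = G"
    using fg by (auto simp: finitely_generated_def)
  \<comment> \<open>With the identity included, \<open>T\<close> contains \<open>x0\<close> even if
    \<open>S\<close> is empty.\<close>
  define S' where "S' = insert \<one> S"
  have S': "S' \<subseteq> G" using S by (auto simp: S'_def)
  define T where "T = {x \<in> M. \<exists>g\<in>G. \<exists>s\<in>S'. ac g x \<in> sg x0 (ac s x0)}"
  have TM: "T \<subseteq> M" by (auto simp: T_def)
  have T_inv: "ac h x \<in> T" if x: "x \<in> T" and h: "h \<in> G" for x h
  proof -
    obtain g s where g: "g \<in> G" "s \<in> S'" "ac g x \<in> sg x0 (ac s x0)" and xM: "x \<in> M"
      using x by (auto simp: T_def)
    have "ac (g \<otimes> inv h) (ac h x) = ac g x"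
      using act_mult[OF g(1) F.inv_closed[OF h] act_closed[OF h xM]] act_inv1[OF h xM] by simp
    then show ?thesis
      using g h act_closed[OF h xM] unfolding T_def
      by (intro CollectI conjI bexI[of _ "g \<otimes> inv h"] bexI[of _ s]) auto
  qed
  have T_inv': "x \<in> T" if "ac h x \<in> T" "h \<in> G" "x \<in> M" for x h
    using T_inv[OF that(1) F.inv_closed[OF that(2)]] act_inv1 that by simp
  have x0T: "sg x0 (ac s x0) \<subseteq> T" if s: "s \<in> S'" for s
  proof
    fix x assume x: "x \<in> sg x0 (ac s x0)"
    then have "x \<in> M" by (rule seg_in_M)
    then show "x \<in> T" unfolding T_def using x s act_one[of x]
      by (intro CollectI conjI bexI[of _ "\<one>"] bexI[of _ s]) auto
  qed
  \<comment> \<open>Induction on a word for \<open>g\<close>: for a product,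
    \<open>seg_split\<close> covers the geodesic by that of the first factor and the translate of
    that of the second.\<close>
  have path: "sg x0 (ac g x0) \<subseteq> T" if "g \<in> G" for g
  proof -
    have "g \<in> generate F S" using that S by simp
    then show ?thesis
    proof (induction rule: generate.induct)
      case one
      then show ?case using x0T[of "\<one>"] by (simp add: S'_def)
    next
      case (incl h)
      then show ?case using x0T by (simp add: S'_def)
    next
      case (inv h)
      then have h: "h \<in> G" "h \<in> S'" using S by (auto simp: S'_def)
      show ?case
      proof
        fix x assume x: "x \<in> sg x0 (ac (inv h) x0)"
        have "ac h x \<in> sg (ac h x0) (ac h (ac (inv h) x0))"
          using act_seg_mem[OF h(1) x0 act_closed[OF F.inv_closed[OF h(1)] x0] x] .
        then have "ac h x \<in> sg (ac h x0) x0" using act_inv2[OF h(1) x0] by simp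
        then have "ac h x \<in> sg x0 (ac h x0)" by (subst seg_commute)
        then have "ac h x \<in> T" using x0T[OF h(2)] by blast
        then show "x \<in> T" using T_inv' h(1) seg_in_M[OF x] by blast
      qed
    next
      case (eng g h)
      have gh: "g \<in> G" "h \<in> G" using eng S by auto
      show ?case
      proof
        fix x assume x: "x \<in> sg x0 (ac (g \<otimes> h) x0)"
        have xM: "x \<in> M" using seg_in_M[OF x] .
        have M: "ac g x0 \<in> M" "ac h x0 \<in> M" "ac g (ac h x0) \<in> M" using gh x0 act_closed by auto
        have "x \<in> sg x0 (ac g (ac h x0))" using x act_mult[OF gh x0] by simp
        then have "x \<in> sg x0 (ac g x0) \<or> x \<in> sg (ac g x0) (ac g (ac h x0))"
          using seg_split[OF _ x0 M(3) M(1)] by simp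
        then show "x \<in> T"
        proof
          assume "x \<in> sg x0 (ac g x0)" then show ?thesis using eng.IH by blast
        next
          assume "x \<in> sg (ac g x0) (ac g (ac h x0))"
          then obtain y where y: "y \<in> sg x0 (ac h x0)" "x = ac g y"
            using act_seg[OF gh(1) x0 M(2)] by auto
          then have "y \<in> T" using eng.IH by blast
          then show ?thesis using T_inv y(2) gh(1) by simp
        qed
      qed
    qed
  qed
  have path2: "sg (ac a x0) (ac b x0) \<subseteq> T" if ab: "a \<in> G" "b \<in> G" for a b
  proof
    fix x assume x: "x \<in> sg (ac a x0) (ac b x0)"
    have "b = a \<otimes> (inv a \<otimes> b)" using ab by (simp add: F.m_assoc[symmetric])
    then have "ac b x0 = ac a (ac (inv a \<otimes> b) x0)"
      using act_mult[of a "inv a \<otimes> b" x0] ab x0 by simp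
    moreover have "ac (inv a \<otimes> b) x0 \<in> M" using act_closed[OF _ x0] ab by simp
    ultimately have "x \<in> ac a ` sg x0 (ac (inv a \<otimes> b) x0)"
      using x act_seg[OF ab(1) x0] by simp
    then obtain y where y: "y \<in> sg x0 (ac (inv a \<otimes> b) x0)" "x = ac a y" by auto
    then have "y \<in> T" using path[of "inv a \<otimes> b"] ab by auto
    then show "x \<in> T" using T_inv y(2) ab(1) by simp
  qed
  \<comment> \<open>Every point of \<open>T\<close> is joined to the orbit of \<open>x0\<close>
    inside \<open>T\<close>; together with \<open>path2\<close> this gives convexity.\<close>
  have leg: "\<exists>g\<in>G. sg x (ac g x0) \<subseteq> T" if x: "x \<in> T" for x
  proof -
    obtain g s where g: "g \<in> G" "s \<in> S'" "ac g x \<in> sg x0 (ac s x0)" and xM: "x \<in> M"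
      using x by (auto simp: T_def)
    have sM: "ac s x0 \<in> M" using g(2) S' x0 act_closed by blast
    have ig: "inv g \<in> G" using g(1) by simp
    have "sg x (ac (inv g) x0) \<subseteq> T"
    proof
      fix p assume p: "p \<in> sg x (ac (inv g) x0)"
      have "ac g p \<in> sg (ac g x) (ac g (ac (inv g) x0))"
        using act_seg_mem[OF g(1) xM act_closed[OF ig x0] p] .
      then have "ac g p \<in> sg (ac g x) x0" using act_inv2[OF g(1) x0] by simp
      moreover have "sg (ac g x) x0 \<subseteq> sg x0 (ac s x0)"
        using seg_subset[OF g(3) _ x0 sM] seg_ends[OF x0 sM] by simp
      ultimately have "ac g p \<in> T" using x0T[OF g(2)] by blast
      then show "p \<in> T" using T_inv' g(1) seg_in_M[OF p] by blast
    qed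
    then show ?thesis using ig by blast
  qed
  have "subtree (metr \<Gamma>) T"
    unfolding subtree_def
  proof (intro conjI ballI allI impI)
    show "T \<noteq> {}" using path[OF F.one_closed] act_one[OF x0] x0 by auto
    show "T \<subseteq> M" by (rule TM)
    fix x y A assume x: "x \<in> T" and y: "y \<in> T" and "geodesic_segment (metr \<Gamma>) x y A"
    then have A: "A = sg x y" by (simp add: geodesic_segment_iff)
    obtain g where g: "g \<in> G" "sg x (ac g x0) \<subseteq> T" using leg[OF x] by auto
    obtain h where h: "h \<in> G" "sg y (ac h x0) \<subseteq> T" using leg[OF y] by auto
    have M: "x \<in> M" "y \<in> M" "ac g x0 \<in> M" "ac h x0 \<in> M" using x y TM g h x0 act_closed by auto
    show "A \<subseteq> T"
    proof
      fix p assume "p \<in> A"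
      then have "p \<in> sg x (ac g x0) \<or> p \<in> sg (ac g x0) y" using seg_split[OF _ M(1,2,3)] A by simp
      moreover have "p \<in> sg (ac g x0) (ac h x0) \<or> p \<in> sg (ac h x0) y" if "p \<in> sg (ac g x0) y"
        using seg_split[OF that M(3,2,4)] .
      moreover have "sg (ac h x0) y = sg y (ac h x0)" by (rule seg_commute)
      ultimately show "p \<in> T" using g(2) h(2) path2[OF g(1) h(1)] by auto
    qed
  qed
  moreover have "\<forall>g\<in>G. ac g ` T \<subseteq> T" using T_inv by auto
  ultimately have "T = M" using outer by (simp add: outer_trees_def minimal_action_def)
  then have "\<exists>g\<in>G. \<exists>s\<in>S'. ac g x \<in> sg x0 (ac s x0)" if "x \<in> M" for x using that by (auto simp: T_def)
  then show thesis using that S unfolding S'_def by blast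
qed

section \<open>Finiteness of edge orbits, stars and balls; properness of the action\<close>

lemma ex_vertex: "\<exists>v. v \<in> W"
proof -
  obtain x where x: "x \<in> M" using tree by (auto simp: real_tree_def)
  show ?thesis
  proof (cases "x \<in> W")
    case False
    then obtain e where "e \<in> E" using edge_exists[OF x] by auto
    then obtain u v where "u \<in> W" "v \<in> W" using edgeE by metis
    then show ?thesis by blast
  qed blast
qed

text \<open>The midpoint of any edge can be moved into one of the finitely many segments of
  \<open>cocompact\<close>. Since \<open>x0\<close> is taken to be a vertex, an edge with an
  interior point on such a segment lies in it entirely, and it is determined by its ends, for which
  there are finitely many choices.\<close>

lemma finite_edge_orbits: "\<exists>R. finite R \<and> R \<subseteq> E \<and> (\<forall>e\<in>E. \<exists>g\<in>G. ac g ` e \<in> R)"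
proof -
  obtain x0 where x0: "x0 \<in> W" using ex_vertex by auto
  have x0M: "x0 \<in> M" using V_in_M[OF x0] .
  obtain S where S: "finite S" "S \<subseteq> G" "generate F S = G"
    "\<And>x. x \<in> M \<Longrightarrow> \<exists>g\<in>G. \<exists>s\<in>insert \<one> S. ac g x \<in> sg x0 (ac s x0)"
    using cocompact[OF x0M] by blast
  define S' where "S' = insert \<one> S"
  have S': "s \<in> G" "ac s x0 \<in> W" "ac s x0 \<in> M" if "s \<in> S'" for s
  proof -
    show s: "s \<in> G" using that S(2) by (auto simp: S'_def)
    show "ac s x0 \<in> W" using act_W[OF s x0] .
    then show "ac s x0 \<in> M" by (rule V_in_M)
  qed
  define R where "R = {e \<in> E. \<exists>s\<in>S'. \<exists>k\<in>e. k \<notin> W \<and> k \<in> sg x0 (ac s x0)}"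
  have "inj_on (\<lambda>e. e \<inter> W) R"
  proof (rule inj_onI)
    fix e e' assume "e \<in> R" "e' \<in> R" "e \<inter> W = e' \<inter> W"
    then show "e = e'" using edge_eqI[of e e'] unfolding R_def by blast
  qed
  moreover have "(\<lambda>e. e \<inter> W) ` R \<subseteq> Pow (\<Union>s\<in>S'. sg x0 (ac s x0) \<inter> W)"
  proof (rule image_subsetI)
    fix e assume "e \<in> R"
    then obtain s k where e: "e \<in> E" "s \<in> S'" "k \<in> e" "k \<notin> W" "k \<in> sg x0 (ac s x0)"
      unfolding R_def by auto
    have "e \<subseteq> sg x0 (ac s x0)" using edge_subset_seg[OF x0 S'(2)[OF e(2)] e(1,3,4,5)] .
    then show "e \<inter> W \<in> Pow (\<Union>s\<in>S'. sg x0 (ac s x0) \<inter> W)" using e(2) by auto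
  qed
  moreover have "finite (\<Union>s\<in>S'. sg x0 (ac s x0) \<inter> W)"
  proof (rule finite_UN_I)
    show "finite S'" using S(1) by (simp add: S'_def)
    show "finite (sg x0 (ac s x0) \<inter> W)" if "s \<in> S'" for s
      using finite_seg_V[OF x0M S'(3)[OF that]] .
  qed
  ultimately have "finite R" by (meson finite_Pow_iff finite_imageD finite_subset)
  moreover have "R \<subseteq> E" by (auto simp: R_def)
  moreover have "\<exists>g\<in>G. ac g ` e \<in> R" if e: "e \<in> E" for e
  proof -
    obtain u v where uv: "u \<in> W" "v \<in> W" "u \<noteq> v" "e = sg u v" "e \<inter> W = {u, v}" "u \<in> M" "v \<in> M"
      using edgeE[OF e] .
    have h: "d u v / 2 \<in> {0..d u v}" by simp
    define p where "p = pt u v (d u v / 2)"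
    have p: "p \<in> sg u v" "d u p = d u v / 2" using pt[OF uv(6,7) h] by (simp_all add: p_def)
    have pM: "p \<in> M" using seg_in_M[OF p(1)] .
    have uvpos: "d u v > 0" using dist_zeroD[OF uv(6,7)] uv(3) by linarith
    have pW: "p \<notin> W"
    proof
      assume "p \<in> W"
      then have "p = u \<or> p = v" using uv(4,5) p(1) by blast
      then show False using p(2) uvpos uv(6,7) by auto
    qed
    obtain g s where g: "g \<in> G" "s \<in> S'" "ac g p \<in> sg x0 (ac s x0)"
      using S(4)[OF pM] by (auto simp: S'_def)
    have "ac g p \<notin> W" using act_invariant_iff[OF act_W g(1) pM] pW by simp
    moreover have "ac g p \<in> ac g ` e" using p(1) uv(4) by simp
    ultimately have "ac g ` e \<in> R" unfolding R_def using act_edge[OF g(1) e] g by blast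
    then show ?thesis using g(1) by blast
  qed
  ultimately show ?thesis by blast
qed

lemma finite_stabilizer: "x \<in> M \<Longrightarrow> finite (stabilizer F ac x)"
  using outer by (simp add: outer_trees_def)

lemma finite_transporter:
  assumes "x \<in> M" shows "finite {g \<in> G. ac g x = y}"
proof (cases "{g \<in> G. ac g x = y} = {}")
  case False
  then obtain g0 where g0: "g0 \<in> G" "ac g0 x = y" by auto
  have "{g \<in> G. ac g x = y} \<subseteq> (\<lambda>h. g0 \<otimes> h) ` stabilizer F ac x"
  proof
    fix g assume "g \<in> {g \<in> G. ac g x = y}"
    then have g: "g \<in> G" "ac g x = y" by auto
    have "ac (inv g0 \<otimes> g) x = x"
      using act_mult[OF F.inv_closed[OF g0(1)] g(1) assms] g(2) g0 act_inv1[OF g0(1) assms] by simp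
    then have "inv g0 \<otimes> g \<in> stabilizer F ac x" using g g0 by (simp add: stabilizer_def)
    moreover have "g = g0 \<otimes> (inv g0 \<otimes> g)" using g g0 by (simp add: F.m_assoc[symmetric])
    ultimately show "g \<in> (\<lambda>h. g0 \<otimes> h) ` stabilizer F ac x" by blast
  qed
  then show ?thesis using finite_stabilizer[OF assms] by (meson finite_imageI finite_subset)
qed (simp only: finite.emptyI)

lemma edge_finite_vertices:
  assumes "e \<in> E" shows "finite (e \<inter> W)"
proof -
  obtain u v where "e \<inter> W = {u, v}" using edgeE[OF assms] by metis
  then show ?thesis by (simp only: finite_insert finite.emptyI)
qed

text \<open>Local finiteness: an edge at \<open>v\<close> is the translate of one of finitely many
  representatives by an element taking one of its ends to \<open>v\<close>, and finite stabilizers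
  leave finitely many such elements.\<close>

lemma finite_star: "finite {e \<in> E. v \<in> e}" if v: "v \<in> W"
proof -
  obtain R where R: "finite R" "R \<subseteq> E" "\<forall>e\<in>E. \<exists>g\<in>G. ac g ` e \<in> R" using finite_edge_orbits by auto
  have "{e \<in> E. v \<in> e} \<subseteq> (\<Union>r\<in>R. \<Union>w\<in>r \<inter> W. (\<lambda>g. ac g ` r) ` {g \<in> G. ac g w = v})"
  proof
    fix e assume "e \<in> {e \<in> E. v \<in> e}"
    then have e: "e \<in> E" "v \<in> e" by auto
    obtain g where g: "g \<in> G" "ac g ` e \<in> R" using R(3) e by auto
    have vM: "v \<in> M" using v V_in_M by simp
    have "ac g v \<in> ac g ` e \<inter> W" using e(2) act_W[OF g(1) v] by simp
    moreover have "inv g \<in> {h \<in> G. ac h (ac g v) = v}" using g act_inv1[OF g(1) vM] by simp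
    moreover have "e = ac (inv g) ` (ac g ` e)"
      using act_inv1[OF g(1)] edge_in_M[OF e(1)] by (force simp: image_image)
    ultimately show "e \<in> (\<Union>r\<in>R. \<Union>w\<in>r \<inter> W. (\<lambda>g. ac g ` r) ` {g \<in> G. ac g w = v})"
      using g(2) by blast
  qed
  moreover have "finite (\<Union>r\<in>R. \<Union>w\<in>r \<inter> W. (\<lambda>g. ac g ` r) ` {g \<in> G. ac g w = v})"
  proof (intro finite_UN_I finite_imageI)
    show "finite R" by (rule R(1))
    show "finite (r \<inter> W)" if "r \<in> R" for r using edge_finite_vertices that R(2) by blast
    show "finite {g \<in> G. ac g w = v}" if "w \<in> r \<inter> W" for r w
      using finite_transporter V_in_M[of w] that by simp
  qed
  ultimately show ?thesis by (rule finite_subset)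
qed

lemma edge_length_bound: "\<exists>l>0. \<forall>u v. u \<in> W \<longrightarrow> v \<in> W \<longrightarrow> u \<noteq> v \<longrightarrow> sg u v \<in> E \<longrightarrow> l \<le> d u v"
proof -
  obtain R where R: "finite R" "R \<subseteq> E" "\<forall>e\<in>E. \<exists>g\<in>G. ac g ` e \<in> R" using finite_edge_orbits by auto
  define X where "X = (\<lambda>(u, v). d u v) ` {(u, v). u \<noteq> v \<and> u \<in> \<Union>R \<inter> W \<and> v \<in> \<Union>R \<inter> W}"
  have "finite (\<Union>R \<inter> W)"
  proof -
    have "\<Union>R \<inter> W = (\<Union>r\<in>R. r \<inter> W)" by auto
    moreover have "finite (r \<inter> W)" if "r \<in> R" for r using edge_finite_vertices R(2) that by blast
    ultimately show ?thesis using R(1) by (simp only: finite_UN_I)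
  qed
  then have "finite ((\<Union>R \<inter> W) \<times> (\<Union>R \<inter> W))" by simp
  then have finX: "finite X" unfolding X_def by (rule finite_imageI[OF finite_subset[rotated]]) auto
  have posX: "x > 0" if "x \<in> X" for x
  proof -
    obtain u v where "x = d u v" "u \<noteq> v" "u \<in> M" "v \<in> M" using \<open>x \<in> X\<close> W_subset unfolding X_def by auto
    then show ?thesis using dist_zeroD[of u v] by linarith
  qed
  \<comment> \<open>The inserted 1 keeps the set nonempty when there are no edges.\<close>
  define l where "l = Min (insert 1 X)"
  have "l > 0" unfolding l_def using finX posX by (subst Min_gr_iff) auto
  moreover have "l \<le> d u v" if uv: "u \<in> W" "v \<in> W" "u \<noteq> v" "sg u v \<in> E" for u v
  proof -
    obtain g where g: "g \<in> G" "ac g ` sg u v \<in> R" using R(3) uv(4) by auto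
    have M: "u \<in> M" "v \<in> M" using uv V_in_M by auto
    have ends: "ac g u \<in> ac g ` sg u v" "ac g v \<in> ac g ` sg u v" using seg_ends[OF M] by auto
    have "ac g u \<noteq> ac g v" using act_inj[OF g(1) M] uv(3) by auto
    then have "(ac g u, ac g v) \<in> {(u, v). u \<noteq> v \<and> u \<in> \<Union>R \<inter> W \<and> v \<in> \<Union>R \<inter> W}"
      using ends g(2) act_W[OF g(1)] uv by auto
    then have "d (ac g u) (ac g v) \<in> X" unfolding X_def by (force intro: image_eqI)
    then have "d u v \<in> X" using act_isom[OF g(1) M] by simp
    then show ?thesis unfolding l_def using finX by (intro Min_le) auto
  qed
  ultimately show ?thesis by blast
qed

lemma edge_towards:
  assumes "w \<in> W" "v \<in> W" "w \<noteq> v"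
  shows "\<exists>w'\<in>W. w' \<noteq> w \<and> w' \<in> sg w v \<and> sg w w' \<in> E"
proof -
  have M: "w \<in> M" "v \<in> M" using assms V_in_M by auto
  have "finite (sg w v \<inter> (W - {w}))"
    using finite_seg_V[OF M] by (rule finite_subset[rotated]) auto
  then obtain w' where w': "w' \<in> sg w v" "w' \<in> W - {w}" "sg w w' \<inter> (W - {w}) = {w'}"
    using seg_nearest[of w v "W - {w}" v] seg_ends[OF M] assms M by auto
  have "w' \<in> M" using seg_in_M[OF w'(1)] .
  then have "sg w w' \<inter> W = {w, w'}"
    using w'(2,3) assms(1) seg_ends[OF M(1)] by auto
  then have "sg w w' \<in> E" using edge_iff assms(1) w'(2) by auto
  then show ?thesis using w' by auto
qed

text \<open>One edge in the direction of \<open>v0\<close> brings a vertex closer to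
  \<open>v0\<close> by at least the minimal edge length \<open>l\<close>. Induction over the radii
  \<open>n * l\<close> thus adds finitely many finite stars at a time.\<close>

lemma finite_ball_vertices:
  assumes "x \<in> M" shows "finite {w \<in> W. d x w \<le> r}"
proof -
  obtain v0 where v0: "v0 \<in> W" using ex_vertex by auto
  have v0M: "v0 \<in> M" using V_in_M[OF v0] .
  obtain l where l: "l > 0" "\<And>u v. u \<in> W \<Longrightarrow> v \<in> W \<Longrightarrow> u \<noteq> v \<Longrightarrow> sg u v \<in> E \<Longrightarrow> l \<le> d u v"
    using edge_length_bound by blast
  define B where "B n = {w \<in> W. d v0 w \<le> real n * l}" for n
  have "finite (B n)" for n
  proof (induction n)
    case 0
    have "w = v0" if "w \<in> B 0" for w
      using that dist_zeroD[OF v0M, of w] V_in_M[of w] by (simp add: B_def)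
    then have "B 0 \<subseteq> {v0}" by blast
    then show ?case using finite_subset by blast
  next
    case (Suc n)
    have "B (Suc n) \<subseteq> {v0} \<union> (\<Union>v\<in>B n. \<Union>e\<in>{e \<in> E. v \<in> e}. e \<inter> W)"
    proof
      fix w assume "w \<in> B (Suc n)"
      then have w: "w \<in> W" "d v0 w \<le> real (Suc n) * l" by (auto simp: B_def)
      have wM: "w \<in> M" using V_in_M[OF w(1)] .
      show "w \<in> {v0} \<union> (\<Union>v\<in>B n. \<Union>e\<in>{e \<in> E. v \<in> e}. e \<inter> W)"
      proof (cases "w = v0")
        case False
        obtain w' where w': "w' \<in> W" "w' \<noteq> w" "w' \<in> sg w v0" and e: "sg w w' \<in> E"
          using edge_towards[OF w(1) v0 False] by auto
        have "l \<le> d w w'" using l(2)[OF w(1) w'(1) _ e] w'(2) by auto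
        then have "d v0 w' \<le> real n * l"
          using seg_dist_sum[OF w'(3)] w(2) mdist_commute[of "metr \<Gamma>" w v0]
            mdist_commute[of "metr \<Gamma>" w' v0] by (simp add: algebra_simps)
        then have "w' \<in> B n" using w'(1) by (simp add: B_def)
        moreover have "w' \<in> sg w w'" "w \<in> sg w w'" using seg_ends[OF wM V_in_M[OF w'(1)]] by auto
        ultimately show ?thesis using e w(1) by blast
      qed simp
    qed
    moreover have "finite ({v0} \<union> (\<Union>v\<in>B n. \<Union>e\<in>{e \<in> E. v \<in> e}. e \<inter> W))"
      by (intro finite_UnI finite_UN_I Suc.IH finite_star edge_finite_vertices) (auto simp: B_def)
    ultimately show ?case by (rule finite_subset)
  qed
  moreover obtain n where n: "d v0 x + r \<le> real n * l"
    using reals_Archimedean3[OF l(1)] by (meson less_imp_le)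
  moreover have "{w \<in> W. d x w \<le> r} \<subseteq> B n"
    using tri[OF v0M assms] n W_subset by (force simp: B_def)
  ultimately show ?thesis using finite_subset by blast
qed

text \<open>The action is metrically proper: \<open>g\<close> takes the vertex \<open>v0\<close>
  into a ball with finitely many vertices, and each of these is reached by finitely many group
  elements.\<close>

lemma finite_displacement:
  assumes "x \<in> M" "y \<in> M" shows "finite {g \<in> G. d x (ac g y) \<le> r}"
proof -
  obtain v0 where v0: "v0 \<in> W" using ex_vertex by auto
  have v0M: "v0 \<in> M" using V_in_M[OF v0] .
  have "{g \<in> G. d x (ac g y) \<le> r} \<subseteq> (\<Union>w\<in>{w \<in> W. d x w \<le> r + d y v0}. {g \<in> G. ac g v0 = w})"
  proof
    fix g assume "g \<in> {g \<in> G. d x (ac g y) \<le> r}"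
    then have g: "g \<in> G" "d x (ac g y) \<le> r" by auto
    have "d x (ac g v0) \<le> d x (ac g y) + d (ac g y) (ac g v0)"
      using tri assms v0M g(1) act_closed by simp
    then have "d x (ac g v0) \<le> r + d y v0" using act_isom[OF g(1) assms(2) v0M] g(2) by simp
    then show "g \<in> (\<Union>w\<in>{w \<in> W. d x w \<le> r + d y v0}. {g \<in> G. ac g v0 = w})"
      using g(1) act_W[OF g(1) v0] by auto
  qed
  then show ?thesis
    by (rule finite_subset) (intro finite_UN_I finite_ball_vertices finite_transporter assms v0M)
qed

lemma compactin_seg:
  assumes "x \<in> M" "y \<in> M" shows "compactin (mtopology_of (metr \<Gamma>)) (sg x y)"
proof -
  have "Lipschitz_continuous_map (submetric euclidean_metric {0..d x y}) (metr \<Gamma>) (pt x y)"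
    unfolding Lipschitz_continuous_map_def
    using seg_in_M[OF pt(1)[OF assms]] pt_dist[OF assms]
    by (auto simp: dist_real_def intro!: exI[of _ 1])
  then have "continuous_map (top_of_set {0..d x y}) (mtopology_of (metr \<Gamma>)) (pt x y)"
    using Lipschitz_continuous_imp_continuous_map[of "submetric euclidean_metric {0..d x y}"]
    by (simp add: mtopology_of_submetric)
  then have "compactin (mtopology_of (metr \<Gamma>)) (pt x y ` {0..d x y})"
    by (rule image_compactin[rotated]) (simp add: compactin_subtopology)
  then show ?thesis using seg_image_pt[OF assms] by simp
qed

text \<open>The ball is a closed part of a finite union of vertices and closed edges: an edge that
  contains a point of the ball has an end in the ball, because the way to the centre
  \<open>v0\<close>, a vertex, leaves the edge through an end.\<close>

lemma compactin_cball:
  assumes v0: "v0 \<in> W" shows "compactin (mtopology_of (metr \<Gamma>)) {x \<in> M. d v0 x \<le> r}"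
proof -
  have v0M: "v0 \<in> M" using V_in_M[OF v0] .
  let ?B = "{w \<in> W. d v0 w \<le> r}"
  let ?K = "?B \<union> \<Union>(\<Union>w\<in>?B. {e \<in> E. w \<in> e})"
  have "compactin (mtopology_of (metr \<Gamma>)) ?K"
  proof (rule compactin_Un)
    show "compactin (mtopology_of (metr \<Gamma>)) ?B"
      using finite_ball_vertices[OF v0M] W_subset by (intro finite_imp_compactin) auto
    show "compactin (mtopology_of (metr \<Gamma>)) (\<Union>(\<Union>w\<in>?B. {e \<in> E. w \<in> e}))"
    proof (rule compactin_Union)
      show "finite (\<Union>w\<in>?B. {e \<in> E. w \<in> e})"
        by (intro finite_UN_I finite_ball_vertices v0M finite_star) simp
      show "compactin (mtopology_of (metr \<Gamma>)) e" if "e \<in> (\<Union>w\<in>?B. {e \<in> E. w \<in> e})" for e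
      proof -
        have "e \<in> E" using that by simp
        then show ?thesis by (rule edgeE) (simp add: compactin_seg)
      qed
    qed
  qed
  moreover have "{x \<in> M. d v0 x \<le> r} \<subseteq> ?K"
  proof
    fix x assume "x \<in> {x \<in> M. d v0 x \<le> r}"
    then have x: "x \<in> M" "d v0 x \<le> r" by auto
    show "x \<in> ?K"
    proof (cases "x \<in> W")
      case True then show ?thesis using x by simp
    next
      case False
      then obtain e where e: "e \<in> E" "x \<in> e" using edge_exists[OF x(1)] by auto
      have "\<exists>w\<in>e. w \<in> W \<and> d v0 w \<le> r"
      proof (cases "v0 \<in> e")
        case True
        moreover have "d v0 v0 \<le> r"
          using x(2) mdist_nonneg[of "metr \<Gamma>" v0 x] v0M by (simp del: mdist_nonneg)
        ultimately show ?thesis using v0 by blast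
      next
        case False
        then obtain w where w: "w \<in> sg x v0" "w \<in> e" "w \<in> W"
          using edge_exit[OF e \<open>x \<notin> W\<close> v0M] by auto
        have "w \<in> sg v0 x" using w(1) by (subst seg_commute)
        then have "d v0 w \<le> r" using seg_dist_le x(2) by fastforce
        then show ?thesis using w by auto
      qed
      then show ?thesis using e by blast
    qed
  qed
  moreover have "closedin (mtopology_of (metr \<Gamma>)) {x \<in> M. d v0 x \<le> r}"
  proof -
    have "{x \<in> M. d v0 x \<le> r} = mcball_of (metr \<Gamma>) v0 r" using v0M by auto
    then show ?thesis
      by (simp add: mcball_of_def mtopology_of_def Metric_space.closedin_mcball)
  qed
  ultimately show ?thesis using closed_compactin by blast
qed

end

section \<open>Content and volume\<close>

definition stab_card :: "('g, 'm) monoid_scheme \<Rightarrow> ('g, 'a) acted_tree \<Rightarrow> 'a \<Rightarrow> real" where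
  "stab_card F \<Gamma> x = real (card (stabilizer F (act \<Gamma>) x))"

text \<open>A discrete substitute for the one-dimensional measure of the quotient orbifold; unlike length,
  it behaves well under Lipschitz maps that are not piecewise linear.\<close>

definition content_le :: "('g, 'm) monoid_scheme \<Rightarrow> ('g, 'a) acted_tree \<Rightarrow> 'a set \<Rightarrow> real \<Rightarrow> bool" where
  "content_le F \<Gamma> J a \<longleftrightarrow> (\<exists>c. \<forall>\<epsilon>>0. \<exists>B. finite B \<and> B \<subseteq> points \<Gamma> \<and>
     (\<forall>y\<in>J. \<exists>g\<in>carrier F. \<exists>b\<in>B. mdist (metr \<Gamma>) y (act \<Gamma> g b) \<le> \<epsilon>) \<and>
     (\<Sum>b\<in>B. 1 / stab_card F \<Gamma> b) \<le> a / (2 * \<epsilon>) + c)"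

text \<open>Subadditivity of Lebesgue measure. This is the only place where measure enters; it
  bounds the number of covering points from below.\<close>

lemma card_intervals_cover:
  fixes a b \<epsilon> :: real
  assumes "finite I" "{a<..<b} \<subseteq> (\<Union>i\<in>I. {\<tau> i - \<epsilon>..\<tau> i + \<epsilon>})" "\<epsilon> \<ge> 0"
  shows "b - a \<le> 2 * \<epsilon> * real (card I)"
proof (cases "a \<le> b")
  case True
  have "emeasure lborel {a<..<b} \<le> emeasure lborel (\<Union>i\<in>I. {\<tau> i - \<epsilon>..\<tau> i + \<epsilon>})"
    using assms by (intro emeasure_mono) auto
  also have "\<dots> \<le> (\<Sum>i\<in>I. emeasure lborel {\<tau> i - \<epsilon>..\<tau> i + \<epsilon>})"
    using assms(1) by (intro emeasure_subadditive_finite) auto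
  also have "\<dots> = (\<Sum>i\<in>I. ennreal (2 * \<epsilon>))"
    using assms(3) by (intro sum.cong) auto
  also have "\<dots> = ennreal (2 * \<epsilon> * real (card I))"
    using assms(3) by (simp add: ennreal_mult' ennreal_of_nat_eq_real_of_nat mult.commute)
  finally have "ennreal (b - a) \<le> ennreal (2 * \<epsilon> * real (card I))" using True by simp
  then show ?thesis using assms(3) by (simp add: ennreal_le_iff)
next
  case False
  moreover have "0 \<le> 2 * \<epsilon> * real (card I)" using assms(3) by simp
  ultimately show ?thesis by linarith
qed

context gtree begin

abbreviation "sc \<equiv> stab_card F \<Gamma>"
abbreviation "cont \<equiv> content_le F \<Gamma>"

section \<open>Stabilizers of points and edges\<close>

lemma one_in_stabilizer: "x \<in> M \<Longrightarrow> \<one> \<in> stabilizer F ac x"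
  by (simp add: stabilizer_def act_one)

lemma stab_card_ge1: "x \<in> M \<Longrightarrow> sc x \<ge> 1"
  using finite_stabilizer[of x] one_in_stabilizer[of x]
  by (simp add: stab_card_def Suc_le_eq card_gt_0_iff) auto

lemma stab_card_act:
  assumes "g \<in> G" "x \<in> M" shows "sc (ac g x) = sc x"
proof -
  have *: "card (stabilizer F ac (ac g x)) \<le> card (stabilizer F ac x)" if g: "g \<in> G" and x: "x \<in> M" for g x
  proof (rule card_inj_on_le[OF _ _ finite_stabilizer[OF x]])
    let ?c = "\<lambda>h. inv g \<otimes> h \<otimes> g"
    show "inj_on ?c (stabilizer F ac (ac g x))"
      by (rule inj_onI) (use g in \<open>auto simp: stabilizer_def\<close>)
    show "?c ` stabilizer F ac (ac g x) \<subseteq> stabilizer F ac x"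
    proof (rule image_subsetI)
      fix h assume "h \<in> stabilizer F ac (ac g x)"
      then have h: "h \<in> G" "ac h (ac g x) = ac g x" by (auto simp: stabilizer_def)
      have "ac (?c h) x = ac (inv g) (ac h (ac g x))"
        using g h(1) x act_mult[of "inv g \<otimes> h" g x] act_mult[of "inv g" h "ac g x"] act_closed by simp
      then have "ac (?c h) x = x" using h(2) act_inv1[OF g x] by simp
      then show "?c h \<in> stabilizer F ac x" using g h(1) by (simp add: stabilizer_def)
    qed
  qed
  have "card (stabilizer F ac x) \<le> card (stabilizer F ac (ac g x))"
    using *[of "inv g" "ac g x"] assms act_inv1[OF assms] act_closed[OF assms] by simp
  then show ?thesis using *[OF assms] by (simp add: stab_card_def)
qed

definition ew :: "'a set \<Rightarrow> real" where
  "ew e = real (card (stabilizer F (edge_act \<Gamma>) e))"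

text \<open>The benefit of subdividing: without inversions an element preserving \<open>e\<close>
  fixes it pointwise. Hence the weight of an interior point in \<open>content_le\<close> is the
  weight of its edge in \<open>vol\<close>.\<close>

lemma edge_stabilizer:
  assumes "e \<in> E" "x \<in> e" "x \<notin> W"
  shows "stabilizer F ac x = stabilizer F (edge_act \<Gamma>) e"
proof
  have xM: "x \<in> M" using edge_in_M assms by blast
  show "stabilizer F ac x \<subseteq> stabilizer F (edge_act \<Gamma>) e"
  proof
    fix g assume "g \<in> stabilizer F ac x"
    then have g: "g \<in> G" "ac g x = x" by (auto simp: stabilizer_def)
    have "x \<in> ac g ` e" using g(2) assms(2) by (metis imageI)
    then have "ac g ` e = e" using edge_unique[OF act_edge[OF g(1) assms(1)] assms(1) _ assms(2,3)] by simp
    then show "g \<in> stabilizer F (edge_act \<Gamma>) e" using g(1) by (simp add: stabilizer_def edge_act_def)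
  qed
  show "stabilizer F (edge_act \<Gamma>) e \<subseteq> stabilizer F ac x"
    using no_inversion[OF _ assms(1) _ assms(2)] by (auto simp: stabilizer_def edge_act_def)
qed

lemma stab_card_interior: "e \<in> E \<Longrightarrow> x \<in> e \<Longrightarrow> x \<notin> W \<Longrightarrow> sc x = ew e"
  using edge_stabilizer by (simp add: stab_card_def ew_def)

text \<open>At an end of the edge the stabilizer may be larger. The inequality has the direction
  needed for upper bounds on content; lower bounds use interior points only.\<close>

lemma ew_le_stab_card:
  assumes "e \<in> E" "x \<in> e" shows "ew e \<le> sc x"
proof -
  have "stabilizer F (edge_act \<Gamma>) e \<subseteq> stabilizer F ac x"
    using no_inversion[OF _ assms(1) _ assms(2)] by (auto simp: stabilizer_def edge_act_def)
  then show ?thesis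
    using finite_stabilizer edge_in_M[OF assms] by (simp add: stab_card_def ew_def card_mono)
qed

lemma edge_interior_pt:
  assumes "u \<in> M" "v \<in> M" "e = sg u v" "e \<inter> W = {u, v}" "0 < t" "t < d u v"
  shows "pt u v t \<in> e" "pt u v t \<notin> W"
proof -
  have t: "t \<in> {0..d u v}" using assms by simp
  show 1: "pt u v t \<in> e" using pt(1)[OF assms(1,2) t] assms(3) by simp
  have 2: "d u (pt u v t) = t" using pt(2)[OF assms(1,2) t] .
  show "pt u v t \<notin> W"
  proof
    assume "pt u v t \<in> W"
    then have "pt u v t = u \<or> pt u v t = v" using 1 assms(4) by blast
    then show False using 2 assms by auto
  qed
qed

lemma edge_has_interior: "e \<in> E \<Longrightarrow> \<exists>x\<in>e. x \<notin> W"
proof -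
  assume "e \<in> E"
  then obtain u v where uv: "u \<in> W" "v \<in> W" "u \<noteq> v" "e = sg u v" "e \<inter> W = {u, v}" "u \<in> M" "v \<in> M"
    by (rule edgeE)
  have "d u v > 0" using dist_zeroD[OF uv(6,7)] uv(3) by linarith
  then show ?thesis using edge_interior_pt[OF uv(6,7,4,5), of "d u v / 2"] by auto
qed

lemma ew_ge1:
  assumes "e \<in> E" shows "ew e \<ge> 1"
proof -
  obtain x where x: "x \<in> e" "x \<notin> W" using edge_has_interior[OF assms] by auto
  then show ?thesis using stab_card_interior[OF assms x] stab_card_ge1[OF edge_in_M[OF assms x(1)]] by simp
qed

lemma edge_length:
  assumes "x \<in> M" "y \<in> M" shows "edge_length \<Gamma> (sg x y) = d x y"
  unfolding edge_length_def
proof (rule cSup_eq_maximum)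
  show "d x y \<in> (\<lambda>(x, y). d x y) ` (sg x y \<times> sg x y)"
    using seg_ends[OF assms] by (intro image_eqI[of _ _ "(x, y)"]) auto
  fix r assume "r \<in> (\<lambda>(x, y). d x y) ` (sg x y \<times> sg x y)"
  then obtain p q where pq: "p \<in> sg x y" "q \<in> sg x y" "r = d p q" by auto
  show "r \<le> d x y"
    using seg_same_dist[OF pq(1,2) assms] seg_dist_le[OF pq(1)] seg_dist_le[OF pq(2)] pq(3)
      mdist_nonneg[of "metr \<Gamma>" x p] mdist_nonneg[of "metr \<Gamma>" x q] by linarith
qed

section \<open>Calculus of content\<close>

lemma content_mono:
  assumes "cont J a" "I \<subseteq> J" "a \<le> b" shows "cont I b"
proof -
  obtain c where c: "\<And>\<epsilon>. \<epsilon> > 0 \<Longrightarrow> \<exists>B. finite B \<and> B \<subseteq> M \<and>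
     (\<forall>y\<in>J. \<exists>g\<in>G. \<exists>b\<in>B. d y (ac g b) \<le> \<epsilon>) \<and> (\<Sum>b\<in>B. 1 / sc b) \<le> a / (2 * \<epsilon>) + c"
    using assms(1) unfolding content_le_def by auto
  show ?thesis
    unfolding content_le_def
  proof (intro exI[of _ c] allI impI)
    fix \<epsilon> :: real assume e: "\<epsilon> > 0"
    have "a / (2 * \<epsilon>) \<le> b / (2 * \<epsilon>)" using assms(3) e by (intro divide_right_mono) auto
    moreover obtain B where "finite B" "B \<subseteq> M" "\<forall>y\<in>J. \<exists>g\<in>G. \<exists>b\<in>B. d y (ac g b) \<le> \<epsilon>"
      "(\<Sum>b\<in>B. 1 / sc b) \<le> a / (2 * \<epsilon>) + c" using c[OF e] by auto
    ultimately show "\<exists>B. finite B \<and> B \<subseteq> M \<and>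
     (\<forall>y\<in>I. \<exists>g\<in>G. \<exists>b\<in>B. d y (ac g b) \<le> \<epsilon>) \<and> (\<Sum>b\<in>B. 1 / sc b) \<le> b / (2 * \<epsilon>) + c"
      using assms(2) by (intro exI[of _ B]) auto
  qed
qed

lemma content_empty: "cont {} 0"
  unfolding content_le_def by (intro exI[of _ 0] allI impI exI[of _ "{}"]) auto

lemma content_Un:
  assumes "cont I a" "cont J b" shows "cont (I \<union> J) (a + b)"
proof -
  obtain c where c: "\<And>\<epsilon>. \<epsilon> > 0 \<Longrightarrow> \<exists>B. finite B \<and> B \<subseteq> M \<and>
     (\<forall>y\<in>I. \<exists>g\<in>G. \<exists>b\<in>B. d y (ac g b) \<le> \<epsilon>) \<and> (\<Sum>b\<in>B. 1 / sc b) \<le> a / (2 * \<epsilon>) + c"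
    using assms(1) unfolding content_le_def by auto
  obtain c' where c': "\<And>\<epsilon>. \<epsilon> > 0 \<Longrightarrow> \<exists>B. finite B \<and> B \<subseteq> M \<and>
     (\<forall>y\<in>J. \<exists>g\<in>G. \<exists>b\<in>B. d y (ac g b) \<le> \<epsilon>) \<and> (\<Sum>b\<in>B. 1 / sc b) \<le> b / (2 * \<epsilon>) + c'"
    using assms(2) unfolding content_le_def by auto
  show ?thesis
    unfolding content_le_def
  proof (intro exI[of _ "c + c'"] allI impI)
    fix \<epsilon> :: real assume e: "\<epsilon> > 0"
    obtain B where B: "finite B" "B \<subseteq> M" "\<forall>y\<in>I. \<exists>g\<in>G. \<exists>b\<in>B. d y (ac g b) \<le> \<epsilon>"
      "(\<Sum>b\<in>B. 1 / sc b) \<le> a / (2 * \<epsilon>) + c" using c[OF e] by auto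
    obtain B' where B': "finite B'" "B' \<subseteq> M" "\<forall>y\<in>J. \<exists>g\<in>G. \<exists>b\<in>B'. d y (ac g b) \<le> \<epsilon>"
      "(\<Sum>b\<in>B'. 1 / sc b) \<le> b / (2 * \<epsilon>) + c'" using c'[OF e] by auto
    have "(\<Sum>b\<in>B \<union> B'. 1 / sc b) \<le> (\<Sum>b\<in>B. 1 / sc b) + (\<Sum>b\<in>B'. 1 / sc b)"
    proof -
      have "(\<Sum>b\<in>B \<union> B'. 1 / sc b) + (\<Sum>b\<in>B \<inter> B'. 1 / sc b) = (\<Sum>b\<in>B. 1 / sc b) + (\<Sum>b\<in>B'. 1 / sc b)"
        using B(1) B'(1) by (rule sum.union_inter)
      moreover have "0 \<le> (\<Sum>b\<in>B \<inter> B'. 1 / sc b)" by (intro sum_nonneg) (simp add: stab_card_def)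
      ultimately show ?thesis by linarith
    qed
    also have "\<dots> \<le> (a + b) / (2 * \<epsilon>) + (c + c')"
      using B(4) B'(4) by (simp add: add_divide_distrib)
    finally have "(\<Sum>b\<in>B \<union> B'. 1 / sc b) \<le> (a + b) / (2 * \<epsilon>) + (c + c')" .
    moreover have "\<forall>y\<in>I \<union> J. \<exists>g\<in>G. \<exists>b\<in>B \<union> B'. d y (ac g b) \<le> \<epsilon>" using B(3) B'(3) by blast
    ultimately show "\<exists>B. finite B \<and> B \<subseteq> M \<and>
     (\<forall>y\<in>I \<union> J. \<exists>g\<in>G. \<exists>b\<in>B. d y (ac g b) \<le> \<epsilon>) \<and> (\<Sum>b\<in>B. 1 / sc b) \<le> (a + b) / (2 * \<epsilon>) + (c + c')"
      using B(1,2) B'(1,2) by (intro exI[of _ "B \<union> B'"]) auto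
  qed
qed

lemma content_UN:
  assumes "finite I" "\<And>i. i \<in> I \<Longrightarrow> cont (J i) (a i)"
  shows "cont (\<Union>i\<in>I. J i) (\<Sum>i\<in>I. a i)"
  using assms
proof (induction I rule: finite_induct)
  case empty then show ?case using content_empty by simp
next
  case (insert i I)
  then show ?case using content_Un[of "J i" "a i" "\<Union>i\<in>I. J i" "\<Sum>i\<in>I. a i"] by simp
qed

definition sat :: "'a set \<Rightarrow> 'a set" where
  "sat J = {x \<in> M. \<exists>g\<in>G. ac g x \<in> J}"

text \<open>Covering is measured up to translation, so the centres for \<open>J\<close> serve all
  its translates.\<close>

lemma content_sat:
  assumes "cont J a" shows "cont (sat J) a"
proof -
  obtain c where c: "\<And>\<epsilon>. \<epsilon> > 0 \<Longrightarrow> \<exists>B. finite B \<and> B \<subseteq> M \<and>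
     (\<forall>y\<in>J. \<exists>g\<in>G. \<exists>b\<in>B. d y (ac g b) \<le> \<epsilon>) \<and> (\<Sum>b\<in>B. 1 / sc b) \<le> a / (2 * \<epsilon>) + c"
    using assms(1) unfolding content_le_def by auto
  show ?thesis
    unfolding content_le_def
  proof (intro exI[of _ c] allI impI)
    fix \<epsilon> :: real assume e: "\<epsilon> > 0"
    obtain B where B: "finite B" "B \<subseteq> M" "\<forall>y\<in>J. \<exists>g\<in>G. \<exists>b\<in>B. d y (ac g b) \<le> \<epsilon>"
      "(\<Sum>b\<in>B. 1 / sc b) \<le> a / (2 * \<epsilon>) + c" using c[OF e] by auto
    have "\<exists>g\<in>G. \<exists>b\<in>B. d x (ac g b) \<le> \<epsilon>" if x: "x \<in> sat J" for x
    proof -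
      obtain h where h: "h \<in> G" "ac h x \<in> J" "x \<in> M" using x by (auto simp: sat_def)
      obtain g b where g: "g \<in> G" "b \<in> B" "d (ac h x) (ac g b) \<le> \<epsilon>" using B(3) h(2) by blast
      have bM: "b \<in> M" using g(2) B(2) by blast
      have ih: "inv h \<in> G" using h(1) by simp
      have "d (ac (inv h) (ac h x)) (ac (inv h) (ac g b)) \<le> \<epsilon>"
        using act_isom[OF ih act_closed[OF h(1,3)] act_closed[OF g(1) bM]] g(3) by simp
      then have "d x (ac (inv h \<otimes> g) b) \<le> \<epsilon>"
        using act_inv1[OF h(1,3)] act_mult[OF ih g(1) bM] by simp
      then show ?thesis using ih g(1,2) by (intro bexI[of _ "inv h \<otimes> g"] bexI[of _ b]) auto
    qed
    then show "\<exists>B. finite B \<and> B \<subseteq> M \<and>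
     (\<forall>y\<in>sat J. \<exists>g\<in>G. \<exists>b\<in>B. d y (ac g b) \<le> \<epsilon>) \<and> (\<Sum>b\<in>B. 1 / sc b) \<le> a / (2 * \<epsilon>) + c"
      using B by (intro exI[of _ B]) simp
  qed
qed

text \<open>Centres at the odd multiples of \<open>\<epsilon>\<close> cover the segment. There are
  at most \<open>d x y / (2 * \<epsilon>) + 1\<close> of them, each of weight at most
  \<open>1 / k\<close>; the extra one accounts for the constant \<open>1 / k\<close>.\<close>

lemma content_seg:
  assumes xy: "x \<in> M" "y \<in> M" and k: "k > 0" "\<And>z. z \<in> sg x y \<Longrightarrow> k \<le> sc z"
  shows "cont (sg x y) (d x y / k)"
  unfolding content_le_def
proof (intro exI[of _ "1 / k"] allI impI)
  fix \<epsilon> :: real assume e: "\<epsilon> > 0"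
  define n where "n = nat \<lfloor>d x y / (2 * \<epsilon>)\<rfloor> + 1"
  \<comment> \<open>The minimum keeps the last centre on the segment.\<close>
  define \<tau> where "\<tau> i = min (d x y) ((2 * real i + 1) * \<epsilon>)" for i
  define B where "B = (\<lambda>i. pt x y (\<tau> i)) ` {..<n}"
  have tau: "\<tau> i \<in> {0..d x y}" for i using e by (auto simp: \<tau>_def)
  have Bs: "B \<subseteq> sg x y" using pt(1)[OF xy tau] by (auto simp: B_def)
  have finB: "finite B" by (simp add: B_def)
  have cov: "\<exists>g\<in>G. \<exists>b\<in>B. d z (ac g b) \<le> \<epsilon>" if z: "z \<in> sg x y" for z
  proof -
    define t where "t = d x z"
    have t: "t \<in> {0..d x y}" "pt x y t = z" using pt_seg[OF z xy] by (auto simp: t_def)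
    define i where "i = nat \<lfloor>t / (2 * \<epsilon>)\<rfloor>"
    have t0: "0 \<le> t / (2 * \<epsilon>)" using t e by simp
    have ri: "real i = of_int \<lfloor>t / (2 * \<epsilon>)\<rfloor>" using t0 by (simp add: i_def)
    have "real i \<le> t / (2 * \<epsilon>)" "t / (2 * \<epsilon>) < real i + 1" unfolding ri by linarith+
    then have b: "2 * real i * \<epsilon> \<le> t" "t < (2 * real i + 2) * \<epsilon>" using e by (auto simp: field_simps)
    have "\<lfloor>t / (2 * \<epsilon>)\<rfloor> \<le> \<lfloor>d x y / (2 * \<epsilon>)\<rfloor>"
      using t(1) e by (intro floor_mono divide_right_mono) auto
    then have "i < n" unfolding i_def n_def by linarith
    then have inB: "pt x y (\<tau> i) \<in> B" by (simp add: B_def)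
    have "\<bar>t - \<tau> i\<bar> \<le> \<epsilon>"
      using b t(1) unfolding \<tau>_def by (auto simp: min_def algebra_simps abs_le_iff)
    then have "d z (pt x y (\<tau> i)) \<le> \<epsilon>" using pt_dist[OF xy t(1) tau] t(2) by simp
    moreover have "ac \<one> (pt x y (\<tau> i)) = pt x y (\<tau> i)" using act_one seg_in_M[OF pt(1)[OF xy tau]] by simp
    ultimately show ?thesis using inB F.one_closed by metis
  qed
  have "(\<Sum>b\<in>B. 1 / sc b) \<le> (\<Sum>b\<in>B. 1 / k)"
    using k Bs by (intro sum_mono divide_left_mono) (auto intro!: mult_pos_pos intro: less_le_trans)
  also have "\<dots> = real (card B) / k" by simp
  also have "\<dots> \<le> real n / k"
    using k(1) card_image_le[of "{..<n}" "\<lambda>i. pt x y (\<tau> i)"] by (intro divide_right_mono) (auto simp: B_def)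
  also have "\<dots> \<le> (d x y / (2 * \<epsilon>) + 1) / k"
  proof (intro divide_right_mono)
    have "real (nat \<lfloor>d x y / (2 * \<epsilon>)\<rfloor>) = of_int \<lfloor>d x y / (2 * \<epsilon>)\<rfloor>" using e by simp
    then show "real n \<le> d x y / (2 * \<epsilon>) + 1" unfolding n_def by simp
  qed (use k in simp)
  also have "\<dots> = d x y / k / (2 * \<epsilon>) + 1 / k" by (simp add: add_divide_distrib)
  finally show "\<exists>B. finite B \<and> B \<subseteq> M \<and> (\<forall>y\<in>sg x y. \<exists>g\<in>G. \<exists>b\<in>B. d y (ac g b) \<le> \<epsilon>) \<and>
      (\<Sum>b\<in>B. 1 / sc b) \<le> d x y / k / (2 * \<epsilon>) + 1 / k"
  proof (intro exI[of _ B] conjI ballI)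
    show "B \<subseteq> M" using Bs seg_in_M by auto
  qed (use finB cov in simp_all)
qed

section \<open>Transversals of the edge orbits\<close>

lemma edge_weight_act:
  assumes "g \<in> G" "e \<in> E"
  shows "edge_length \<Gamma> (ac g ` e) = edge_length \<Gamma> e" "ew (ac g ` e) = ew e"
proof -
  obtain u v where uv: "u \<in> W" "v \<in> W" "u \<noteq> v" "e = sg u v" "e \<inter> W = {u, v}" "u \<in> M" "v \<in> M"
    using edgeE[OF assms(2)] .
  show "edge_length \<Gamma> (ac g ` e) = edge_length \<Gamma> e"
    using act_seg[OF assms(1) uv(6,7)] edge_length[OF uv(6,7)] act_isom[OF assms(1) uv(6,7)]
      edge_length[OF act_closed[OF assms(1) uv(6)] act_closed[OF assms(1) uv(7)]] uv(4) by simp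
  obtain x where x: "x \<in> e" "x \<notin> W" using edge_has_interior[OF assms(2)] by auto
  have xM: "x \<in> M" using edge_in_M[OF assms(2) x(1)] .
  have "ac g x \<notin> W" using act_invariant_iff[OF act_W assms(1) xM] x(2) by simp
  then have "sc (ac g x) = ew (ac g ` e)"
    using stab_card_interior[OF act_edge[OF assms]] x(1) by blast
  then show "ew (ac g ` e) = ew e"
    using stab_card_interior[OF assms(2) x] stab_card_act[OF assms(1) xM] by simp
qed

text \<open>A transversal of the edge orbits, bundled with the finite sum that it gives for the
  volume; the lifts chosen in \<open>vol\<close> do not appear after this.\<close>

definition edge_reps :: "'a set set \<Rightarrow> bool" where
  "edge_reps R \<longleftrightarrow> finite R \<and> R \<subseteq> E \<and> (\<forall>e\<in>E. \<exists>g\<in>G. ac g ` e \<in> R) \<and>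
     (\<forall>e\<in>R. \<forall>e'\<in>R. \<forall>g\<in>G. ac g ` e = e' \<longrightarrow> e = e') \<and>
     vol F \<Gamma> = (\<Sum>e\<in>R. edge_length \<Gamma> e / ew e)"

lemma edge_repsD:
  assumes "edge_reps R"
  shows "finite R" "R \<subseteq> E" "\<And>e. e \<in> E \<Longrightarrow> \<exists>g\<in>G. ac g ` e \<in> R"
    "\<And>e e' g. e \<in> R \<Longrightarrow> e' \<in> R \<Longrightarrow> g \<in> G \<Longrightarrow> ac g ` e = e' \<Longrightarrow> e = e'"
    "vol F \<Gamma> = (\<Sum>e\<in>R. edge_length \<Gamma> e / ew e)"
  using assms unfolding edge_reps_def by (blast+)

text \<open>The accounting needs transversals containing prescribed edges; any set \<open>A0\<close>
  of edges from distinct orbits can be completed. The value of \<open>vol\<close> is unaffected,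
  since length and stabilizer order are constant on orbits.\<close>

lemma vol_reps:
  assumes A0: "A0 \<subseteq> E" "\<And>e e' g. e \<in> A0 \<Longrightarrow> e' \<in> A0 \<Longrightarrow> g \<in> G \<Longrightarrow> ac g ` e = e' \<Longrightarrow> e = e'"
  shows "\<exists>R. edge_reps R \<and> A0 \<subseteq> R"
proof -
  let ?O = "orbits F E (edge_act \<Gamma>)"
  let ?orb = "orbit F (edge_act \<Gamma>)"
  \<comment> \<open>Prefers an element of \<open>A0\<close> if the orbit has one; \<open>sel\<close>
    is the choice made in \<open>vol\<close>.\<close>
  define rep where "rep Q = (SOME e. e \<in> Q \<and> (A0 \<inter> Q \<noteq> {} \<longrightarrow> e \<in> A0))" for Q :: "'a set set"
  define sel where "sel Q = (SOME e. e \<in> Q)" for Q :: "'a set set"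
  have E_M: "e \<in> E \<Longrightarrow> e \<subseteq> M" for e using edge_in_M by blast
  have mult: "ac (g \<otimes> h) ` e = ac g ` ac h ` e" if "g \<in> G" "h \<in> G" "e \<in> E" for g h e
    using act_mult[OF that(1,2)] E_M[OF that(3)] by (force simp: image_image)
  have one: "ac \<one> ` e = e" if "e \<in> E" for e
    using act_one E_M[OF that] by (force simp: image_iff)
  have orb: "?orb e = {ac g ` e | g. g \<in> G}" for e by (simp add: orbit_def edge_act_def)
  have orb_eq: "?orb e' = ?orb e" if e: "e \<in> E" "g \<in> G" "e' = ac g ` e" for e e' g
  proof
    show "?orb e' \<subseteq> ?orb e"
    proof
      fix f assume "f \<in> ?orb e'"
      then obtain h where h: "h \<in> G" "f = ac h ` e'" by (auto simp: orb)
      then have "f = ac (h \<otimes> g) ` e" using mult[OF h(1) e(2,1)] e(3) by simp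
      then show "f \<in> ?orb e" using h(1) e(2) orb by auto
    qed
    show "?orb e \<subseteq> ?orb e'"
    proof
      fix f assume "f \<in> ?orb e"
      then obtain h where h: "h \<in> G" "f = ac h ` e" by (auto simp: orb)
      have "ac (inv g) ` e' = e"
        using mult[of "inv g" g e] one[OF e(1)] e by simp
      then have "f = ac (h \<otimes> inv g) ` e'"
        using mult[OF h(1) _ act_edge[OF e(2,1)], of "inv g"] e h(2) by simp
      then show "f \<in> ?orb e'" using h(1) e(2) orb by auto
    qed
  qed
  have rep: "rep Q \<in> E \<and> ?orb (rep Q) = Q \<and> rep Q \<in> Q \<and> (A0 \<inter> Q \<noteq> {} \<longrightarrow> rep Q \<in> A0)" if "Q \<in> ?O" for Q
  proof -
    obtain e where e: "e \<in> E" "Q = ?orb e" using \<open>Q \<in> ?O\<close> by (auto simp: orbits_def)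
    have "e \<in> Q" using e one[OF e(1)] F.one_closed orb by auto
    then have "\<exists>e. e \<in> Q \<and> (A0 \<inter> Q \<noteq> {} \<longrightarrow> e \<in> A0)" by blast
    then have r: "rep Q \<in> Q \<and> (A0 \<inter> Q \<noteq> {} \<longrightarrow> rep Q \<in> A0)" unfolding rep_def by (rule someI_ex)
    then obtain g where "g \<in> G" "rep Q = ac g ` e" using e(2) orb by auto
    then show ?thesis using orb_eq[OF e(1)] act_edge e r by simp
  qed
  have inj: "Q = Q'" if Q: "Q \<in> ?O" "Q' \<in> ?O" "g \<in> G" "ac g ` rep Q = rep Q'" for Q Q' g
    using orb_eq[of "rep Q" g "rep Q'"] rep[OF Q(1)] rep[OF Q(2)] Q(3,4) by simp
  have injon: "inj_on rep ?O"
  proof (rule inj_onI)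
    fix Q Q' assume Q: "Q \<in> ?O" "Q' \<in> ?O" "rep Q = rep Q'"
    have "ac \<one> ` rep Q = rep Q'" using one rep[OF Q(1)] Q(3) by simp
    then show "Q = Q'" using inj[OF Q(1,2) F.one_closed] by blast
  qed
  obtain R0 where R0: "finite R0" "R0 \<subseteq> E" "\<forall>e\<in>E. \<exists>g\<in>G. ac g ` e \<in> R0"
    using finite_edge_orbits by auto
  have "?O \<subseteq> ?orb ` R0"
  proof
    fix Q assume "Q \<in> ?O"
    then obtain e where e: "e \<in> E" "Q = ?orb e" by (auto simp: orbits_def)
    obtain g where g: "g \<in> G" "ac g ` e \<in> R0" using R0(3) e(1) by auto
    have "Q = ?orb (ac g ` e)" using orb_eq[OF e(1) g(1)] e(2) by simp
    then show "Q \<in> ?orb ` R0" using g(2) by blast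
  qed
  then have finO: "finite ?O" using R0(1) finite_subset by blast
  \<comment> \<open>Finitely many orbits, so the infinite sum is an ordinary one.\<close>
  have "vol F \<Gamma> = (\<Sum>Q\<in>?O. edge_length \<Gamma> (sel Q) / ew (sel Q))"
    unfolding vol_def subdivided_edges Let_def sel_def[symmetric] ew_def[symmetric]
    using finO by (rule infsum_finite)
  also have "\<dots> = (\<Sum>Q\<in>?O. edge_length \<Gamma> (rep Q) / ew (rep Q))"
  proof (rule sum.cong[OF refl])
    fix Q assume Q: "Q \<in> ?O"
    have "sel Q \<in> ?orb (rep Q)" using rep[OF Q] unfolding sel_def by (metis someI)
    then obtain g where "g \<in> G" "sel Q = ac g ` rep Q" using orb by auto
    then show "edge_length \<Gamma> (sel Q) / ew (sel Q) = edge_length \<Gamma> (rep Q) / ew (rep Q)"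
      using edge_weight_act rep[OF Q] by simp
  qed
  also have "\<dots> = (\<Sum>e\<in>rep ` ?O. edge_length \<Gamma> e / ew e)"
    using injon by (simp add: sum.reindex)
  finally have vol: "vol F \<Gamma> = (\<Sum>e\<in>rep ` ?O. edge_length \<Gamma> e / ew e)" .
  have sub: "A0 \<subseteq> rep ` ?O"
  proof
    fix e assume e: "e \<in> A0"
    then have eE: "e \<in> E" using A0(1) by blast
    have Q: "?orb e \<in> ?O" using eE by (auto simp: orbits_def)
    have "e \<in> ?orb e" using one[OF eE] F.one_closed orb by auto
    then have "rep (?orb e) \<in> A0" "rep (?orb e) \<in> ?orb e" using rep[OF Q] e by auto
    moreover from this(2) obtain g where "g \<in> G" "ac g ` e = rep (?orb e)" using orb by auto
    ultimately have "e = rep (?orb e)" using A0(2) e by blast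
    then show "e \<in> rep ` ?O" using Q by blast
  qed
  have "edge_reps (rep ` ?O)"
    unfolding edge_reps_def
  proof (intro conjI ballI impI)
    show "vol F \<Gamma> = (\<Sum>e\<in>rep ` ?O. edge_length \<Gamma> e / ew e)" by (rule vol)
    show "finite (rep ` ?O)" using finO by simp
    show "rep ` ?O \<subseteq> E" using rep by blast
    show "\<exists>g\<in>G. ac g ` e \<in> rep ` ?O" if e: "e \<in> E" for e
    proof -
      have Q: "?orb e \<in> ?O" using e by (auto simp: orbits_def)
      then have "rep (?orb e) \<in> ?orb e" using rep by blast
      then obtain g where "g \<in> G" "rep (?orb e) = ac g ` e" using orb by auto
      then show ?thesis using Q by force
    qed
    show "e = e'" if "e \<in> rep ` ?O" "e' \<in> rep ` ?O" "g \<in> G" "ac g ` e = e'" for e e' g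
      using that inj by blast
  qed
  then show ?thesis using sub by blast
qed

section \<open>Comparison of content with volume\<close>

lemma edge_pt:
  assumes "e = sg u v" "u \<in> M" "v \<in> M" "s \<in> {0..d u v}"
  shows "pt u v s \<in> e" "d u (pt u v s) = s" "d (pt u v s) v = d u v - s" "pt u v s \<in> M"
proof -
  show 1: "pt u v s \<in> e" and 2: "d u (pt u v s) = s" using pt[OF assms(2-4)] assms(1) by auto
  then show "d (pt u v s) v = d u v - s" using seg_dist_sum[of "pt u v s" u v] assms(1) by simp
  show "pt u v s \<in> M" using 1 assms(1) seg_in_M by simp
qed

text \<open>Edge interiors embed in the quotient: the element taking one point to the other
  preserves the edge, which it then fixes pointwise by \<open>no_inversion\<close>.\<close>

lemma sat_interior_unique:
  assumes e: "e \<in> E" and b: "b \<in> M" and g: "g \<in> G" "ac g b \<in> e" "ac g b \<notin> W" and h: "h \<in> G" "ac h b \<in> e"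
  shows "ac g b = ac h b"
proof -
  have gM: "ac g b \<in> M" using act_closed[OF g(1) b] .
  let ?k = "h \<otimes> inv g"
  have k: "?k \<in> G" using g h by simp
  have kb: "ac ?k (ac g b) = ac h b"
    using act_mult[OF h(1) F.inv_closed[OF g(1)] gM] act_inv1[OF g(1) b] by simp
  have hW: "ac h b \<notin> W" using act_invariant_iff[OF act_W k gM] g(3) kb by simp
  have "ac h b \<in> ac ?k ` e" using kb g(2) by (metis imageI)
  then have "ac ?k ` e = e" using edge_unique[OF act_edge[OF k e] e _ h(2) hW] by simp
  then have "ac ?k (ac g b) = ac g b" using no_inversion[OF k e _ g(2)] by simp
  then show ?thesis using kb by simp
qed

text \<open>A point deep inside \<open>e\<close> is covered only by translates of centres that lie
  in the interior of \<open>e\<close>. Each such centre has a unique position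
  \<open>\<tau> b\<close> there and weight \<open>1 / ew e\<close>, and it covers at most length
  \<open>2 * \<epsilon>\<close>.\<close>

lemma content_lower_edge:
  assumes e: "e \<in> E" and B: "finite B" "B \<subseteq> M" and eps: "\<epsilon> > 0"
    and dense: "\<forall>y\<in>M. \<exists>g\<in>G. \<exists>b\<in>B. d y (ac g b) \<le> \<epsilon>"
  defines "Be \<equiv> {b \<in> B. \<exists>g\<in>G. ac g b \<in> e \<and> ac g b \<notin> W}"
  shows "edge_length \<Gamma> e / ew e / (2 * \<epsilon>) - 1 / ew e \<le> (\<Sum>b\<in>Be. 1 / sc b)"
proof -
  obtain u v where uv: "u \<in> W" "v \<in> W" "u \<noteq> v" "e = sg u v" "e \<inter> W = {u, v}" "u \<in> M" "v \<in> M"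
    using edgeE[OF e] .
  define D where "D = d u v"
  define gg where "gg b = (SOME g. g \<in> G \<and> ac g b \<in> e \<and> ac g b \<notin> W)" for b
  have gg: "gg b \<in> G \<and> ac (gg b) b \<in> e \<and> ac (gg b) b \<notin> W" if "b \<in> Be" for b
    unfolding gg_def by (rule someI_ex) (use that in \<open>auto simp: Be_def\<close>)
  define \<tau> where "\<tau> b = d u (ac (gg b) b)" for b
  have BeB: "Be \<subseteq> B" by (auto simp: Be_def)
  have finBe: "finite Be" using B(1) BeB finite_subset by blast
  \<comment> \<open>Points more than \<open>\<epsilon>\<close> away from both ends cannot be covered
    from an end or, by \<open>edge_exit\<close>, from outside the edge. The total loss of length
    \<open>2 * \<epsilon>\<close> costs one centre.\<close>
  have "{\<epsilon><..<D - \<epsilon>} \<subseteq> (\<Union>b\<in>Be. {\<tau> b - \<epsilon>..\<tau> b + \<epsilon>})"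
  proof
    fix t assume t: "t \<in> {\<epsilon><..<D - \<epsilon>}"
    then have tD: "t \<in> {0..d u v}" using eps by (auto simp: D_def)
    define y where "y = pt u v t"
    have y: "y \<in> e" "d u y = t" "d y v = D - t" "y \<in> M"
      using edge_pt[OF uv(4,6,7) tD] by (simp_all add: y_def D_def)
    have yW: "y \<notin> W"
    proof
      assume "y \<in> W"
      then have "y = u \<or> y = v" using y(1) uv(5) by blast
      then show False using y(2,3) t eps uv(6,7) by auto
    qed
    obtain g b where gb: "g \<in> G" "b \<in> B" "d y (ac g b) \<le> \<epsilon>" using dense y(4) by blast
    have bM: "b \<in> M" using gb(2) B(2) by blast
    have zM: "ac g b \<in> M" using act_closed[OF gb(1) bM] .
    have far: "d y w > \<epsilon>" if "w \<in> e" "w \<in> W" for w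
    proof -
      have "w = u \<or> w = v" using that uv(5) by blast
      then show ?thesis using y(2,3) t mdist_commute[of "metr \<Gamma>" y u] by auto
    qed
    have ze: "ac g b \<in> e"
    proof (rule ccontr)
      assume "ac g b \<notin> e"
      then obtain w where w: "w \<in> sg y (ac g b)" "w \<in> e" "w \<in> W"
        using edge_exit[OF e y(1) yW zM] by auto
      show False using far[OF w(2,3)] seg_dist_le[OF w(1)] gb(3) by linarith
    qed
    have zW: "ac g b \<notin> W" using far[OF ze] gb(3) by auto
    have b: "b \<in> Be" using gb ze zW by (auto simp: Be_def)
    have "ac g b = ac (gg b) b" using sat_interior_unique[OF e bM gb(1) ze zW] gg[OF b] by blast
    then have "\<tau> b = d u (ac g b)" by (simp add: \<tau>_def)
    then have "\<bar>t - \<tau> b\<bar> \<le> \<epsilon>"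
      using seg_same_dist[of y u v "ac g b"] y(1,2) ze uv(4,6,7) gb(3) by simp
    then show "t \<in> (\<Union>b\<in>Be. {\<tau> b - \<epsilon>..\<tau> b + \<epsilon>})" using b by (intro UN_I[of b]) (auto simp: abs_le_iff)
  qed
  then have "(D - \<epsilon>) - \<epsilon> \<le> 2 * \<epsilon> * real (card Be)"
    using finBe eps by (intro card_intervals_cover) auto
  then have cardBe: "D / (2 * \<epsilon>) - 1 \<le> real (card Be)" using eps by (simp add: field_simps)
  have "sc b = ew e" if b: "b \<in> Be" for b
    using stab_card_interior[OF e] gg[OF b] stab_card_act[of "gg b" b] b BeB B(2) by auto
  then have "(\<Sum>b\<in>Be. 1 / sc b) = real (card Be) / ew e" by simp
  moreover have "(D / (2 * \<epsilon>) - 1) / ew e \<le> real (card Be) / ew e"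
    using cardBe ew_ge1[OF e] by (intro divide_right_mono) auto
  moreover have "edge_length \<Gamma> e = D" using edge_length uv by (simp add: D_def)
  ultimately show ?thesis by (simp add: diff_divide_distrib mult.commute)
qed

text \<open>Centres for edges in different orbits are different, so the bounds of
  \<open>content_lower_edge\<close> add up. The total loss \<open>C\<close> does not depend on
  \<open>\<epsilon>\<close>, so for small \<open>\<epsilon>\<close> a positive gap
  \<open>vol F \<Gamma> - a\<close> outweighs all constants.\<close>

lemma content_lower:
  assumes "cont M a" shows "vol F \<Gamma> \<le> a"
proof (rule ccontr)
  assume "\<not> ?thesis"
  then have gap: "vol F \<Gamma> - a > 0" by simp
  obtain R where "edge_reps R" using vol_reps[of "{}"] by auto
  note R = edge_repsD[OF this]
  obtain c where c: "\<And>\<epsilon>. \<epsilon> > 0 \<Longrightarrow> \<exists>B. finite B \<and> B \<subseteq> M \<and>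
     (\<forall>y\<in>M. \<exists>g\<in>G. \<exists>b\<in>B. d y (ac g b) \<le> \<epsilon>) \<and> (\<Sum>b\<in>B. 1 / sc b) \<le> a / (2 * \<epsilon>) + c"
    using assms(1) unfolding content_le_def by auto
  define C where "C = (\<Sum>e\<in>R. 1 / ew e)"
  \<comment> \<open>Chosen so that the gap divided by \<open>2 * \<epsilon>\<close> is
    \<open>2 * (\<bar>c + C\<bar> + 1)\<close>, which exceeds \<open>c + C\<close>.\<close>
  define \<epsilon> where "\<epsilon> = (vol F \<Gamma> - a) / (4 * (\<bar>c + C\<bar> + 1))"
  have "\<bar>c + C\<bar> + 1 > 0" using abs_ge_zero[of "c + C"] by linarith
  then have eps: "\<epsilon> > 0" unfolding \<epsilon>_def using gap by (intro divide_pos_pos mult_pos_pos) auto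
  obtain B where B: "finite B" "B \<subseteq> M" "\<forall>y\<in>M. \<exists>g\<in>G. \<exists>b\<in>B. d y (ac g b) \<le> \<epsilon>"
    "(\<Sum>b\<in>B. 1 / sc b) \<le> a / (2 * \<epsilon>) + c" using c[OF eps] by auto
  define Be where "Be e = {b \<in> B. \<exists>g\<in>G. ac g b \<in> e \<and> ac g b \<notin> W}" for e
  have disj: "Be e \<inter> Be e' = {}" if e: "e \<in> R" "e' \<in> R" "e \<noteq> e'" for e e'
  proof (rule ccontr)
    assume "Be e \<inter> Be e' \<noteq> {}"
    then obtain b g h where b: "b \<in> B" and g: "g \<in> G" "ac g b \<in> e" "ac g b \<notin> W"
      and h: "h \<in> G" "ac h b \<in> e'" "ac h b \<notin> W" by (auto simp: Be_def)
    have bM: "b \<in> M" using b B(2) by blast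
    let ?k = "h \<otimes> inv g"
    have k: "?k \<in> G" using g h by simp
    have "ac ?k (ac g b) = ac h b"
      using act_mult[OF h(1) F.inv_closed[OF g(1)] act_closed[OF g(1) bM]] act_inv1[OF g(1) bM] by simp
    then have "ac h b \<in> ac ?k ` e" using g(2) by (metis imageI)
    then have "ac ?k ` e = e'"
      using edge_unique[OF act_edge[OF k] _ _ h(2,3), of e] R(2) e by blast
    then show False using R(4)[OF e(1,2) k] e(3) by blast
  qed
  have "vol F \<Gamma> / (2 * \<epsilon>) - C = (\<Sum>e\<in>R. edge_length \<Gamma> e / ew e / (2 * \<epsilon>) - 1 / ew e)"
    by (simp only: R(5) C_def sum_subtractf sum_divide_distrib)
  also have "\<dots> \<le> (\<Sum>e\<in>R. \<Sum>b\<in>Be e. 1 / sc b)"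
    unfolding Be_def using R(2) by (intro sum_mono content_lower_edge B eps) auto
  also have "\<dots> = (\<Sum>b\<in>(\<Union>e\<in>R. Be e). 1 / sc b)"
    using R(1) B(1) disj by (subst sum.UNION_disjoint) (auto simp: Be_def)
  also have "\<dots> \<le> (\<Sum>b\<in>B. 1 / sc b)"
    using B(1) by (intro sum_mono2) (auto simp: Be_def stab_card_def)
  also have "\<dots> \<le> a / (2 * \<epsilon>) + c" by (rule B(4))
  finally have "(vol F \<Gamma> - a) / (2 * \<epsilon>) \<le> c + C" by (simp add: diff_divide_distrib)
  moreover have "(vol F \<Gamma> - a) / (2 * \<epsilon>) = 2 * (\<bar>c + C\<bar> + 1)"
    using gap by (simp add: \<epsilon>_def field_simps)
  ultimately have "2 * (\<bar>c + C\<bar> + 1) \<le> c + C" by (simp only:)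
  moreover have "\<not> 2 * (\<bar>x\<bar> + 1) \<le> x" for x :: real by (cases "x \<ge> 0") auto
  ultimately show False by blast
qed

lemma content_subedge:
  assumes e: "e \<in> E" "e = sg u v" "u \<in> M" "v \<in> M" and st: "0 \<le> s" "s \<le> t" "t \<le> d u v"
  shows "cont (pt u v ` {s..t}) ((t - s) / ew e)"
proof -
  have sD: "s \<in> {0..d u v}" "t \<in> {0..d u v}" using st by auto
  have M: "pt u v s \<in> M" "pt u v t \<in> M" using edge_pt[OF e(2-4)] sD by auto
  have P: "pt u v s \<in> sg u v" "pt u v t \<in> sg u v" using pt(1)[OF e(3,4)] sD by auto
  have sub: "sg (pt u v s) (pt u v t) \<subseteq> e" using seg_subset[OF P e(3,4)] e(2) by simp
  have "cont (sg (pt u v s) (pt u v t)) (d (pt u v s) (pt u v t) / ew e)"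
    using ew_ge1[OF e(1)] ew_le_stab_card[OF e(1)] sub by (intro content_seg M) auto
  moreover have "d (pt u v s) (pt u v t) = t - s" using pt_dist[OF e(3,4) sD] st by simp
  moreover have "pt u v ` {s..t} \<subseteq> sg (pt u v s) (pt u v t)"
  proof (rule image_subsetI)
    fix r assume r: "r \<in> {s..t}"
    then have rD: "r \<in> {0..d u v}" using st by auto
    show "pt u v r \<in> sg (pt u v s) (pt u v t)"
      using seg_interval[OF P pt(1)[OF e(3,4) rD] e(3,4)] pt(2)[OF e(3,4)] rD sD r by simp
  qed
  ultimately show ?thesis by (metis content_mono order_refl)
qed

lemma content_edge: "e \<in> E \<Longrightarrow> cont e (edge_length \<Gamma> e / ew e)"
proof -
  assume e: "e \<in> E"
  obtain u v where uv: "u \<in> W" "v \<in> W" "u \<noteq> v" "e = sg u v" "e \<inter> W = {u, v}" "u \<in> M" "v \<in> M"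
    using edgeE[OF e] .
  show ?thesis using content_subedge[OF e uv(4,6,7), of 0 "d u v"] seg_image_pt[OF uv(6,7)]
    edge_length[OF uv(6,7)] uv(4) by simp
qed

lemma content_edge_minus1:
  assumes e: "e \<in> E" "e = sg u v" "u \<in> M" "v \<in> M" and st: "0 \<le> s" "s \<le> t" "t \<le> d u v"
  shows "cont (e - pt u v ` {s..t}) (edge_length \<Gamma> e / ew e - (t - s) / ew e)"
proof -
  have "cont (pt u v ` {0..s} \<union> pt u v ` {t..d u v}) ((s - 0) / ew e + (d u v - t) / ew e)"
    using st by (intro content_Un content_subedge e) auto
  moreover have "e - pt u v ` {s..t} \<subseteq> pt u v ` {0..s} \<union> pt u v ` {t..d u v}"
    unfolding e(2) seg_image_pt[OF e(3,4), symmetric] by fastforce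
  moreover have "(s - 0) / ew e + (d u v - t) / ew e \<le> edge_length \<Gamma> e / ew e - (t - s) / ew e"
    using edge_length[OF e(3,4)] e(2) by (simp add: diff_divide_distrib)
  ultimately show ?thesis using content_mono by blast
qed

lemma content_edge_minus2:
  assumes e: "e \<in> E" "e = sg u v" "u \<in> M" "v \<in> M"
    and st: "0 \<le> s" "s \<le> t" "t \<le> s'" "s' \<le> t'" "t' \<le> d u v"
  shows "cont (e - (pt u v ` {s..t} \<union> pt u v ` {s'..t'})) (edge_length \<Gamma> e / ew e - ((t - s) / ew e + (t' - s') / ew e))"
proof -
  have "cont (pt u v ` {0..s} \<union> (pt u v ` {t..s'} \<union> pt u v ` {t'..d u v}))
      ((s - 0) / ew e + ((s' - t) / ew e + (d u v - t') / ew e))"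
    using st by (intro content_Un content_subedge e) auto
  moreover have "e - (pt u v ` {s..t} \<union> pt u v ` {s'..t'}) \<subseteq>
      pt u v ` {0..s} \<union> (pt u v ` {t..s'} \<union> pt u v ` {t'..d u v})"
    unfolding e(2) seg_image_pt[OF e(3,4), symmetric] by fastforce
  moreover have "(s - 0) / ew e + ((s' - t) / ew e + (d u v - t') / ew e) \<le>
      edge_length \<Gamma> e / ew e - ((t - s) / ew e + (t' - s') / ew e)"
    using edge_length[OF e(3,4)] e(2) by (simp add: diff_divide_distrib)
  ultimately show ?thesis using content_mono by blast
qed

lemma point_in_edge:
  assumes "E \<noteq> {}" "x \<in> M" shows "\<exists>e\<in>E. x \<in> e"
proof (cases "x \<in> W")
  case False then show ?thesis using edge_exists assms by blast
next
  case True
  obtain e where e: "e \<in> E" using assms(1) by blast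
  obtain u v where uv: "u \<in> W" "v \<in> W" "u \<noteq> v" using edgeE[OF e] by metis
  obtain w where w: "w \<in> W" "x \<noteq> w" using uv by metis
  obtain w' where w': "w' \<in> sg x w" "sg x w' \<in> E" using edge_towards[OF True w] by auto
  have "x \<in> sg x w'" using seg_ends[OF assms(2) seg_in_M[OF w'(1)]] by simp
  then show ?thesis using w'(2) by blast
qed

text \<open>The accounting on the source side: removing \<open>X e\<close> from each representative
  saves \<open>\<xi> e\<close>, while what is left and the removed parts together still meet every
  orbit.\<close>

lemma content_cover:
  assumes R: "edge_reps R" and "E \<noteq> {}"
    and X: "\<And>e. e \<in> R \<Longrightarrow> cont (e - X e) (edge_length \<Gamma> e / ew e - \<xi> e)"
  shows "\<exists>Z. cont Z (vol F \<Gamma> - (\<Sum>e\<in>R. \<xi> e)) \<and> Z \<subseteq> M \<and> (\<forall>x\<in>M. \<exists>g\<in>G. ac g x \<in> Z \<or> (\<exists>e\<in>R. ac g x \<in> X e))"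
proof (intro exI conjI ballI)
  note R = edge_repsD[OF R]
  let ?Z = "\<Union>e\<in>R. e - X e"
  show "cont ?Z (vol F \<Gamma> - (\<Sum>e\<in>R. \<xi> e))"
    unfolding R(5) sum_subtractf[symmetric] using R(1) X by (rule content_UN)
  show "?Z \<subseteq> M" using R(2) edge_in_M by blast
  fix x assume x: "x \<in> M"
  obtain e where e: "e \<in> E" "x \<in> e" using point_in_edge[OF assms(2) x] by blast
  obtain g where g: "g \<in> G" "ac g ` e \<in> R" using R(3)[OF e(1)] by blast
  have "ac g x \<in> ac g ` e" using e(2) by simp
  then show "\<exists>g\<in>G. ac g x \<in> ?Z \<or> (\<exists>e\<in>R. ac g x \<in> X e)" using g by blast
qed

lemma edges_nonempty: "vol F \<Gamma> \<noteq> 0 \<Longrightarrow> E \<noteq> {}"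
proof
  assume v: "vol F \<Gamma> \<noteq> 0" and "E = {}"
  moreover obtain R where "edge_reps R" using vol_reps[of "{}"] by auto
  ultimately show False by (simp add: edge_reps_def)
qed

lemma content_upper: "vol F \<Gamma> \<noteq> 0 \<Longrightarrow> cont M (vol F \<Gamma>)"
proof -
  assume v: "vol F \<Gamma> \<noteq> 0"
  obtain R where reps: "edge_reps R" using vol_reps[of "{}"] by auto
  note R = edge_repsD[OF reps]
  have "\<exists>Z. cont Z (vol F \<Gamma> - (\<Sum>e\<in>R. 0)) \<and> Z \<subseteq> M \<and> (\<forall>x\<in>M. \<exists>g\<in>G. ac g x \<in> Z \<or> (\<exists>e\<in>R. ac g x \<in> {}))"
    using content_edge R(2) by (intro content_cover[OF reps edges_nonempty[OF v]]) auto
  then obtain Z where Z: "cont Z (vol F \<Gamma>)" "\<forall>x\<in>M. \<exists>g\<in>G. ac g x \<in> Z" by auto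
  then have "M \<subseteq> sat Z" by (auto simp: sat_def)
  then show ?thesis using content_mono[OF content_sat[OF Z(1)]] by simp
qed

text \<open>A ball that does not reach the ends of the edge through its centre is an interval of
  that edge, by \<open>edge_exit\<close>. Halving the distance to the ends makes this
  strict.\<close>

lemma content_small_ball:
  assumes q: "q \<in> M" "q \<notin> W"
  shows "\<exists>r0>0. \<forall>r>0. r \<le> r0 \<longrightarrow> cont {y \<in> M. d q y \<le> r} (2 * r / sc q)"
proof -
  obtain e where e: "e \<in> E" "q \<in> e" using edge_exists[OF q] by blast
  obtain u v where uv: "u \<in> W" "v \<in> W" "u \<noteq> v" "e = sg u v" "e \<inter> W = {u, v}" "u \<in> M" "v \<in> M"
    using edgeE[OF e(1)] .
  have quv: "q \<in> sg u v" using e uv(4) by simp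
  have ne: "q \<noteq> u" "q \<noteq> v" using uv(1,2) q(2) by auto
  have pos: "d u q > 0" "d q v > 0"
    using dist_zeroD[OF uv(6) q(1)] dist_zeroD[OF q(1) uv(7)] ne by (metis not_le)+
  define r0 where "r0 = min (d u q) (d q v) / 2"
  have r0: "r0 > 0" "r0 < d u q" "r0 < d q v" using pos by (auto simp: r0_def)
  have "cont {y \<in> M. d q y \<le> r} (2 * r / sc q)" if r: "r > 0" "r \<le> r0" for r
  proof -
    have "cont (pt u v ` {d u q - r..d u q + r}) ((d u q + r - (d u q - r)) / ew e)"
      using r r0 seg_dist_sum[OF quv] by (intro content_subedge[OF e(1) uv(4,6,7)]) auto
    moreover have "{y \<in> M. d q y \<le> r} \<subseteq> pt u v ` {d u q - r..d u q + r}"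
    proof
      fix y assume "y \<in> {y \<in> M. d q y \<le> r}"
      then have y: "y \<in> M" "d q y \<le> r" by auto
      have ye: "y \<in> e"
      proof (rule ccontr)
        assume "y \<notin> e"
        then obtain w where w: "w \<in> sg q y" "w \<in> e" "w \<in> W" using edge_exit[OF e q(2) y(1)] by auto
        have "w = u \<or> w = v" using w uv(5) by blast
        then show False
          using seg_dist_le[OF w(1)] y(2) r r0 mdist_commute[of "metr \<Gamma>" q u] by auto
      qed
      then have yuv: "y \<in> sg u v" using uv(4) by simp
      have "\<bar>d u q - d u y\<bar> \<le> r" using seg_same_dist[OF quv yuv uv(6,7)] y(2) by simp
      then have "d u y \<in> {d u q - r..d u q + r}" by (auto simp: abs_le_iff)
      then show "y \<in> pt u v ` {d u q - r..d u q + r}" using pt_seg(1)[OF yuv uv(6,7)] by (metis imageI)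
    qed
    moreover have "(d u q + r - (d u q - r)) / ew e \<le> 2 * r / sc q"
      using stab_card_interior[OF e q(2)] by simp
    ultimately show ?thesis using content_mono by blast
  qed
  then show ?thesis using r0(1) by blast
qed

lemma vertex_orbits:
  assumes "E \<noteq> {}"
  shows "\<exists>W0. finite W0 \<and> W0 \<subseteq> W \<and> (\<forall>w\<in>W. \<exists>g\<in>G. ac g w \<in> W0)"
proof -
  obtain R where R: "finite R" "R \<subseteq> E" "\<forall>e\<in>E. \<exists>g\<in>G. ac g ` e \<in> R" using finite_edge_orbits by auto
  define W0 where "W0 = (\<Union>r\<in>R. r \<inter> W)"
  have "finite W0" unfolding W0_def using R(1,2) edge_finite_vertices by (intro finite_UN_I) auto
  moreover have "W0 \<subseteq> W" unfolding W0_def by blast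
  moreover have "\<exists>g\<in>G. ac g w \<in> W0" if w: "w \<in> W" for w
  proof -
    obtain e where e: "e \<in> E" "w \<in> e" using point_in_edge[OF assms V_in_M[OF w]] by blast
    obtain g where g: "g \<in> G" "ac g ` e \<in> R" using R(3) e(1) by blast
    have "ac g w \<in> ac g ` e \<inter> W" using e(2) act_W[OF g(1) w] by simp
    then show ?thesis using g unfolding W0_def by blast
  qed
  ultimately show ?thesis by blast
qed

end

section \<open>Equivariant Lipschitz maps\<close>

definition equi_lip ::
    "('g, 'm) monoid_scheme \<Rightarrow> ('g, 'a) acted_tree \<Rightarrow> ('g, 'b) acted_tree \<Rightarrow> real \<Rightarrow> ('a \<Rightarrow> 'b) \<Rightarrow> bool" where
  "equi_lip F \<Gamma> \<Gamma>' L f \<longleftrightarrow> f \<in> points \<Gamma> \<rightarrow> points \<Gamma>' \<and>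
     (\<forall>g\<in>carrier F. \<forall>x\<in>points \<Gamma>. f (act \<Gamma> g x) = act \<Gamma>' g (f x)) \<and>
     (\<forall>x\<in>points \<Gamma>. \<forall>y\<in>points \<Gamma>. mdist (metr \<Gamma>') (f x) (f y) \<le> L * mdist (metr \<Gamma>) x y)"

lemma equi_lipD:
  assumes "equi_lip F \<Gamma> \<Gamma>' L f"
  shows "f \<in> points \<Gamma> \<rightarrow> points \<Gamma>'" "\<And>x. x \<in> points \<Gamma> \<Longrightarrow> f x \<in> points \<Gamma>'"
    "\<And>g x. g \<in> carrier F \<Longrightarrow> x \<in> points \<Gamma> \<Longrightarrow> f (act \<Gamma> g x) = act \<Gamma>' g (f x)"
    "\<And>x y. x \<in> points \<Gamma> \<Longrightarrow> y \<in> points \<Gamma> \<Longrightarrow> mdist (metr \<Gamma>') (f x) (f y) \<le> L * mdist (metr \<Gamma>) x y"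
  using assms by (auto simp: equi_lip_def)

lemma equi_lip_mono:
  assumes "equi_lip F \<Gamma> \<Gamma>' L f" "L \<le> L'" shows "equi_lip F \<Gamma> \<Gamma>' L' f"
proof -
  have "L * mdist (metr \<Gamma>) x y \<le> L' * mdist (metr \<Gamma>) x y" for x y
    using assms(2) by (intro mult_right_mono) auto
  then show ?thesis using assms(1) unfolding equi_lip_def by (meson order_trans)
qed

locale gtree_pair = A: gtree F \<Gamma> + B: gtree F \<Gamma>'
  for F :: "('g, 'm) monoid_scheme" (structure) and \<Gamma> :: "('g, 'a) acted_tree" and \<Gamma>' :: "('g, 'b) acted_tree"
begin

text \<open>This direction is what makes weighted content, unlike unweighted length in the quotient,
  monotone under equivariant maps.\<close>

lemma stab_card_image:
  assumes f: "equi_lip F \<Gamma> \<Gamma>' L f" and x: "x \<in> A.M"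
  shows "A.sc x \<le> B.sc (f x)"
proof -
  have "stabilizer F A.ac x \<subseteq> stabilizer F B.ac (f x)"
  proof
    fix g assume "g \<in> stabilizer F A.ac x"
    then have g: "g \<in> A.G" "A.ac g x = x" by (auto simp: stabilizer_def)
    then show "g \<in> stabilizer F B.ac (f x)" using equi_lipD(3)[OF f g(1) x] by (simp add: stabilizer_def)
  qed
  then show ?thesis
    using B.finite_stabilizer[OF equi_lipD(2)[OF f x]] by (simp add: stab_card_def card_mono)
qed

text \<open>The images of centres for radius \<open>\<epsilon> / L\<close> are centres for radius
  \<open>\<epsilon>\<close>. Their number cannot grow, nor can their weights, by
  \<open>stab_card_image\<close>.\<close>

lemma content_image:
  assumes f: "equi_lip F \<Gamma> \<Gamma>' L f" and L: "L > 0" and J: "A.cont J a" "J \<subseteq> A.M"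
  shows "B.cont (f ` J) (L * a)"
proof -
  obtain c where c: "\<And>\<epsilon>. \<epsilon> > 0 \<Longrightarrow> \<exists>B. finite B \<and> B \<subseteq> A.M \<and>
     (\<forall>y\<in>J. \<exists>g\<in>A.G. \<exists>b\<in>B. A.d y (A.ac g b) \<le> \<epsilon>) \<and> (\<Sum>b\<in>B. 1 / A.sc b) \<le> a / (2 * \<epsilon>) + c"
    using J(1) unfolding content_le_def by auto
  show ?thesis
    unfolding content_le_def
  proof (intro exI[of _ c] allI impI)
    fix \<epsilon> :: real assume e: "\<epsilon> > 0"
    then have "\<epsilon> / L > 0" using L by simp
    from c[OF this] obtain B where B: "finite B" "B \<subseteq> A.M" "\<forall>y\<in>J. \<exists>g\<in>A.G. \<exists>b\<in>B. A.d y (A.ac g b) \<le> \<epsilon> / L"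
      "(\<Sum>b\<in>B. 1 / A.sc b) \<le> a / (2 * (\<epsilon> / L)) + c" by auto
    have BM: "b \<in> A.M" if "b \<in> B" for b using that B(2) by blast
    have "(\<Sum>b\<in>f ` B. 1 / B.sc b) \<le> (\<Sum>b\<in>B. 1 / B.sc (f b))"
      using sum_image_le[OF B(1), of "\<lambda>b. 1 / B.sc b" f] by (simp add: stab_card_def)
    also have "\<dots> \<le> (\<Sum>b\<in>B. 1 / A.sc b)"
    proof (rule sum_mono)
      fix b assume b: "b \<in> B"
      show "1 / B.sc (f b) \<le> 1 / A.sc b"
        using stab_card_image[OF f BM[OF b]] A.stab_card_ge1[OF BM[OF b]] by (intro divide_left_mono) auto
    qed
    also have "\<dots> \<le> L * a / (2 * \<epsilon>) + c" using B(4) by (simp add: mult.commute)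
    finally have "(\<Sum>b\<in>f ` B. 1 / B.sc b) \<le> L * a / (2 * \<epsilon>) + c" .
    moreover have "\<exists>g\<in>B.G. \<exists>b\<in>f ` B. B.d y (B.ac g b) \<le> \<epsilon>" if y: "y \<in> f ` J" for y
    proof -
      obtain x where x: "x \<in> J" "y = f x" using y by blast
      obtain g b where gb: "g \<in> A.G" "b \<in> B" "A.d x (A.ac g b) \<le> \<epsilon> / L" using B(3) x(1) by blast
      have "B.d (f x) (f (A.ac g b)) \<le> L * A.d x (A.ac g b)"
        using equi_lipD(4)[OF f] x(1) J(2) A.act_closed[OF gb(1) BM[OF gb(2)]] by blast
      also have "\<dots> \<le> L * (\<epsilon> / L)" using gb(3) L by (intro mult_left_mono) auto
      also have "\<dots> = \<epsilon>" using L by simp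
      finally have "B.d y (B.ac g (f b)) \<le> \<epsilon>" using equi_lipD(3)[OF f gb(1) BM[OF gb(2)]] x(2) by simp
      then show ?thesis using gb by blast
    qed
    moreover have "f ` B \<subseteq> B.M" using BM equi_lipD(2)[OF f] by blast
    ultimately show "\<exists>B. finite B \<and> B \<subseteq> B.M \<and> (\<forall>y\<in>f ` J. \<exists>g\<in>B.G. \<exists>b\<in>B. B.d y (B.ac g b) \<le> \<epsilon>) \<and>
       (\<Sum>b\<in>B. 1 / B.sc b) \<le> L * a / (2 * \<epsilon>) + c"
      using B(1) by (intro exI[of _ "f ` B"]) auto
  qed
qed

lemma seg_subset_image:
  assumes f: "equi_lip F \<Gamma> \<Gamma>' L f" and "x \<in> A.M" "y \<in> A.M"
  shows "B.sg (f x) (f y) \<subseteq> f ` A.sg x y"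
  using lipschitz_seg_image[OF A.tree B.tree equi_lipD(1,4)[OF f] assms(2,3)] by simp

lemma surjective:
  assumes f: "equi_lip F \<Gamma> \<Gamma>' L f"
  shows "f ` A.M = B.M"
proof -
  have "subtree (metr \<Gamma>') (f ` A.M)"
    unfolding subtree_def
  proof (intro conjI ballI allI impI)
    show "f ` A.M \<noteq> {}" using A.tree by (auto simp: real_tree_def)
    show "f ` A.M \<subseteq> B.M" using equi_lipD(2)[OF f] by blast
    fix p q S assume "p \<in> f ` A.M" "q \<in> f ` A.M" and S: "geodesic_segment (metr \<Gamma>') p q S"
    then obtain x y where xy: "x \<in> A.M" "p = f x" "y \<in> A.M" "q = f y" by blast
    have "S = B.sg (f x) (f y)" using S xy by (simp add: B.geodesic_segment_iff)
    then show "S \<subseteq> f ` A.M" using seg_subset_image[OF f xy(1,3)] seg_subset_mspace[of "metr \<Gamma>" x y] by blast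
  qed
  moreover have "\<forall>g\<in>carrier F. B.ac g ` (f ` A.M) \<subseteq> f ` A.M"
  proof (intro ballI image_subsetI)
    fix g y assume g: "g \<in> carrier F" and "y \<in> f ` A.M"
    then obtain x where x: "x \<in> A.M" "y = f x" by blast
    have "B.ac g y = f (A.ac g x)" using equi_lipD(3)[OF f g x(1)] x(2) by simp
    then show "B.ac g y \<in> f ` A.M" using A.act_closed[OF g x(1)] by blast
  qed
  ultimately show ?thesis using B.outer by (simp add: outer_trees_def minimal_action_def)
qed

end

section \<open>Deficits for maps between trees of volume 1\<close>

locale unit_pair = gtree_pair +
  assumes volA: "vol F \<Gamma> = 1" and volB: "vol F \<Gamma>' = 1"
begin

lemma lip_ge1:
  assumes f: "equi_lip F \<Gamma> \<Gamma>' L f"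
  shows "L \<ge> 1"
proof (rule ccontr)
  assume "\<not> L \<ge> 1"
  \<comment> \<open>\<open>content_image\<close> asks for a positive constant, which
    \<open>L\<close> need not be; any number strictly between 0 and 1 could replace 1/2.\<close>
  define L' where "L' = max L (1/2)"
  have L': "L' > 0" "L' < 1" "L \<le> L'" using \<open>\<not> L \<ge> 1\<close> by (auto simp: L'_def)
  have f': "equi_lip F \<Gamma> \<Gamma>' L' f" using equi_lip_mono[OF f L'(3)] .
  have "A.cont A.M 1" using A.content_upper volA by simp
  from content_image[OF f' L'(1) this] have "B.cont B.M L'" using surjective[OF f] by simp
  then show False using B.content_lower volB L'(2) by fastforce
qed

text \<open>The image of the remainder has content at most 1 minus the savings. With the images of
  the removed parts it fills \<open>\<Gamma>'\<close> up to translation, and by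
  \<open>content_lower\<close> the total cannot be less than 1.\<close>

lemma content_deficit:
  assumes f: "equi_lip F \<Gamma> \<Gamma>' 1 f" and R: "A.edge_reps R"
    and X: "\<And>e. e \<in> R \<Longrightarrow> A.cont (e - X e) (edge_length \<Gamma> e / A.ew e - \<xi> e)"
      "\<And>e. e \<in> R \<Longrightarrow> X e \<subseteq> A.M"
    and a: "B.cont (\<Union>e\<in>R. f ` X e) a"
  shows "(\<Sum>e\<in>R. \<xi> e) \<le> a"
proof -
  have "A.E \<noteq> {}" using A.edges_nonempty volA by simp
  from A.content_cover[OF R this X(1)]
  obtain Z where Z: "A.cont Z (1 - (\<Sum>e\<in>R. \<xi> e))" "Z \<subseteq> A.M"
    "\<forall>x\<in>A.M. \<exists>g\<in>A.G. A.ac g x \<in> Z \<or> (\<exists>e\<in>R. A.ac g x \<in> X e)" unfolding volA by auto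
  have "B.cont (f ` Z) (1 - (\<Sum>e\<in>R. \<xi> e))" using content_image[OF f _ Z(1,2)] by simp
  from B.content_sat[OF B.content_Un[OF this a]]
  have c: "B.cont (B.sat (f ` Z \<union> (\<Union>e\<in>R. f ` X e))) (1 - (\<Sum>e\<in>R. \<xi> e) + a)" .
  have "B.M \<subseteq> B.sat (f ` Z \<union> (\<Union>e\<in>R. f ` X e))"
  proof
    fix y assume y: "y \<in> B.M"
    then obtain x where x: "x \<in> A.M" "y = f x" using surjective[OF f] by blast
    obtain g where g: "g \<in> A.G" "A.ac g x \<in> Z \<or> (\<exists>e\<in>R. A.ac g x \<in> X e)" using Z(3) x(1) by blast
    have "B.ac g y = f (A.ac g x)" using equi_lipD(3)[OF f g(1) x(1)] x(2) by simp
    then have "B.ac g y \<in> f ` Z \<union> (\<Union>e\<in>R. f ` X e)" using g(2) by auto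
    then show "y \<in> B.sat (f ` Z \<union> (\<Union>e\<in>R. f ` X e))" using y g(1) by (auto simp: B.sat_def)
  qed
  then have "B.cont B.M (1 - (\<Sum>e\<in>R. \<xi> e) + a)" using B.content_mono[OF c] by blast
  from B.content_lower[OF this] show ?thesis unfolding volB by linarith
qed

text \<open>Serves two purposes: an edge cannot be shortened, and a piece cannot be mapped to points
  with larger stabilizers.\<close>

lemma deficit_one:
  assumes f: "equi_lip F \<Gamma> \<Gamma>' 1 f" and e: "e \<in> A.E" "e = A.sg u v" "u \<in> A.M" "v \<in> A.M"
    and st: "0 \<le> s" "s \<le> t" "t \<le> A.d u v" and a: "B.cont (f ` A.pt u v ` {s..t}) a"
  shows "(t - s) / A.ew e \<le> a"
proof -
  have "\<exists>R. A.edge_reps R \<and> {e} \<subseteq> R" using e by (intro A.vol_reps) auto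
  then obtain R where R: "A.edge_reps R" "e \<in> R" by auto
  note R' = A.edge_repsD[OF R(1)]
  have sub: "A.pt u v ` {s..t} \<subseteq> A.M" using A.edge_pt(4)[OF e(2-4)] st by auto
  let ?X = "\<lambda>e'. if e' = e then A.pt u v ` {s..t} else {}"
  let ?\<xi> = "\<lambda>e'. if e' = e then (t - s) / A.ew e else 0"
  have "(\<Sum>e\<in>R. ?\<xi> e) \<le> a"
  proof (rule content_deficit[OF f R(1), of ?X])
    fix e' assume e': "e' \<in> R"
    show "A.cont (e' - ?X e') (edge_length \<Gamma> e' / A.ew e' - ?\<xi> e')"
    proof (cases "e' = e")
      case True then show ?thesis using A.content_edge_minus1[OF e st] by simp
    next
      case False then show ?thesis using A.content_edge e' R'(2) by auto
    qed
    show "?X e' \<subseteq> A.M" using sub by simp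
  next
    have "(\<Union>e\<in>R. f ` ?X e) = f ` A.pt u v ` {s..t}" using R(2) by (auto split: if_splits)
    then show "B.cont (\<Union>e\<in>R. f ` ?X e) a" using a by simp
  qed
  then show ?thesis using R(2) R'(1) by simp
qed

text \<open>Inequivalent edges belong to a common transversal, so both savings count. The image
  bound concerns the union, which is smaller than expected if the two images overlap.\<close>

lemma deficit_two_edges:
  assumes f: "equi_lip F \<Gamma> \<Gamma>' 1 f"
    and e: "e \<in> A.E" "e = A.sg u v" "u \<in> A.M" "v \<in> A.M" "0 \<le> s" "s \<le> t" "t \<le> A.d u v"
    and e': "e' \<in> A.E" "e' = A.sg u' v'" "u' \<in> A.M" "v' \<in> A.M" "0 \<le> s'" "s' \<le> t'" "t' \<le> A.d u' v'"
    and ne: "\<And>g. g \<in> A.G \<Longrightarrow> A.ac g ` e \<noteq> e'"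
    and a: "B.cont (f ` A.pt u v ` {s..t} \<union> f ` A.pt u' v' ` {s'..t'}) a"
  shows "(t - s) / A.ew e + (t' - s') / A.ew e' \<le> a"
proof -
  have img: "A.ac (inv g) ` A.ac g ` p = p" if "g \<in> A.G" "p \<subseteq> A.M" for g p
    using A.act_inv1[OF that(1)] that(2) by (force simp: image_image)
  have ne': "A.ac g ` e' \<noteq> e" if g: "g \<in> A.G" for g
  proof
    assume "A.ac g ` e' = e"
    then have "A.ac (inv g) ` e = e'"
      using img[OF g, of e'] A.edge_in_M[OF e'(1)] by blast
    then show False using ne g by simp
  qed
  have ee': "e \<noteq> e'"
  proof
    assume "e = e'"
    moreover have "A.ac \<one> ` e = e" using A.act_one A.edge_in_M[OF e(1)] by (force simp: image_iff)
    ultimately show False using ne[OF A.F.one_closed] by simp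
  qed
  have "\<exists>R. A.edge_reps R \<and> {e, e'} \<subseteq> R"
  proof (rule A.vol_reps)
    show "{e, e'} \<subseteq> A.E" using e(1) e'(1) by simp
    show "p = q" if "p \<in> {e, e'}" "q \<in> {e, e'}" "g \<in> A.G" "A.ac g ` p = q" for p q g
      using that ne[OF that(3)] ne'[OF that(3)] by auto
  qed
  then obtain R where R: "A.edge_reps R" "e \<in> R" "e' \<in> R" by auto
  note R' = A.edge_repsD[OF R(1)]
  have sub: "A.pt u v ` {s..t} \<subseteq> A.M" "A.pt u' v' ` {s'..t'} \<subseteq> A.M"
    using A.edge_pt(4)[OF e(2-4)] e(5-7) A.edge_pt(4)[OF e'(2-4)] e'(5-7) by auto
  let ?X = "\<lambda>r. if r = e then A.pt u v ` {s..t} else if r = e' then A.pt u' v' ` {s'..t'} else {}"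
  let ?\<xi> = "\<lambda>r. (if r = e then (t - s) / A.ew e else 0) + (if r = e' then (t' - s') / A.ew e' else 0)"
  have "(\<Sum>e\<in>R. ?\<xi> e) \<le> a"
  proof (rule content_deficit[OF f R(1), of ?X])
    fix r assume r: "r \<in> R"
    show "A.cont (r - ?X r) (edge_length \<Gamma> r / A.ew r - ?\<xi> r)"
    proof -
      consider "r = e" | "r = e'" | "r \<noteq> e" "r \<noteq> e'" by blast
      then show ?thesis
      proof cases
        case 1 then show ?thesis using A.content_edge_minus1[OF e] ee' by simp
      next
        case 2 then show ?thesis using A.content_edge_minus1[OF e'] ee' by simp
      next
        case 3 then show ?thesis using A.content_edge r R'(2) by auto
      qed
    qed
    show "?X r \<subseteq> A.M" using sub by simp
  next
    have "(\<Union>r\<in>R. f ` ?X r) = f ` A.pt u v ` {s..t} \<union> f ` A.pt u' v' ` {s'..t'}"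
    proof
      show "(\<Union>r\<in>R. f ` ?X r) \<subseteq> f ` A.pt u v ` {s..t} \<union> f ` A.pt u' v' ` {s'..t'}"
        by (rule UN_least) simp
      have "f ` ?X e \<subseteq> (\<Union>r\<in>R. f ` ?X r)" using R(2) by (rule UN_upper)
      moreover have "f ` ?X e' \<subseteq> (\<Union>r\<in>R. f ` ?X r)" using R(3) by (rule UN_upper)
      ultimately show "f ` A.pt u v ` {s..t} \<union> f ` A.pt u' v' ` {s'..t'} \<subseteq> (\<Union>r\<in>R. f ` ?X r)"
        using ee' by simp
    qed
    then show "B.cont (\<Union>r\<in>R. f ` ?X r) a" using a by simp
  qed
  then show ?thesis using R(2,3) R'(1) by (simp add: sum.distrib)
qed

text \<open>The intervals may touch but not overlap, so their savings add up within one
  representative.\<close>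

lemma deficit_same_edge:
  assumes f: "equi_lip F \<Gamma> \<Gamma>' 1 f" and e: "e \<in> A.E" "e = A.sg u v" "u \<in> A.M" "v \<in> A.M"
    and st: "0 \<le> s" "s \<le> t" "t \<le> s'" "s' \<le> t'" "t' \<le> A.d u v"
    and a: "B.cont (f ` A.pt u v ` {s..t} \<union> f ` A.pt u v ` {s'..t'}) a"
  shows "(t - s) / A.ew e + (t' - s') / A.ew e \<le> a"
proof -
  have "\<exists>R. A.edge_reps R \<and> {e} \<subseteq> R" using e by (intro A.vol_reps) auto
  then obtain R where R: "A.edge_reps R" "e \<in> R" by auto
  note R' = A.edge_repsD[OF R(1)]
  let ?Y = "A.pt u v ` {s..t} \<union> A.pt u v ` {s'..t'}"
  have sub: "?Y \<subseteq> A.M" using A.edge_pt(4)[OF e(2-4)] st by auto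
  let ?X = "\<lambda>e'. if e' = e then ?Y else {}"
  let ?\<xi> = "\<lambda>e'. if e' = e then (t - s) / A.ew e + (t' - s') / A.ew e else 0"
  have "(\<Sum>e\<in>R. ?\<xi> e) \<le> a"
  proof (rule content_deficit[OF f R(1), of ?X])
    fix e' assume e': "e' \<in> R"
    show "A.cont (e' - ?X e') (edge_length \<Gamma> e' / A.ew e' - ?\<xi> e')"
    proof (cases "e' = e")
      case True then show ?thesis using A.content_edge_minus2[OF e st] by simp
    next
      case False then show ?thesis using A.content_edge e' R'(2) by auto
    qed
    show "?X e' \<subseteq> A.M" using sub by simp
  next
    have "(\<Union>e\<in>R. f ` ?X e) = f ` ?Y" using R(2) by (auto split: if_splits)
    then show "B.cont (\<Union>e\<in>R. f ` ?X e) a" using a by (simp only: image_Un)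
  qed
  then show ?thesis using R(2) R'(1) by simp
qed

end

section \<open>The equality case\<close>

context gtree begin

lemma local_coords:
  assumes x: "x \<in> M" "x \<notin> W"
  obtains e u v s where "e \<in> E" "e = sg u v" "u \<in> M" "v \<in> M" "0 < s" "s < d u v" "pt u v s = x" "sc x = ew e"
    "u \<in> W" "v \<in> W"
proof -
  obtain e where e: "e \<in> E" "x \<in> e" using edge_exists[OF x] by blast
  obtain u v where uv: "u \<in> W" "v \<in> W" "u \<noteq> v" "e = sg u v" "e \<inter> W = {u, v}" "u \<in> M" "v \<in> M"
    using edgeE[OF e(1)] .
  have xuv: "x \<in> sg u v" using e uv(4) by simp
  have ne: "u \<noteq> x" "x \<noteq> v" using uv(1,2) x(2) by auto
  have "\<not> d u x \<le> 0" "\<not> d x v \<le> 0"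
    using dist_zeroD[OF uv(6) x(1)] dist_zeroD[OF x(1) uv(7)] ne by auto
  then have "0 < d u x" "d u x < d u v" using seg_dist_sum[OF xuv] by linarith+
  from that[OF e(1) uv(4,6,7) this pt_seg(1)[OF xuv uv(6,7)] stab_card_interior[OF e x(2)] uv(1,2)]
  show thesis .
qed

lemma cball_act_subset_sat:
  assumes "h \<in> G" "q \<in> M"
  shows "{y \<in> M. d (ac h q) y \<le> r} \<subseteq> sat {y \<in> M. d q y \<le> r}"
proof
  fix y assume "y \<in> {y \<in> M. d (ac h q) y \<le> r}"
  then have y: "y \<in> M" "d (ac h q) y \<le> r" by auto
  have ih: "inv h \<in> G" using assms(1) by simp
  have "d (ac (inv h) (ac h q)) (ac (inv h) y) \<le> r"
    using act_isom[OF ih act_closed[OF assms] y(1)] y(2) by simp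
  then have "d q (ac (inv h) y) \<le> r" using act_inv1[OF assms] by simp
  then have "ac (inv h) y \<in> {y \<in> M. d q y \<le> r}" using act_closed[OF ih y(1)] by simp
  then show "y \<in> sat {y \<in> M. d q y \<le> r}" using y(1) ih unfolding sat_def by blast
qed

end

context unit_pair begin

text \<open>The stabilizer of \<open>f x\<close> contains the stabilizer of \<open>x\<close> and its
  coset by \<open>g\<close>, which are disjoint because \<open>g\<close> moves
  \<open>x\<close>.\<close>

lemma stab_card_doubles:
  assumes f: "equi_lip F \<Gamma> \<Gamma>' L f" and x: "x \<in> A.M" and g: "g \<in> A.G" "A.ac g x \<noteq> x" "f (A.ac g x) = f x"
  shows "2 * A.sc x \<le> B.sc (f x)"
proof -
  let ?S = "stabilizer F A.ac x"
  let ?gS = "(\<lambda>h. g \<otimes> h) ` ?S"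
  have SG: "?S \<subseteq> A.G" by (auto simp: stabilizer_def)
  have gfx: "B.ac g (f x) = f x" using equi_lipD(3)[OF f g(1) x] g(3) by simp
  have fixf: "B.ac h (f x) = f x" if "h \<in> ?S" for h
    using equi_lipD(3)[OF f, of h x] that x by (simp add: stabilizer_def)
  have sub: "?S \<union> ?gS \<subseteq> stabilizer F B.ac (f x)"
  proof
    fix k assume "k \<in> ?S \<union> ?gS"
    then consider "k \<in> ?S" | h where "h \<in> ?S" "k = g \<otimes> h" by blast
    then show "k \<in> stabilizer F B.ac (f x)"
    proof cases
      case 1 then show ?thesis using fixf SG by (auto simp: stabilizer_def)
    next
      case 2
      then have h: "h \<in> A.G" using SG by blast
      then show ?thesis using 2 g(1) B.act_mult[OF g(1) h equi_lipD(2)[OF f x]] fixf gfx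
        by (simp add: stabilizer_def)
    qed
  qed
  have "?S \<inter> ?gS = {}"
  proof (rule ccontr)
    assume "?S \<inter> ?gS \<noteq> {}"
    then obtain h where h: "h \<in> ?S" "g \<otimes> h \<in> ?S" by blast
    then have "A.ac g (A.ac h x) = x" "A.ac h x = x"
      using A.act_mult[OF g(1) _ x, of h] SG by (auto simp: stabilizer_def)
    then show False using g(2) by simp
  qed
  moreover have "inj_on (\<lambda>h. g \<otimes> h) ?S"
  proof (rule inj_onI)
    fix a b assume "a \<in> ?S" "b \<in> ?S" "g \<otimes> a = g \<otimes> b"
    then show "a = b" using A.F.Units_l_cancel[of g a b] A.F.Units_eq SG g(1) by auto
  qed
  ultimately have "card (?S \<union> ?gS) = 2 * card ?S"
    using A.finite_stabilizer[OF x] by (simp add: card_Un_disjoint card_image)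
  then have "2 * card ?S \<le> card (stabilizer F B.ac (f x))"
    using card_mono[OF B.finite_stabilizer[OF equi_lipD(2)[OF f x]] sub] by simp
  then show ?thesis unfolding stab_card_def by linarith
qed

lemma image_interval:
  assumes f: "equi_lip F \<Gamma> \<Gamma>' 1 f" and uv: "u \<in> A.M" "v \<in> A.M" and r: "0 \<le> s - r" "s + r \<le> A.d u v" "r > 0"
  shows "f ` A.pt u v ` {s - r..s + r} \<subseteq> {y \<in> B.M. B.d (f (A.pt u v s)) y \<le> r}"
proof
  fix y assume "y \<in> f ` A.pt u v ` {s - r..s + r}"
  then obtain t where t: "t \<in> {s - r..s + r}" "y = f (A.pt u v t)" by blast
  have D: "t \<in> {0..A.d u v}" "s \<in> {0..A.d u v}" using t(1) r by auto
  have M: "A.pt u v t \<in> A.M" "A.pt u v s \<in> A.M" using A.edge_pt(4)[OF refl uv] D by auto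
  have "A.d (A.pt u v s) (A.pt u v t) \<le> r" using A.pt_dist[OF uv D(2,1)] t(1) by auto
  then have "B.d (f (A.pt u v s)) y \<le> r" using equi_lipD(4)[OF f M(2,1)] t(2) by simp
  then show "y \<in> {y \<in> B.M. B.d (f (A.pt u v s)) y \<le> r}" using equi_lipD(2)[OF f M(1)] t(2) by simp
qed

text \<open>Away from vertices and images of vertices, two preimages of a point would allow to save a
  definite amount of content.\<close>

lemma generic_fibre:
  assumes f: "equi_lip F \<Gamma> \<Gamma>' 1 f" and q: "q \<in> B.M" "q \<notin> B.W"
    and x1: "x1 \<in> A.M" "x1 \<notin> A.W" "f x1 = q" and x2: "x2 \<in> A.M" "x2 \<notin> A.W" "f x2 = q"
  shows "x1 = x2"
proof (rule ccontr)
  assume ne: "x1 \<noteq> x2"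
  obtain r0 where r0: "r0 > 0" "\<And>r. r > 0 \<Longrightarrow> r \<le> r0 \<Longrightarrow> B.cont {y \<in> B.M. B.d q y \<le> r} (2 * r / B.sc q)"
    using B.content_small_ball[OF q] by blast
  let ?J = "\<lambda>r. B.sat {y \<in> B.M. B.d q y \<le> r}"
  have J: "B.cont (?J r) (2 * r / B.sc q)" if "r > 0" "r \<le> r0" for r
    using B.content_sat[OF r0(2)[OF that]] .
  have scq: "B.sc q \<ge> 1" using B.stab_card_ge1[OF q(1)] .
  have le: "A.sc x1 \<le> B.sc q" "A.sc x2 \<le> B.sc q"
    using stab_card_image[OF f x1(1)] stab_card_image[OF f x2(1)] x1(3) x2(3) by auto
  have ge: "A.sc x1 \<ge> 1" "A.sc x2 \<ge> 1" using A.stab_card_ge1 x1(1) x2(1) by auto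
  obtain e1 u1 v1 s1 where e1: "e1 \<in> A.E" "e1 = A.sg u1 v1" "u1 \<in> A.M" "v1 \<in> A.M"
    and s1: "0 < s1" "s1 < A.d u1 v1" "A.pt u1 v1 s1 = x1" "A.sc x1 = A.ew e1" "u1 \<in> A.W" "v1 \<in> A.W"
    by (rule A.local_coords[OF x1(1,2)])
  obtain e2 u2 v2 s2 where e2: "e2 \<in> A.E" "e2 = A.sg u2 v2" "u2 \<in> A.M" "v2 \<in> A.M"
    and s2: "0 < s2" "s2 < A.d u2 v2" "A.pt u2 v2 s2 = x2" "A.sc x2 = A.ew e2" "u2 \<in> A.W" "v2 \<in> A.W"
    by (rule A.local_coords[OF x2(1,2)])
  \<comment> \<open>Two pieces of length \<open>2 * r\<close>, each of weight at least
    \<open>1 / B.sc q\<close> per unit length, exceed the content of one ball of radius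
    \<open>r\<close> about \<open>q\<close>.\<close>
  have final: False if r: "r > 0" and "(2 * r) / k1 + (2 * r) / k2 \<le> 2 * r / B.sc q"
      "k1 \<ge> 1" "k2 \<ge> 1" "k1 \<le> B.sc q" "k2 \<le> B.sc q" for r k1 k2 :: real
  proof -
    have "2 * r / B.sc q \<le> 2 * r / k1" "2 * r / B.sc q \<le> 2 * r / k2"
      using that by (auto intro!: divide_left_mono)
    moreover have "2 * r / B.sc q > 0" using r scq by simp
    ultimately show False using that(2) by linarith
  qed
  show False
  proof (cases "\<exists>g\<in>A.G. A.ac g x1 = x2")
    case True
    then obtain g where g: "g \<in> A.G" "A.ac g x1 = x2" by blast
    \<comment> \<open>In this case there is only one piece in the quotient, but the doubled
      stabilizer lets it count as two pieces with stabilizer order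
      \<open>2 * A.sc x1\<close>.\<close>
    have "2 * A.sc x1 \<le> B.sc q"
      using stab_card_doubles[OF f x1(1) g(1)] ne g(2) x1(3) x2(3) by simp
    define r where "r = min r0 (min s1 (A.d u1 v1 - s1))"
    have r: "r > 0" "r \<le> r0" "0 \<le> s1 - r" "s1 + r \<le> A.d u1 v1" using r0(1) s1 by (auto simp: r_def)
    have "f ` A.pt u1 v1 ` {s1 - r..s1 + r} \<subseteq> {y \<in> B.M. B.d q y \<le> r}"
      using image_interval[OF f e1(3,4) r(3,4,1)] s1(3) x1(3) by simp
    then have "B.cont (f ` A.pt u1 v1 ` {s1 - r..s1 + r}) (2 * r / B.sc q)"
      by (rule B.content_mono[OF r0(2)[OF r(1,2)] _ order_refl])
    then have "(s1 + r - (s1 - r)) / A.ew e1 \<le> 2 * r / B.sc q"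
      using r by (intro deficit_one[OF f e1]) auto
    then have *: "(2 * r) / A.sc x1 \<le> 2 * r / B.sc q" using s1(4) by simp
    have "(2 * r) / (2 * A.sc x1) + (2 * r) / (2 * A.sc x1) \<le> 2 * r / B.sc q" using * by simp
    then show False
      using final[of r "2 * A.sc x1" "2 * A.sc x1"] r(1) ge \<open>2 * A.sc x1 \<le> B.sc q\<close> by simp
  next
    \<comment> \<open>Now there are two separate pieces in the quotient, either on inequivalent
      edges or, after translating the first edge, on the same edge \<open>e2\<close>.\<close>
    case noorb: False
    show False
    proof (cases "\<exists>g\<in>A.G. A.ac g ` e1 = e2")
      case False
      define r where "r = min r0 (min (min s1 (A.d u1 v1 - s1)) (min s2 (A.d u2 v2 - s2)))"
      have r: "r > 0" "r \<le> r0" "0 \<le> s1 - r" "s1 + r \<le> A.d u1 v1" "0 \<le> s2 - r" "s2 + r \<le> A.d u2 v2"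
        using r0(1) s1 s2 by (auto simp: r_def)
      have "f ` A.pt u1 v1 ` {s1 - r..s1 + r} \<subseteq> {y \<in> B.M. B.d q y \<le> r}"
        using image_interval[OF f e1(3,4) r(3,4,1)] s1(3) x1(3) by simp
      moreover have "f ` A.pt u2 v2 ` {s2 - r..s2 + r} \<subseteq> {y \<in> B.M. B.d q y \<le> r}"
        using image_interval[OF f e2(3,4) r(5,6,1)] s2(3) x2(3) by simp
      ultimately have "B.cont (f ` A.pt u1 v1 ` {s1 - r..s1 + r} \<union> f ` A.pt u2 v2 ` {s2 - r..s2 + r}) (2 * r / B.sc q)"
        by (intro B.content_mono[OF r0(2)[OF r(1,2)] Un_least order_refl])
      then have "(s1 + r - (s1 - r)) / A.ew e1 + (s2 + r - (s2 - r)) / A.ew e2 \<le> 2 * r / B.sc q"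
        using r False by (intro deficit_two_edges[OF f e1 _ _ _ e2]) auto
      then show False using final[of r "A.sc x1" "A.sc x2"] r(1) ge le s1(4) s2(4) by simp
    next
      case True
      then obtain g where g: "g \<in> A.G" "A.ac g ` e1 = e2" by blast
      define x where "x = A.ac g x1"
      have xM: "x \<in> A.M" using A.act_closed[OF g(1) x1(1)] by (simp add: x_def)
      have "x1 \<in> e1" using A.edge_pt(1)[OF e1(2-4), of s1] s1 by simp
      then have xe: "x \<in> A.sg u2 v2" using g(2) e2(2) by (auto simp: x_def)
      \<comment> \<open>After the translation the first piece lands near a translate of
        \<open>q\<close>. Both images therefore lie in the saturation \<open>?J r\<close>, which has
        the content bound of a single ball.\<close>
      have fx: "f x = B.ac g q" using equi_lipD(3)[OF f g(1) x1(1)] x1(3) by (simp add: x_def)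
      have xW: "x \<notin> A.W" using A.act_invariant_iff[OF A.act_W g(1) x1(1)] x1(2) by (simp add: x_def)
      define s where "s = A.d u2 x"
      have ptx: "A.pt u2 v2 s = x" using A.pt_seg(1)[OF xe e2(3,4)] by (simp add: s_def)
      have "x \<noteq> x2" using noorb g(1) by (auto simp: x_def)
      then have sne: "s \<noteq> s2" using ptx s2(3) by auto
      have k1: "A.ew e2 \<ge> 1" "A.ew e2 \<le> B.sc q" using ge le s2(4) by auto
      have "u2 \<noteq> x" "x \<noteq> v2" using s2(5,6) xW by auto
      then have "\<not> A.d u2 x \<le> 0" "\<not> A.d x v2 \<le> 0"
        using A.dist_zeroD[OF e2(3) xM] A.dist_zeroD[OF xM e2(4)] by auto
      then have "s > 0" "s < A.d u2 v2" using A.seg_dist_sum[OF xe] unfolding s_def by linarith+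
      \<comment> \<open>At most half the distance between the two points, so that the pieces do not
        overlap, and small enough to stay within the edge.\<close>
      define r where "r = min r0 (min (\<bar>s - s2\<bar> / 2) (min (min s (A.d u2 v2 - s)) (min s2 (A.d u2 v2 - s2))))"
      have rle: "r \<le> r0" "r \<le> \<bar>s - s2\<bar> / 2" "r \<le> s" "r \<le> A.d u2 v2 - s" "r \<le> s2" "r \<le> A.d u2 v2 - s2"
        by (simp_all only: r_def min_le_iff_disj order_refl simp_thms)
      have "r > 0" using r0(1) \<open>s > 0\<close> \<open>s < A.d u2 v2\<close> s2(1,2) sne by (simp add: r_def)
      then have r: "r > 0" "r \<le> r0" "0 \<le> s - r" "s + r \<le> A.d u2 v2" "0 \<le> s2 - r" "s2 + r \<le> A.d u2 v2"
        using rle by linarith+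
      have rs: "2 * r \<le> \<bar>s - s2\<bar>" using rle(2) by (simp add: field_simps)
      have "f ` A.pt u2 v2 ` {s - r..s + r} \<subseteq> {y \<in> B.M. B.d (B.ac g q) y \<le> r}"
        using image_interval[OF f e2(3,4) r(3,4,1)] ptx fx by simp
      also have "\<dots> \<subseteq> ?J r" using B.cball_act_subset_sat[OF g(1) q(1)] .
      finally have i1: "f ` A.pt u2 v2 ` {s - r..s + r} \<subseteq> ?J r" .
      have "f ` A.pt u2 v2 ` {s2 - r..s2 + r} \<subseteq> {y \<in> B.M. B.d (B.ac \<one> q) y \<le> r}"
        using image_interval[OF f e2(3,4) r(5,6,1)] s2(3) x2(3) B.act_one[OF q(1)] by simp
      also have "\<dots> \<subseteq> ?J r" using B.cball_act_subset_sat[OF A.F.one_closed q(1)] .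
      finally have i2: "f ` A.pt u2 v2 ` {s2 - r..s2 + r} \<subseteq> ?J r" .
      have "(2 * r) / A.ew e2 + (2 * r) / A.ew e2 \<le> 2 * r / B.sc q"
      proof (cases "s \<le> s2")
        case True
        have "B.cont (f ` A.pt u2 v2 ` {s - r..s + r} \<union> f ` A.pt u2 v2 ` {s2 - r..s2 + r}) (2 * r / B.sc q)"
          by (rule B.content_mono[OF J[OF r(1,2)] Un_least[OF i1 i2] order_refl])
        then have "(s + r - (s - r)) / A.ew e2 + (s2 + r - (s2 - r)) / A.ew e2 \<le> 2 * r / B.sc q"
          using r rs True by (intro deficit_same_edge[OF f e2]) linarith+
        then show ?thesis by simp
      next
        case False
        have "B.cont (f ` A.pt u2 v2 ` {s2 - r..s2 + r} \<union> f ` A.pt u2 v2 ` {s - r..s + r}) (2 * r / B.sc q)"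
          by (rule B.content_mono[OF J[OF r(1,2)] Un_least[OF i2 i1] order_refl])
        then have "(s2 + r - (s2 - r)) / A.ew e2 + (s + r - (s - r)) / A.ew e2 \<le> 2 * r / B.sc q"
          using r rs False by (intro deficit_same_edge[OF f e2]) linarith+
        then show ?thesis by simp
      qed
      then show False using final[of r "A.ew e2" "A.ew e2"] r(1) k1 by simp
    qed
  qed
qed

end

section \<open>Absence of folding and isometry\<close>

context rtree begin

lemma infinite_seg:
  assumes "x \<in> M" "y \<in> M" "x \<noteq> y" shows "infinite (sg x y)"
proof
  assume "finite (sg x y)"
  then have "finite (d x ` sg x y)" by simp
  moreover have "{0..d x y} \<subseteq> d x ` sg x y"
  proof
    fix t assume "t \<in> {0..d x y}"
    from pt[OF assms(1,2) this] show "t \<in> d x ` sg x y" by (metis imageI)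
  qed
  ultimately have "finite {0..d x y}" by (rule finite_subset[rotated])
  moreover have "\<not> d x y \<le> 0" using dist_zeroD[OF assms(1,2)] assms(3) by auto
  ultimately show False using infinite_Icc[of 0 "d x y"] by auto
qed

end

context unit_pair begin

text \<open>A segment is infinite, but only finitely many of its points are vertices or images of
  vertices: the vertices of \<open>\<Gamma>\<close> form finitely many orbits, and by properness
  only finitely many translates of each image come close enough.\<close>

lemma generic_point:
  assumes f: "equi_lip F \<Gamma> \<Gamma>' L f" and pq: "p \<in> B.M" "q \<in> B.M" "p \<noteq> q"
  shows "\<exists>z\<in>B.sg p q. z \<noteq> p \<and> z \<noteq> q \<and> z \<notin> B.W \<and> z \<notin> f ` A.W"
proof -
  have "A.E \<noteq> {}" using A.edges_nonempty volA by simp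
  then obtain W0 where W0: "finite W0" "W0 \<subseteq> A.W" "\<forall>w\<in>A.W. \<exists>g\<in>A.G. A.ac g w \<in> W0"
    using A.vertex_orbits by blast
  let ?N = "\<Union>w\<in>W0. (\<lambda>g. B.ac g (f w)) ` {g \<in> B.G. B.d p (B.ac g (f w)) \<le> B.d p q}"
  have W0M: "w \<in> A.M" if "w \<in> W0" for w using W0(2) that A.V_in_M by blast
  have "finite ?N"
    using W0(1) B.finite_displacement[OF pq(1) equi_lipD(2)[OF f W0M]] by (intro finite_UN_I finite_imageI)
  moreover have "B.sg p q \<inter> f ` A.W \<subseteq> ?N"
  proof
    fix z assume z: "z \<in> B.sg p q \<inter> f ` A.W"
    then obtain w where w: "w \<in> A.W" "z = f w" by blast
    have wM: "w \<in> A.M" using A.V_in_M[OF w(1)] .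
    obtain g where g: "g \<in> A.G" "A.ac g w \<in> W0" using W0(3) w(1) by blast
    have ig: "inv g \<in> A.G" using g(1) by simp
    have "z = f (A.ac (inv g) (A.ac g w))" using w(2) A.act_inv1[OF g(1) wM] by simp
    then have "z = B.ac (inv g) (f (A.ac g w))"
      using equi_lipD(3)[OF f ig A.act_closed[OF g(1) wM]] by simp
    moreover have "B.d p z \<le> B.d p q" using B.seg_dist_le z by blast
    ultimately show "z \<in> ?N" using g(2) ig by blast
  qed
  ultimately have "finite (B.sg p q \<inter> f ` A.W)" by (rule finite_subset[rotated])
  then have "finite ({p, q} \<union> (B.sg p q \<inter> B.W) \<union> (B.sg p q \<inter> f ` A.W))"
    using B.finite_seg_V[OF pq(1,2)] by (simp only: finite_Un finite_insert finite.emptyI simp_thms)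
  then have "\<not> B.sg p q \<subseteq> {p, q} \<union> (B.sg p q \<inter> B.W) \<union> (B.sg p q \<inter> f ` A.W)"
    using B.infinite_seg[OF pq] finite_subset by blast
  then show ?thesis by blast
qed

text \<open>If \<open>f z\<close> were off the geodesic, the path would run from the median
  \<open>w\<close> to \<open>f z\<close> and back. A generic point \<open>q\<close> of that spur has
  a preimage on \<open>sg x z\<close> and one on \<open>sg y z\<close>; by
  \<open>generic_fibre\<close> they coincide. As \<open>z\<close> lies between \<open>x\<close> and
  \<open>y\<close>, these two segments share only \<open>z\<close>, so \<open>q\<close> is
  \<open>f z\<close>, which was excluded.\<close>

lemma image_seg:
  assumes f: "equi_lip F \<Gamma> \<Gamma>' 1 f" and xy: "x \<in> A.M" "y \<in> A.M"
  shows "f ` A.sg x y = B.sg (f x) (f y)"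
proof
  show "B.sg (f x) (f y) \<subseteq> f ` A.sg x y" using seg_subset_image[OF f xy] .
  show "f ` A.sg x y \<subseteq> B.sg (f x) (f y)"
  proof (rule image_subsetI)
    fix z assume z: "z \<in> A.sg x y"
    have zM: "z \<in> A.M" using A.seg_in_M[OF z] .
    have fM: "f x \<in> B.M" "f y \<in> B.M" "f z \<in> B.M" using equi_lipD(2)[OF f] xy zM by auto
    obtain w where w: "w \<in> B.sg (f x) (f y)" "w \<in> B.sg (f y) (f z)" "w \<in> B.sg (f x) (f z)"
      using B.median[OF fM] by blast
    have wM: "w \<in> B.M" using B.seg_in_M[OF w(1)] .
    have "w = f z"
    proof (rule ccontr)
      assume "w \<noteq> f z"
      then obtain q where q: "q \<in> B.sg w (f z)" "q \<noteq> f z" "q \<notin> B.W" "q \<notin> f ` A.W"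
        using generic_point[OF f wM fM(3)] by blast
      have qM: "q \<in> B.M" using B.seg_in_M[OF q(1)] .
      have "B.sg w (f z) \<subseteq> B.sg (f x) (f z)"
        using B.seg_subset[OF w(3) _ fM(1,3)] seg_ends[OF fM(1,3)] by simp
      then have "q \<in> f ` A.sg x z" using q(1) seg_subset_image[OF f xy(1) zM] by blast
      then obtain a where a: "a \<in> A.sg x z" "q = f a" by blast
      have "B.sg w (f z) \<subseteq> B.sg (f y) (f z)"
        using B.seg_subset[OF w(2) _ fM(2,3)] seg_ends[OF fM(2,3)] by simp
      then have "q \<in> f ` A.sg y z" using q(1) seg_subset_image[OF f xy(2) zM] by blast
      then obtain b where b: "b \<in> A.sg y z" "q = f b" by blast
      have aM: "a \<in> A.M" and bM: "b \<in> A.M" using A.seg_in_M a(1) b(1) by blast+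
      have "a \<notin> A.W" "b \<notin> A.W" using q(4) a(2) b(2) by blast+
      then have ab: "a = b"
        using generic_fibre[OF f qM q(3) aM _ a(2)[symmetric] bM _ b(2)[symmetric]] by simp
      have "A.d x z + A.d z y = A.d x y" "A.d x a + A.d a z = A.d x z" "A.d y a + A.d a z = A.d y z"
        using A.seg_dist_sum z a(1) b(1) ab by auto
      moreover have "A.d x y \<le> A.d x a + A.d a y" using A.tri xy aM by blast
      ultimately have "A.d a z \<le> 0"
        using mdist_commute[of "metr \<Gamma>" a y] mdist_commute[of "metr \<Gamma>" z y] by linarith
      then have "a = z" using A.dist_zeroD[OF aM zM] by simp
      then show False using a(2) q(2) by simp
    qed
    then show "f z \<in> B.sg (f x) (f y)" using w(1) by simp
  qed
qed

text \<open>By \<open>image_seg\<close> the image of a piece of \<open>e\<close> is the geodesic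
  between the images of its ends, where stabilizers have order at least \<open>ew e\<close>. Its
  content is thus bounded by its length over \<open>ew e\<close>, and a shortened piece would
  contradict \<open>deficit_one\<close>.\<close>

lemma isometric_on_edge:
  assumes f: "equi_lip F \<Gamma> \<Gamma>' 1 f" and e: "e \<in> A.E" "x \<in> e" "y \<in> e"
  shows "B.d (f x) (f y) = A.d x y"
proof -
  obtain u v where uv: "u \<in> A.W" "v \<in> A.W" "u \<noteq> v" "e = A.sg u v" "e \<inter> A.W = {u, v}" "u \<in> A.M" "v \<in> A.M"
    using A.edgeE[OF e(1)] .
  have *: "A.d x y \<le> B.d (f x) (f y)" if xy: "x \<in> e" "y \<in> e" "A.d u x \<le> A.d u y" for x y
  proof -
    have seg: "x \<in> A.sg u v" "y \<in> A.sg u v" using xy uv(4) by auto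
    have M: "x \<in> A.M" "y \<in> A.M" using A.edge_in_M[OF e(1)] xy by auto
    have fM: "f x \<in> B.M" "f y \<in> B.M" using equi_lipD(2)[OF f] M by auto
    have sub: "A.sg x y \<subseteq> e" using A.seg_subset[OF seg uv(6,7)] uv(4) by simp
    have img: "A.pt u v ` {A.d u x..A.d u y} \<subseteq> A.sg x y"
    proof (rule image_subsetI)
      fix t assume t: "t \<in> {A.d u x..A.d u y}"
      then have tD: "t \<in> {0..A.d u v}"
        using A.seg_dist_le[OF seg(2)] mdist_nonneg[of "metr \<Gamma>" u x] by (auto simp del: mdist_nonneg)
      show "A.pt u v t \<in> A.sg x y"
        using A.seg_interval[OF seg A.pt(1)[OF uv(6,7) tD] uv(6,7)] A.pt(2)[OF uv(6,7) tD] t by simp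
    qed
    have "B.cont (B.sg (f x) (f y)) (B.d (f x) (f y) / A.ew e)"
    proof (rule B.content_seg[OF fM])
      show "A.ew e > 0" using A.ew_ge1[OF e(1)] by simp
      fix z assume "z \<in> B.sg (f x) (f y)"
      then obtain a where a: "a \<in> A.sg x y" "z = f a" using image_seg[OF f M] by blast
      then have ae: "a \<in> e" using sub by blast
      show "A.ew e \<le> B.sc z"
        using A.ew_le_stab_card[OF e(1) ae] stab_card_image[OF f A.edge_in_M[OF e(1) ae]] a(2) by simp
    qed
    moreover have "f ` A.pt u v ` {A.d u x..A.d u y} \<subseteq> B.sg (f x) (f y)"
      using img image_seg[OF f M] by blast
    ultimately have "B.cont (f ` A.pt u v ` {A.d u x..A.d u y}) (B.d (f x) (f y) / A.ew e)"
      by (rule B.content_mono[OF _ _ order_refl])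
    then have "(A.d u y - A.d u x) / A.ew e \<le> B.d (f x) (f y) / A.ew e"
      using A.seg_dist_le[OF seg(2)] xy(3) by (intro deficit_one[OF f e(1) uv(4,6,7)]) auto
    then have "A.d u y - A.d u x \<le> B.d (f x) (f y)"
      using A.ew_ge1[OF e(1)] by (simp add: divide_le_cancel)
    moreover have "A.d x y = A.d u y - A.d u x" using A.seg_same_dist[OF seg uv(6,7)] xy(3) by simp
    ultimately show ?thesis by simp
  qed
  have M: "x \<in> A.M" "y \<in> A.M" using A.edge_in_M[OF e(1)] e by auto
  have "A.d x y \<le> B.d (f x) (f y)"
  proof (cases "A.d u x \<le> A.d u y")
    case True then show ?thesis using * e by simp
  next
    case False
    then have "A.d y x \<le> B.d (f y) (f x)" using *[OF e(3,2)] by simp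
    then show ?thesis by (simp only: mdist_commute[of "metr \<Gamma>" x y] mdist_commute[of "metr \<Gamma>'" "f x" "f y"])
  qed
  then show ?thesis using equi_lipD(4)[OF f M] by simp
qed

lemma same_edge:
  assumes "x \<in> A.M" "y \<in> A.M" "x \<noteq> y" "A.sg x y \<inter> A.W \<subseteq> {x, y}"
  shows "\<exists>e\<in>A.E. x \<in> e \<and> y \<in> e"
proof -
  have *: "\<exists>e\<in>A.E. x \<in> e \<and> y \<in> e" if xy: "x \<in> A.M" "y \<in> A.M" "x \<notin> A.W" "A.sg x y \<inter> A.W \<subseteq> {x, y}" for x y
  proof -
    obtain e where e: "e \<in> A.E" "x \<in> e" using A.edge_exists xy by blast
    have "y \<in> e"
    proof (rule ccontr)
      assume "y \<notin> e"
      then obtain w where w: "w \<in> A.sg x y" "w \<in> e" "w \<in> A.W"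
        using A.edge_exit[OF e xy(3,2)] by auto
      then have "w = x \<or> w = y" using xy(4) by blast
      then show False using w xy(3) \<open>y \<notin> e\<close> by auto
    qed
    then show ?thesis using e by blast
  qed
  consider "x \<notin> A.W" | "y \<notin> A.W" | "x \<in> A.W" "y \<in> A.W" by blast
  then show ?thesis
  proof cases
    case 1 then show ?thesis using * assms by blast
  next
    case 2
    have "A.sg y x \<inter> A.W \<subseteq> {y, x}" using assms(4) unfolding seg_commute[of "metr \<Gamma>" y x] by blast
    then show ?thesis using *[OF assms(2,1) 2] by blast
  next
    case 3
    have ends: "x \<in> A.sg x y" "y \<in> A.sg x y" using seg_ends[OF assms(1,2)] by auto
    then have "A.sg x y \<inter> A.W = {x, y}" using assms(4) 3 by blast
    then have "A.sg x y \<in> A.E" using A.edge_iff 3 assms(3) by blast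
    then show ?thesis using ends by blast
  qed
qed

text \<open>Induction on the number of vertices strictly between \<open>x\<close> and
  \<open>y\<close>. Splitting at such a vertex \<open>w\<close> is possible because
  \<open>image_seg\<close> keeps \<open>f w\<close> between the images, so distances add up on both
  sides.\<close>

lemma isometric:
  assumes f: "equi_lip F \<Gamma> \<Gamma>' 1 f" and "x \<in> A.M" "y \<in> A.M"
  shows "B.d (f x) (f y) = A.d x y"
  using assms(2,3)
proof (induction "card (A.sg x y \<inter> A.W - {x, y})" arbitrary: x y rule: less_induct)
  case less
  show ?case
  proof (cases "x = y")
    case True then show ?thesis using less.prems equi_lipD(2)[OF f] by simp
  next
    case ne: False
    show ?thesis
    proof (cases "A.sg x y \<inter> A.W \<subseteq> {x, y}")
      case True
      then obtain e where "e \<in> A.E" "x \<in> e" "y \<in> e" using same_edge[OF less.prems ne] by blast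
      then show ?thesis by (rule isometric_on_edge[OF f])
    next
      case False
      then obtain w where w: "w \<in> A.sg x y" "w \<in> A.W" "w \<noteq> x" "w \<noteq> y" by blast
      have wM: "w \<in> A.M" using A.seg_in_M[OF w(1)] .
      have fin: "finite (A.sg x y \<inter> A.W - {x, y})" using A.finite_seg_V[OF less.prems] by (rule finite_Diff)
      have ends: "x \<in> A.sg x y" "y \<in> A.sg x y" using seg_ends[OF less.prems] by auto
      have sub: "A.sg x w \<subseteq> A.sg x y" "A.sg w y \<subseteq> A.sg x y"
        using A.seg_subset[OF ends(1) w(1) less.prems] A.seg_subset[OF w(1) ends(2) less.prems] by auto
      have "y \<notin> A.sg x w" using A.seg_antisym[OF w(1)] w(4) by auto
      have "x \<notin> A.sg w y"
      proof
        assume "x \<in> A.sg w y"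
        then have "x \<in> A.sg y w" by (subst seg_commute)
        moreover have "w \<in> A.sg y x" using w(1) by (subst seg_commute)
        ultimately show False using A.seg_antisym[of w y x] w(3) by simp
      qed
      have "A.sg x w \<inter> A.W - {x, w} \<subset> A.sg x y \<inter> A.W - {x, y}"
        using sub(1) w \<open>y \<notin> A.sg x w\<close> by blast
      then have 1: "B.d (f x) (f w) = A.d x w"
        using less.hyps[OF psubset_card_mono[OF fin] less.prems(1) wM] by simp
      have "A.sg w y \<inter> A.W - {w, y} \<subset> A.sg x y \<inter> A.W - {x, y}"
        using sub(2) w \<open>x \<notin> A.sg w y\<close> by blast
      then have 2: "B.d (f w) (f y) = A.d w y"
        using less.hyps[OF psubset_card_mono[OF fin] wM less.prems(2)] by simp
      have "f w \<in> B.sg (f x) (f y)" using image_seg[OF f less.prems] w(1) by blast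
      then show ?thesis using B.seg_dist_sum[of "f w"] A.seg_dist_sum[OF w(1)] 1 2 by fastforce
    qed
  qed
qed

lemma equivariantly_isometric_if_1_lip:
  assumes f: "equi_lip F \<Gamma> \<Gamma>' 1 f" shows "equivariantly_isometric F \<Gamma> \<Gamma>'"
  unfolding equivariantly_isometric_def
proof (intro exI[of _ f] conjI ballI)
  show "bij_betw f A.M B.M"
    unfolding bij_betw_def
  proof
    show "inj_on f A.M"
    proof (rule inj_onI)
      fix x y assume xy: "x \<in> A.M" "y \<in> A.M" "f x = f y"
      then have "A.d x y = 0" using isometric[OF f xy(1,2)] equi_lipD(2)[OF f] by simp
      then show "x = y" using xy by simp
    qed
    show "f ` A.M = B.M" by (rule surjective[OF f])
  qed
  show "B.d (f x) (f y) = A.d x y" if "x \<in> A.M" "y \<in> A.M" for x y using isometric[OF f that] .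
  show "f (A.ac g x) = B.ac g (f x)" if "g \<in> carrier F" "x \<in> A.M" for g x using equi_lipD(3)[OF f that] .
qed

end

section \<open>Existence of equivariant Lipschitz maps\<close>

context gtree begin

text \<open>By \<open>cocompact\<close> every point can be moved onto a segment from
  \<open>x0\<close> to some \<open>ac s x0\<close>, hence near \<open>x0\<close>; the sum bounds the
  lengths of all these segments at once.\<close>

lemma coarsely_transitive:
  assumes x0: "x0 \<in> M"
  obtains \<rho> where "\<rho> \<ge> 0" "\<And>x. x \<in> M \<Longrightarrow> \<exists>h\<in>G. d x (ac h x0) \<le> \<rho>"
proof -
  obtain S where S: "finite S" "S \<subseteq> G" "generate F S = G"
    "\<And>x. x \<in> M \<Longrightarrow> \<exists>g\<in>G. \<exists>s\<in>insert \<one> S. ac g x \<in> sg x0 (ac s x0)"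
    using cocompact[OF x0] by blast
  define \<rho> where "\<rho> = (\<Sum>s\<in>insert \<one> S. d x0 (ac s x0))"
  have "\<exists>h\<in>G. d x (ac h x0) \<le> \<rho>" if x: "x \<in> M" for x
  proof -
    obtain g s where g: "g \<in> G" "s \<in> insert \<one> S" "ac g x \<in> sg x0 (ac s x0)" using S(4)[OF x] by blast
    have ig: "inv g \<in> G" using g(1) by simp
    have "d x0 (ac g x) \<le> d x0 (ac s x0)" using seg_dist_le[OF g(3)] .
    also have "\<dots> \<le> \<rho>" unfolding \<rho>_def using g(2) S(1) by (intro member_le_sum) auto
    finally have "d (ac (inv g) x0) (ac (inv g) (ac g x)) \<le> \<rho>"
      using act_isom[OF ig x0 act_closed[OF g(1) x]] by simp
    then have "d x (ac (inv g) x0) \<le> \<rho>"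
      using act_inv1[OF g(1) x] mdist_commute[of "metr \<Gamma>" x] by simp
    then show ?thesis using ig by blast
  qed
  moreover have "\<rho> \<ge> 0" unfolding \<rho>_def by (intro sum_nonneg) simp
  ultimately show thesis using that by blast
qed

end

context gtree_pair begin

text \<open>The orbit of \<open>x0\<close> maps to the orbit of \<open>p\<close> in a coarsely
  Lipschitz way, as in the Svarc-Milnor lemma: a geodesic is followed in unit steps by orbit points,
  and consecutive ones differ by an element of a finite set.\<close>

lemma displacement_bound:
  assumes x0: "x0 \<in> A.M" and p: "p \<in> B.M"
  obtains K C where "K \<ge> 0"
    "\<And>g h. g \<in> A.G \<Longrightarrow> h \<in> A.G \<Longrightarrow>
      B.d (B.ac g p) (B.ac h p) \<le> K * A.d (A.ac g x0) (A.ac h x0) + C"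
proof -
  obtain \<rho> where rho: "\<rho> \<ge> 0" "\<And>x. x \<in> A.M \<Longrightarrow> \<exists>h\<in>A.G. A.d x (A.ac h x0) \<le> \<rho>"
    using A.coarsely_transitive[OF x0] by blast
  \<comment> \<open>Orbit points within \<open>\<rho>\<close> of two points at distance at most 1
    are at most \<open>2 * \<rho> + 1\<close> apart.\<close>
  define T where "T = {t \<in> A.G. A.d x0 (A.ac t x0) \<le> 2 * \<rho> + 1}"
  have finT: "finite T" unfolding T_def using A.finite_displacement[OF x0 x0] .
  define K where "K = (\<Sum>t\<in>T. B.d p (B.ac t p))"
  have K0: "K \<ge> 0" unfolding K_def by (intro sum_nonneg) simp
  have KT: "B.d p (B.ac t p) \<le> K" if "t \<in> T" for t
    unfolding K_def using finT that by (intro member_le_sum) auto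
  \<comment> \<open>Induction over unit steps towards \<open>x0\<close>; the summand 1 pays for an
    orbit point that is only near \<open>x0\<close>.\<close>
  have claim: "B.d p (B.ac h p) \<le> (real n + 1) * K"
    if "y \<in> A.M" "h \<in> A.G" "A.d x0 y \<le> real n" "A.d y (A.ac h x0) \<le> \<rho>" for n y h
    using that
  proof (induction n arbitrary: y h)
    case 0
    then have "y = x0" using A.dist_zeroD[OF x0, of y] by simp
    then have "h \<in> T" using 0 rho(1) by (simp add: T_def)
    then show ?case using KT by simp
  next
    case (Suc n)
    define t where "t = min (A.d x0 y) (real n)"
    have t: "t \<in> {0..A.d x0 y}" by (simp add: t_def)
    define y' where "y' = A.pt x0 y t"
    have y': "y' \<in> A.sg x0 y" "A.d x0 y' = t" using A.pt[OF x0 Suc.prems(1) t] by (simp_all add: y'_def)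
    have y'M: "y' \<in> A.M" using A.seg_in_M[OF y'(1)] .
    have "A.d y' y \<le> 1"
      using A.seg_dist_sum[OF y'(1)] y'(2) Suc.prems(3) by (auto simp: t_def min_def split: if_splits)
    obtain h' where h': "h' \<in> A.G" "A.d y' (A.ac h' x0) \<le> \<rho>" using rho(2)[OF y'M] by blast
    have IH: "B.d p (B.ac h' p) \<le> (real n + 1) * K"
      using Suc.IH[OF y'M h'(1) _ h'(2)] y'(2) by (simp add: t_def)
    let ?t = "inv h' \<otimes> h"
    have tG: "?t \<in> A.G" using h'(1) Suc.prems(2) by simp
    have h: "h' \<otimes> ?t = h" using h'(1) Suc.prems(2) by (simp add: A.F.m_assoc[symmetric])
    have M: "A.ac h' x0 \<in> A.M" "A.ac h x0 \<in> A.M" "A.ac ?t x0 \<in> A.M"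
      using h'(1) Suc.prems(2) tG x0 A.act_closed by auto
    have "A.d x0 (A.ac ?t x0) = A.d (A.ac h' x0) (A.ac h x0)"
      using A.act_isom[OF h'(1) x0 M(3)] A.act_mult[OF h'(1) tG x0] h by simp
    also have "\<dots> \<le> A.d (A.ac h' x0) y' + (A.d y' y + A.d y (A.ac h x0))"
      using A.tri[OF M(1) y'M M(2)] A.tri[OF y'M Suc.prems(1) M(2)] by linarith
    also have "\<dots> \<le> \<rho> + (1 + \<rho>)"
      using h'(2) Suc.prems(4) \<open>A.d y' y \<le> 1\<close> mdist_commute[of "metr \<Gamma>" "A.ac h' x0" y'] by linarith
    finally have "?t \<in> T" using tG by (simp add: T_def)
    have N: "B.ac h' p \<in> B.M" "B.ac h p \<in> B.M" "B.ac ?t p \<in> B.M"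
      using h'(1) Suc.prems(2) tG p B.act_closed by auto
    have "B.d (B.ac h' p) (B.ac h p) = B.d p (B.ac ?t p)"
      using B.act_isom[OF h'(1) p N(3)] B.act_mult[OF h'(1) tG p] h by simp
    also have "\<dots> \<le> K" using KT[OF \<open>?t \<in> T\<close>] .
    finally have "B.d p (B.ac h p) \<le> (real n + 1) * K + K"
      using B.tri[OF p N(1,2)] IH by linarith
    then show ?case by (simp add: algebra_simps)
  qed
  have base: "B.d p (B.ac g p) \<le> K * A.d x0 (A.ac g x0) + 2 * K" if g: "g \<in> A.G" for g
  proof -
    define n where "n = nat \<lceil>A.d x0 (A.ac g x0)\<rceil>"
    have gM: "A.ac g x0 \<in> A.M" using A.act_closed[OF g x0] .
    have n: "A.d x0 (A.ac g x0) \<le> real n" "real n \<le> A.d x0 (A.ac g x0) + 1"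
      unfolding n_def using mdist_nonneg[of "metr \<Gamma>" x0 "A.ac g x0"] by linarith+
    have "B.d p (B.ac g p) \<le> (real n + 1) * K" using claim[OF gM g n(1)] gM rho(1) by simp
    also have "\<dots> \<le> (A.d x0 (A.ac g x0) + 2) * K" using n(2) K0 by (intro mult_right_mono) auto
    finally show ?thesis by (simp add: algebra_simps)
  qed
  have "B.d (B.ac g p) (B.ac h p) \<le> K * A.d (A.ac g x0) (A.ac h x0) + 2 * K"
    if gh: "g \<in> A.G" "h \<in> A.G" for g h
  proof -
    let ?t = "inv g \<otimes> h"
    have tG: "?t \<in> A.G" using gh by simp
    have h: "g \<otimes> ?t = h" using gh by (simp add: A.F.m_assoc[symmetric])
    have "B.d (B.ac g p) (B.ac h p) = B.d p (B.ac ?t p)"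
      using B.act_isom[OF gh(1) p B.act_closed[OF tG p]] B.act_mult[OF gh(1) tG p] h by simp
    moreover have "A.d (A.ac g x0) (A.ac h x0) = A.d x0 (A.ac ?t x0)"
      using A.act_isom[OF gh(1) x0 A.act_closed[OF tG x0]] A.act_mult[OF gh(1) tG x0] h by simp
    ultimately show ?thesis using base[OF tG] by simp
  qed
  then show thesis using that K0 by blast
qed

text \<open>The weighted circumcentre of the orbit of \<open>p\<close>: the minimum \<open>c\<close> of
  \<open>y \<mapsto> sup\<^sub>g (d y (g p) - K * d x (g x0))\<close>. In a tree this function grows at unit speed away from
  its minimum, so \<open>c\<close> is a \<open>K\<close>-Lipschitz function of \<open>x\<close>.\<close>

definition centre :: "real \<Rightarrow> 'a \<Rightarrow> 'b \<Rightarrow> 'a \<Rightarrow> 'b \<Rightarrow> bool" where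
  "centre K x0 p x c \<longleftrightarrow> c \<in> B.M \<and> (\<exists>r.
     (\<forall>g\<in>A.G. B.d c (B.ac g p) \<le> r + K * A.d x (A.ac g x0)) \<and>
     (\<forall>y\<in>B.M. \<exists>g\<in>A.G. r + B.d y c + K * A.d x (A.ac g x0) \<le> B.d y (B.ac g p)))"

text \<open>The circumcentre of a finite set in a tree is the midpoint of a diameter; here it is the
  point of the geodesic between \<open>B.ac a p\<close> and \<open>B.ac b p\<close> that balances
  the weights, for a pair maximising \<open>val\<close>. The slope \<open>K + 1\<close> exceeds the
  growth rate \<open>K\<close> in \<open>bound\<close>, so \<open>val\<close> tends to minus
  infinity and a maximum over infinitely many pairs exists.\<close>

lemma centre_exists:
  assumes x0: "x0 \<in> A.M" and p: "p \<in> B.M" and K: "K \<ge> 0"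
    and bound: "\<And>g h. g \<in> A.G \<Longrightarrow> h \<in> A.G \<Longrightarrow>
      B.d (B.ac g p) (B.ac h p) \<le> K * A.d (A.ac g x0) (A.ac h x0) + C"
    and x: "x \<in> A.M"
  shows "\<exists>c. centre (K + 1) x0 p x c"
proof -
  define \<delta> where "\<delta> g = A.d x (A.ac g x0)" for g
  define w where "w g = (K + 1) * \<delta> g" for g
  have \<delta>0: "\<delta> g \<ge> 0" for g by (simp add: \<delta>_def)
  have w0: "w g \<ge> 0" for g using K \<delta>0 by (simp add: w_def)
  have pM: "B.ac g p \<in> B.M" if "g \<in> A.G" for g using B.act_closed that p by blast
  have xM: "A.ac g x0 \<in> A.M" if "g \<in> A.G" for g using A.act_closed that x0 by blast
  define val where "val g h = (B.d (B.ac g p) (B.ac h p) - w g - w h) / 2" for g h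
  have val_le: "2 * val g h \<le> C - \<delta> g - \<delta> h" if gh: "g \<in> A.G" "h \<in> A.G" for g h
  proof -
    have "A.d (A.ac g x0) (A.ac h x0) \<le> \<delta> g + \<delta> h"
      unfolding \<delta>_def using A.tri[OF xM[OF gh(1)] x xM[OF gh(2)]] mdist_commute[of "metr \<Gamma>" x "A.ac g x0"]
      by linarith
    then have "K * A.d (A.ac g x0) (A.ac h x0) \<le> K * (\<delta> g + \<delta> h)" using K by (rule mult_left_mono)
    then have "B.d (B.ac g p) (B.ac h p) \<le> K * \<delta> g + K * \<delta> h + C"
      using bound[OF gh] by (simp add: distrib_left)
    moreover have "2 * val g h = B.d (B.ac g p) (B.ac h p) - (K * \<delta> g + \<delta> g) - (K * \<delta> h + \<delta> h)"
      by (simp add: val_def w_def distrib_right)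
    ultimately show ?thesis by linarith
  qed
  \<comment> \<open>A pair with a displacement beyond this threshold has \<open>val\<close> at most
    \<open>val \<one> \<one> = - w \<one>\<close>, so the maximum can be taken over the finite set
    \<open>P \<times> P\<close>.\<close>
  let ?k = "C + 2 * w \<one>"
  define P where "P = {g \<in> A.G. \<delta> g \<le> ?k}"
  have finP: "finite (P \<times> P)" unfolding P_def \<delta>_def using A.finite_displacement[OF x x0] by simp
  have one: "\<one> \<in> A.G" by (rule A.F.one_closed)
  have val1: "val g g = - w g" if "g \<in> A.G" for g using pM[OF that] by (simp add: val_def)
  have "2 * val \<one> \<one> \<le> C - \<delta> \<one> - \<delta> \<one>" using val_le[OF one one] .
  then have "\<delta> \<one> \<le> ?k" using val1[OF one] \<delta>0[of "\<one>"] by linarith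
  then have oneP: "(\<one>, \<one>) \<in> P \<times> P" using one by (simp add: P_def)
  define r where "r = Max ((\<lambda>(g, h). val g h) ` (P \<times> P))"
  have "r \<in> (\<lambda>(g, h). val g h) ` (P \<times> P)" unfolding r_def using finP oneP by (intro Max_in) auto
  then obtain a b where ab: "a \<in> A.G" "b \<in> A.G" "r = val a b" by (auto simp: P_def)
  have r_P: "val g h \<le> r" if "g \<in> P" "h \<in> P" for g h
    unfolding r_def using finP that by (intro Max_ge) force+
  have r_max: "val g h \<le> r" if gh: "g \<in> A.G" "h \<in> A.G" for g h
  proof (cases "g \<in> P \<and> h \<in> P")
    case True then show ?thesis using r_P by blast
  next
    case False
    then have "\<delta> g + \<delta> h \<ge> ?k" using gh \<delta>0[of g] \<delta>0[of h] by (auto simp: P_def)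
    then have "val g h \<le> val \<one> \<one>" using val_le[OF gh] val1[OF one] by linarith
    then show ?thesis using r_P oneP by fastforce
  qed
  have rw: "r + w g \<ge> 0" if "g \<in> A.G" for g using r_max[OF that that] val1[OF that] by linarith
  have dab: "B.d (B.ac a p) (B.ac b p) = (r + w a) + (r + w b)" using ab(3) by (simp add: val_def)
  have t: "r + w a \<in> {0..B.d (B.ac a p) (B.ac b p)}" using rw[OF ab(1)] rw[OF ab(2)] dab by simp
  define c where "c = B.pt (B.ac a p) (B.ac b p) (r + w a)"
  have c: "c \<in> B.sg (B.ac a p) (B.ac b p)" and ca: "B.d (B.ac a p) c = r + w a"
    unfolding c_def using B.pt[OF pM[OF ab(1)] pM[OF ab(2)] t] by auto
  have cb: "B.d c (B.ac b p) = r + w b" using B.seg_dist_sum[OF c] ca dab by linarith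
  have cM: "c \<in> B.M" using B.seg_in_M[OF c] .
  \<comment> \<open>Seen from any point \<open>z\<close>, at least one of the two extremal points
    lies beyond \<open>c\<close>. This gives both the radius bound, with \<open>z\<close> in the
    orbit, and the growth away from \<open>c\<close>.\<close>
  have side: "B.d (B.ac a p) z = (r + w a) + B.d c z \<or> B.d z (B.ac b p) = B.d z c + (r + w b)"
    if "z \<in> B.M" for z
    using B.seg_split[OF c pM[OF ab(1)] pM[OF ab(2)] that]
      B.seg_dist_sum[of c "B.ac a p" z] B.seg_dist_sum[of c z "B.ac b p"] ca cb by auto
  have "B.d c (B.ac g p) \<le> r + w g" if g: "g \<in> A.G" for g
  proof -
    have "2 * val a g \<le> 2 * r" "2 * val g b \<le> 2 * r" using r_max ab(1,2) g by auto
    then have "B.d (B.ac a p) (B.ac g p) \<le> 2 * r + w a + w g" "B.d (B.ac g p) (B.ac b p) \<le> 2 * r + w g + w b"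
      by (auto simp: val_def)
    then show ?thesis using side[OF pM[OF g]] mdist_commute[of "metr \<Gamma>'" c "B.ac g p"] by auto
  qed
  moreover have "\<exists>g\<in>A.G. r + B.d y c + w g \<le> B.d y (B.ac g p)" if y: "y \<in> B.M" for y
    using side[OF y]
  proof
    assume "B.d (B.ac a p) y = (r + w a) + B.d c y"
    then show ?thesis using ab(1) mdist_commute[of "metr \<Gamma>'" y c] mdist_commute[of "metr \<Gamma>'" y "B.ac a p"]
      by (intro bexI[of _ a]) auto
  next
    assume "B.d y (B.ac b p) = B.d y c + (r + w b)"
    then show ?thesis using ab(2) by (intro bexI[of _ b]) auto
  qed
  ultimately have "centre (K + 1) x0 p x c" unfolding centre_def w_def \<delta>_def using cM by blast
  then show ?thesis by blast
qed

text \<open>Each centre is tested against the growth condition of the other. Adding the two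
  inequalities cancels the unknown radii \<open>r\<close> and \<open>r'\<close>. For
  \<open>x = x'\<close> this is uniqueness of the centre.\<close>

lemma centre_lipschitz:
  assumes x0: "x0 \<in> A.M" and K: "K \<ge> 0" and x: "x \<in> A.M" "x' \<in> A.M"
    and c: "centre K x0 p x c" and c': "centre K x0 p x' c'"
  shows "B.d c c' \<le> K * A.d x x'"
proof -
  obtain r where r: "c \<in> B.M" "\<forall>g\<in>A.G. B.d c (B.ac g p) \<le> r + K * A.d x (A.ac g x0)"
     "\<forall>y\<in>B.M. \<exists>g\<in>A.G. r + B.d y c + K * A.d x (A.ac g x0) \<le> B.d y (B.ac g p)"
    using c unfolding centre_def by blast
  obtain r' where r': "c' \<in> B.M" "\<forall>g\<in>A.G. B.d c' (B.ac g p) \<le> r' + K * A.d x' (A.ac g x0)"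
     "\<forall>y\<in>B.M. \<exists>g\<in>A.G. r' + B.d y c' + K * A.d x' (A.ac g x0) \<le> B.d y (B.ac g p)"
    using c' unfolding centre_def by blast
  have lip: "K * A.d y (A.ac g x0) \<le> K * A.d y z + K * A.d z (A.ac g x0)"
    if "g \<in> A.G" "y \<in> A.M" "z \<in> A.M" for g y z
  proof -
    have "A.d y (A.ac g x0) \<le> A.d y z + A.d z (A.ac g x0)" using A.tri A.act_closed that x0 by blast
    then have "K * A.d y (A.ac g x0) \<le> K * (A.d y z + A.d z (A.ac g x0))" using K by (rule mult_left_mono)
    then show ?thesis by (simp add: distrib_left)
  qed
  obtain g where g: "g \<in> A.G" "r + B.d c' c + K * A.d x (A.ac g x0) \<le> B.d c' (B.ac g p)"
    using r(3) r'(1) by blast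
  obtain h where h: "h \<in> A.G" "r' + B.d c c' + K * A.d x' (A.ac h x0) \<le> B.d c (B.ac h p)"
    using r'(3) r(1) by blast
  have "B.d c' (B.ac g p) \<le> r' + K * A.d x' (A.ac g x0)" "B.d c (B.ac h p) \<le> r + K * A.d x (A.ac h x0)"
    using r'(2) r(2) g(1) h(1) by auto
  then have "r + B.d c' c \<le> r' + K * A.d x' x" "r' + B.d c c' \<le> r + K * A.d x x'"
    using g h lip[OF g(1) x(2,1)] lip[OF h(1) x] by linarith+
  then show ?thesis using mdist_commute[of "metr \<Gamma>'" c c'] mdist_commute[of "metr \<Gamma>" x x'] by simp
qed

lemma centre_act:
  assumes x0: "x0 \<in> A.M" and p: "p \<in> B.M" and x: "x \<in> A.M" and c: "centre K x0 p x c" and k: "k \<in> A.G"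
  shows "centre K x0 p (A.ac k x) (B.ac k c)"
proof -
  obtain r where r: "c \<in> B.M" "\<And>g. g \<in> A.G \<Longrightarrow> B.d c (B.ac g p) \<le> r + K * A.d x (A.ac g x0)"
     "\<And>y. y \<in> B.M \<Longrightarrow> \<exists>g\<in>A.G. r + B.d y c + K * A.d x (A.ac g x0) \<le> B.d y (B.ac g p)"
    using c unfolding centre_def by blast
  have ik: "inv k \<in> A.G" using k by simp
  have A1: "A.d (A.ac k x) (A.ac (k \<otimes> g) x0) = A.d x (A.ac g x0)" if "g \<in> A.G" for g
    using A.act_mult[OF k that x0] A.act_isom[OF k x A.act_closed[OF that x0]] by simp
  have B1: "B.d (B.ac k y) (B.ac (k \<otimes> g) p) = B.d y (B.ac g p)" if "g \<in> A.G" "y \<in> B.M" for g y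
    using B.act_mult[OF k that(1) p] B.act_isom[OF k that(2) B.act_closed[OF that(1) p]] by simp
  have "B.d (B.ac k c) (B.ac g p) \<le> r + K * A.d (A.ac k x) (A.ac g x0)" if g: "g \<in> A.G" for g
  proof -
    let ?h = "inv k \<otimes> g"
    have h: "?h \<in> A.G" "k \<otimes> ?h = g" using g k by (auto simp: A.F.m_assoc[symmetric])
    show ?thesis using r(2)[OF h(1)] A1[OF h(1)] B1[OF h(1) r(1)] h(2) by simp
  qed
  moreover have "\<exists>g\<in>A.G. r + B.d y (B.ac k c) + K * A.d (A.ac k x) (A.ac g x0) \<le> B.d y (B.ac g p)"
    if y: "y \<in> B.M" for y
  proof -
    define z where "z = B.ac (inv k) y"
    have z: "z \<in> B.M" "B.ac k z = y" using B.act_closed[OF ik y] B.act_inv2[OF k y] by (auto simp: z_def)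
    obtain g where g: "g \<in> A.G" "r + B.d z c + K * A.d x (A.ac g x0) \<le> B.d z (B.ac g p)"
      using r(3)[OF z(1)] by blast
    then have "r + B.d y (B.ac k c) + K * A.d (A.ac k x) (A.ac (k \<otimes> g) x0) \<le> B.d y (B.ac (k \<otimes> g) p)"
      using A1[OF g(1)] B1[OF g(1) z(1)] B.act_isom[OF k z(1) r(1)] z(2) by simp
    then show ?thesis using k g(1) by (intro bexI[of _ "k \<otimes> g"]) auto
  qed
  moreover have "B.ac k c \<in> B.M" using B.act_closed[OF k r(1)] .
  ultimately show ?thesis unfolding centre_def by blast
qed

text \<open>Shows that the infimum in \<open>Lip\<close> is taken over a nonempty set.\<close>

lemma ex_equi_lip: "\<exists>L\<ge>0. \<exists>f. equi_lip F \<Gamma> \<Gamma>' L f"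
proof -
  obtain x0 where x0: "x0 \<in> A.M" using A.tree by (auto simp: real_tree_def)
  obtain p where p: "p \<in> B.M" using B.tree by (auto simp: real_tree_def)
  obtain K C where K: "K \<ge> 0" and bound: "\<And>g h. g \<in> A.G \<Longrightarrow> h \<in> A.G \<Longrightarrow>
      B.d (B.ac g p) (B.ac h p) \<le> K * A.d (A.ac g x0) (A.ac h x0) + C"
    using displacement_bound[OF x0 p] by blast
  define f where "f x = (SOME c. centre (K + 1) x0 p x c)" for x
  have f: "centre (K + 1) x0 p x (f x)" if "x \<in> A.M" for x
    unfolding f_def using centre_exists[OF x0 p K bound that] by (rule someI_ex)
  have K1: "K + 1 \<ge> 0" using K by simp
  have fM: "f x \<in> B.M" if "x \<in> A.M" for x using f[OF that] by (simp add: centre_def)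
  \<comment> \<open>The arbitrary choice of centres is harmless: \<open>B.ac g (f x)\<close> is also
    a centre for \<open>A.ac g x\<close>, and centres are unique.\<close>
  have "f (A.ac g x) = B.ac g (f x)" if g: "g \<in> A.G" and x: "x \<in> A.M" for g x
  proof (rule B.dist_zeroD)
    have gx: "A.ac g x \<in> A.M" using A.act_closed[OF g x] .
    show "B.d (f (A.ac g x)) (B.ac g (f x)) \<le> 0"
      using centre_lipschitz[OF x0 K1 gx gx f[OF gx] centre_act[OF x0 p x f[OF x] g]] gx by simp
    show "f (A.ac g x) \<in> B.M" using fM[OF gx] .
    show "B.ac g (f x) \<in> B.M" using B.act_closed[OF g fM[OF x]] .
  qed
  moreover have "B.d (f x) (f y) \<le> (K + 1) * A.d x y" if "x \<in> A.M" "y \<in> A.M" for x y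
    using centre_lipschitz[OF x0 K1 that f[OF that(1)] f[OF that(2)]] .
  ultimately have "equi_lip F \<Gamma> \<Gamma>' (K + 1) f" unfolding equi_lip_def using fM by simp
  then show ?thesis using K1 by blast
qed

end

section \<open>Attaining the Lipschitz constant\<close>

context gtree_pair begin

text \<open>Points of a product topology are extensional functions, so maps are restricted before
  \<open>ex_1_lip\<close> treats them as such.\<close>

lemma equi_lip_restrict:
  assumes "equi_lip F \<Gamma> \<Gamma>' L f" shows "equi_lip F \<Gamma> \<Gamma>' L (restrict f A.M)"
  using equi_lipD[OF assms] A.act_closed unfolding equi_lip_def by simp

lemma equi_lip_central:
  assumes f: "equi_lip F \<Gamma> \<Gamma>' L f" and c: "c \<in> A.G" "\<And>g. g \<in> A.G \<Longrightarrow> c \<otimes> g = g \<otimes> c"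
  shows "equi_lip F \<Gamma> \<Gamma>' L (\<lambda>x. B.ac c (f x))"
  unfolding equi_lip_def
proof (intro conjI ballI)
  show "(\<lambda>x. B.ac c (f x)) \<in> A.M \<rightarrow> B.M" using B.act_closed[OF c(1)] equi_lipD(2)[OF f] by blast
  fix x assume x: "x \<in> A.M"
  have fx: "f x \<in> B.M" using equi_lipD(2)[OF f x] .
  show "B.ac c (f (A.ac g x)) = B.ac g (B.ac c (f x))" if g: "g \<in> A.G" for g
    using equi_lipD(3)[OF f g x] B.act_mult[OF c(1) g fx] B.act_mult[OF g c(1) fx] c(2)[OF g] by simp
  show "B.d (B.ac c (f x)) (B.ac c (f y)) \<le> L * A.d x y" if y: "y \<in> A.M" for y
    using B.act_isom[OF c(1) fx equi_lipD(2)[OF f y]] equi_lipD(4)[OF f x y] by simp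
qed

lemma commutes_with_generators:
  assumes S: "S \<subseteq> A.G" "generate F S = A.G" and c: "c \<in> A.G"
    and cs: "\<And>s. s \<in> S \<Longrightarrow> c \<otimes> s = s \<otimes> c" and g: "g \<in> A.G"
  shows "c \<otimes> g = g \<otimes> c"
proof -
  have "g \<in> generate F S" using g S by simp
  then show ?thesis
  proof (induction rule: generate.induct)
    case one then show ?case using c by simp
  next
    case (incl h) then show ?case using cs by simp
  next
    case (inv h)
    then have h: "h \<in> A.G" using S by blast
    have "inv h \<otimes> (c \<otimes> h) \<otimes> inv h = inv h \<otimes> (h \<otimes> c) \<otimes> inv h"
      using cs inv by simp
    moreover have "inv h \<otimes> (c \<otimes> h) \<otimes> inv h = inv h \<otimes> c"
      using h c by (simp add: A.F.m_assoc)
    moreover have "inv h \<otimes> (h \<otimes> c) \<otimes> inv h = c \<otimes> inv h"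
      using h c by (simp add: A.F.m_assoc[symmetric])
    ultimately show ?case by simp
  next
    case (eng g h)
    then have gh: "g \<in> A.G" "h \<in> A.G" using S by auto
    have "c \<otimes> (g \<otimes> h) = (c \<otimes> g) \<otimes> h" using gh c by (simp add: A.F.m_assoc)
    also have "\<dots> = g \<otimes> (c \<otimes> h)" using eng.IH(1) gh c by (simp add: A.F.m_assoc)
    also have "\<dots> = (g \<otimes> h) \<otimes> c" using eng.IH(2) gh c by (simp add: A.F.m_assoc)
    finally show ?case .
  qed
qed

text \<open>Up to the action, a base point lands in a bounded set, and then its displacements by the
  generators take finitely many values. Two maps with the same displacements differ by a central
  element of \<open>F\<close>, so after composing with central elements all the maps are uniformly bounded.\<close>

lemma bounded_representatives:
  assumes x0: "x0 \<in> A.M" and v0: "v0 \<in> B.M"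
  shows "\<exists>R. \<forall>L f. L \<le> 2 \<longrightarrow> equi_lip F \<Gamma> \<Gamma>' L f \<longrightarrow> (\<exists>f'. equi_lip F \<Gamma> \<Gamma>' L f' \<and> B.d v0 (f' x0) \<le> R)"
proof -
  obtain S where S: "finite S" "S \<subseteq> A.G" "generate F S = A.G"
    using A.fg by (auto simp: finitely_generated_def)
  obtain \<rho> where rho: "\<rho> \<ge> 0" "\<And>y. y \<in> B.M \<Longrightarrow> \<exists>h\<in>B.G. B.d y (B.ac h v0) \<le> \<rho>"
    using B.coarsely_transitive[OF v0] by blast
  define C where "C = (\<Sum>s\<in>S. A.d x0 (A.ac s x0))"
  have C: "A.d x0 (A.ac s x0) \<le> C" if "s \<in> S" for s
    unfolding C_def using S(1) that by (intro member_le_sum) auto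
  \<comment> \<open>A generator moves \<open>f x0\<close> by at most \<open>2 * C\<close>, as
    \<open>L \<le> 2\<close>; replacing \<open>f x0\<close> by an orbit point of \<open>v0\<close>
    within \<open>\<rho>\<close> adds \<open>\<rho>\<close> at each end.\<close>
  define Q where "Q = {q \<in> A.G. B.d v0 (B.ac q v0) \<le> 2 * \<rho> + 2 * C}"
  have finQ: "finite Q" unfolding Q_def using B.finite_displacement[OF v0 v0] .
  define conj where "conj g s = inv g \<otimes> s \<otimes> g" for g s
  define P where "P = {g \<in> A.G. \<forall>s\<in>S. conj g s \<in> Q}"
  \<comment> \<open>Records how \<open>g\<close> conjugates the generators. Only finitely many
    values occur on \<open>P\<close>, and \<open>M0\<close> realises each of them.\<close>
  define \<theta> where "\<theta> g = restrict (conj g) S" for g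
  have "\<theta> ` P \<subseteq> PiE S (\<lambda>_. Q)" by (auto simp: \<theta>_def P_def)
  then have "finite (\<theta> ` P)" using finite_PiE[OF S(1), of "\<lambda>_. Q"] finQ finite_subset by blast
  then obtain M0 where M0: "M0 \<subseteq> P" "finite M0" "\<theta> ` P = \<theta> ` M0"
    using finite_subset_image[of "\<theta> ` P" \<theta> P] by auto
  define D where "D = (\<Sum>m\<in>M0. B.d v0 (B.ac m v0))"
  have D: "B.d v0 (B.ac m v0) \<le> D" if "m \<in> M0" for m
    unfolding D_def using M0(2) that by (intro member_le_sum) auto
  have "\<exists>f'. equi_lip F \<Gamma> \<Gamma>' L f' \<and> B.d v0 (f' x0) \<le> D + \<rho>" if L: "L \<le> 2" and f: "equi_lip F \<Gamma> \<Gamma>' L f" for L f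
  proof -
    define y where "y = f x0"
    have y: "y \<in> B.M" using equi_lipD(2)[OF f x0] by (simp add: y_def)
    obtain g where g: "g \<in> B.G" "B.d y (B.ac g v0) \<le> \<rho>" using rho(2)[OF y] by blast
    have ig: "inv g \<in> B.G" using g(1) by simp
    have gv: "B.ac g v0 \<in> B.M" using B.act_closed[OF g(1) v0] .
    have "conj g s \<in> Q" if s: "s \<in> S" for s
    proof -
      have sG: "s \<in> A.G" using s S by blast
      have q: "conj g s \<in> A.G" using g(1) sG by (simp add: conj_def)
      have gq: "g \<otimes> conj g s = s \<otimes> g" using g(1) sG by (simp add: conj_def A.F.m_assoc[symmetric])
      have M: "B.ac s y \<in> B.M" "B.ac s (B.ac g v0) \<in> B.M" using B.act_closed[OF sG] y gv by auto
      have "B.d v0 (B.ac (conj g s) v0) = B.d (B.ac g v0) (B.ac g (B.ac (conj g s) v0))"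
        using B.act_isom[OF g(1) v0 B.act_closed[OF q v0]] by simp
      also have "\<dots> = B.d (B.ac g v0) (B.ac s (B.ac g v0))"
        using B.act_mult[OF g(1) q v0] B.act_mult[OF sG g(1) v0] gq by simp
      also have "\<dots> \<le> B.d (B.ac g v0) y + (B.d y (B.ac s y) + B.d (B.ac s y) (B.ac s (B.ac g v0)))"
        using B.tri[OF gv y M(2)] B.tri[OF y M] by linarith
      also have "\<dots> \<le> \<rho> + (2 * C + \<rho>)"
      proof -
        have "B.d y (B.ac s y) \<le> L * A.d x0 (A.ac s x0)"
          using equi_lipD(4)[OF f x0 A.act_closed[OF sG x0]] equi_lipD(3)[OF f sG x0] by (simp add: y_def)
        also have "\<dots> \<le> 2 * C" using L C[OF s] by (intro mult_mono) auto
        finally show ?thesis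
          using g(2) B.act_isom[OF sG y gv] mdist_commute[of "metr \<Gamma>'" "B.ac g v0" y] by linarith
      qed
      finally show ?thesis using q by (simp add: Q_def)
    qed
    then have gP: "g \<in> P" using g(1) by (simp add: P_def)
    then obtain m where m: "m \<in> M0" "\<theta> g = \<theta> m" using M0(3) by (metis imageE imageI)
    have mG: "m \<in> A.G" using m(1) M0(1) by (auto simp: P_def)
    \<comment> \<open>Takes \<open>B.ac g v0\<close> to \<open>B.ac m v0\<close>; it is central
      because \<open>g\<close> and \<open>m\<close> conjugate every generator in the same
      way.\<close>
    define c where "c = m \<otimes> inv g"
    have c: "c \<in> A.G" using mG ig by (simp add: c_def)
    have "c \<otimes> s = s \<otimes> c" if s: "s \<in> S" for s
    proof -
      have sG: "s \<in> A.G" using s S by blast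
      have e: "conj g s = conj m s" using fun_cong[OF m(2), of s] s by (simp add: \<theta>_def)
      have "c \<otimes> s = m \<otimes> conj g s \<otimes> inv g"
        using g(1) mG sG by (simp add: c_def conj_def A.F.m_assoc)
      also have "\<dots> = m \<otimes> conj m s \<otimes> inv g" by (simp only: e)
      also have "\<dots> = s \<otimes> c"
        using g(1) mG sG by (simp add: c_def conj_def A.F.m_assoc[symmetric])
      finally show ?thesis .
    qed
    then have "c \<otimes> h = h \<otimes> c" if "h \<in> A.G" for h
      using commutes_with_generators[OF S(2,3) c _ that] by blast
    from equi_lip_central[OF f c this] have lip: "equi_lip F \<Gamma> \<Gamma>' L (\<lambda>x. B.ac c (f x))" by blast
    have mv: "B.ac m v0 \<in> B.M" using B.act_closed[OF mG v0] .
    have cy: "B.ac c y \<in> B.M" using B.act_closed[OF c y] .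
    have "B.ac c (B.ac g v0) = B.ac m v0"
      using B.act_mult[OF c g(1) v0] mG g(1) by (simp add: c_def A.F.m_assoc)
    then have "B.d (B.ac m v0) (B.ac c y) \<le> \<rho>"
      using B.act_isom[OF c gv y] g(2) mdist_commute[of "metr \<Gamma>'" "B.ac g v0" y] by simp
    then have "B.d v0 (B.ac c (f x0)) \<le> D + \<rho>"
      using B.tri[OF v0 mv cy] D[OF m(1)] by (simp add: y_def)
    then show ?thesis using lip by blast
  qed
  then show ?thesis by blast
qed

text \<open>By Tychonoff's theorem and the compactness of balls, the sets of equivariant
  \<open>(1 + 1/n)\<close>-Lipschitz maps that are bounded at the base point have a common element.\<close>

lemma ex_1_lip:
  assumes ex: "\<And>\<epsilon>. \<epsilon> > 0 \<Longrightarrow> \<exists>L f. L < 1 + \<epsilon> \<and> equi_lip F \<Gamma> \<Gamma>' L f"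
  shows "\<exists>f. equi_lip F \<Gamma> \<Gamma>' 1 f"
proof -
  obtain x0 where x0: "x0 \<in> A.M" using A.tree by (auto simp: real_tree_def)
  obtain v0 where v0: "v0 \<in> B.W" using B.ex_vertex by auto
  have v0M: "v0 \<in> B.M" using B.V_in_M[OF v0] .
  obtain R where R: "\<And>L f. L \<le> 2 \<Longrightarrow> equi_lip F \<Gamma> \<Gamma>' L f \<Longrightarrow> (\<exists>f'. equi_lip F \<Gamma> \<Gamma>' L f' \<and> B.d v0 (f' x0) \<le> R)"
    using bounded_representatives[OF x0 v0M] by blast
  \<comment> \<open>The factor 2 bounds all the constants \<open>l n\<close>, so one compact product
    contains suitable maps for every \<open>n\<close>.\<close>
  define K where "K x = {y \<in> B.M. B.d v0 y \<le> R + 2 * A.d x0 x}" for x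
  define T where "T = mtopology_of (metr \<Gamma>')"
  define X where "X = product_topology (\<lambda>x. subtopology T (K x)) A.M"
  have KM: "K x \<subseteq> B.M" for x by (auto simp: K_def)
  have topX: "topspace X = PiE A.M K" using KM by (auto simp: X_def T_def Int_absorb1)
  have "compact_space (subtopology T (K x))" for x
    unfolding T_def K_def by (intro compact_space_subtopology B.compactin_cball v0)
  then have compX: "compact_space X" unfolding X_def by (simp add: compact_space_product_topology)
  have proj: "continuous_map X T (\<lambda>f. f x)" if "x \<in> A.M" for x
    using continuous_map_product_projection[OF that, of "\<lambda>x. subtopology T (K x)"]
    unfolding X_def by (rule continuous_map_into_fulltopology)
  have cont_act: "continuous_map T T (B.ac g)" if g: "g \<in> B.G" for g
  proof -
    have "Lipschitz_continuous_map (metr \<Gamma>') (metr \<Gamma>') (B.ac g)"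
      unfolding Lipschitz_continuous_map_def
      using B.act_closed[OF g] B.act_isom[OF g] by (intro conjI exI[of _ 1]) auto
    then show ?thesis unfolding T_def by (rule Lipschitz_continuous_imp_continuous_map)
  qed
  have closed_le: "closedin X {f \<in> topspace X. B.d (\<phi> f) (\<psi> f) \<le> k}"
    if "continuous_map X T \<phi>" "continuous_map X T \<psi>" for \<phi> \<psi> k
  proof -
    have "continuous_map X euclidean (\<lambda>f. B.d (\<phi> f) (\<psi> f))"
      using that unfolding T_def by (rule continuous_map_mdist)
    from closedin_continuous_map_preimage[OF this, of "{..k}"] show ?thesis by simp
  qed
  define l where "l n = 1 + 1 / real (Suc n)" for n
  have l: "1 < l n" "l n \<le> 2" for n by (auto simp: l_def)
  \<comment> \<open>Equivariance is written as a distance being at most 0, so that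
    \<open>closed_le\<close> covers it along with the Lipschitz conditions.\<close>
  define Eq where "Eq = (\<lambda>(g, x). {f \<in> topspace X. B.d (f (A.ac g x)) (B.ac g (f x)) \<le> 0}) ` (A.G \<times> A.M)"
  define Li where "Li n = (\<lambda>(x, y). {f \<in> topspace X. B.d (f x) (f y) \<le> l n * A.d x y}) ` (A.M \<times> A.M)" for n
  define Cn where "Cn n = \<Inter>(Eq \<union> Li n)" for n
  have fM: "f x \<in> B.M" if "f \<in> topspace X" "x \<in> A.M" for f x using that topX KM by blast
  have Cn_iff: "f \<in> Cn n \<longleftrightarrow> f \<in> topspace X \<and> equi_lip F \<Gamma> \<Gamma>' (l n) f" for f n
  proof
    assume f: "f \<in> Cn n"
    have "{f \<in> topspace X. B.d (f x0) (f x0) \<le> l n * A.d x0 x0} \<in> Li n"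
      unfolding Li_def by (rule image_eqI[of _ _ "(x0, x0)"]) (use x0 in auto)
    then have top: "f \<in> topspace X" using f unfolding Cn_def by blast
    have "f (A.ac g x) = B.ac g (f x)" if g: "g \<in> A.G" and x: "x \<in> A.M" for g x
    proof (rule B.dist_zeroD)
      have "{f \<in> topspace X. B.d (f (A.ac g x)) (B.ac g (f x)) \<le> 0} \<in> Eq"
        unfolding Eq_def by (rule image_eqI[of _ _ "(g, x)"]) (use g x in auto)
      then show "B.d (f (A.ac g x)) (B.ac g (f x)) \<le> 0" using f unfolding Cn_def by blast
      show "f (A.ac g x) \<in> B.M" using fM[OF top A.act_closed[OF g x]] .
      show "B.ac g (f x) \<in> B.M" using B.act_closed[OF g fM[OF top x]] .
    qed
    moreover have "B.d (f x) (f y) \<le> l n * A.d x y" if xy: "x \<in> A.M" "y \<in> A.M" for x y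
    proof -
      have "{f \<in> topspace X. B.d (f x) (f y) \<le> l n * A.d x y} \<in> Li n"
        unfolding Li_def by (rule image_eqI[of _ _ "(x, y)"]) (use xy in auto)
      then show ?thesis using f unfolding Cn_def by blast
    qed
    ultimately show "f \<in> topspace X \<and> equi_lip F \<Gamma> \<Gamma>' (l n) f"
      unfolding equi_lip_def using top fM[OF top] by simp
  next
    assume f: "f \<in> topspace X \<and> equi_lip F \<Gamma> \<Gamma>' (l n) f"
    have "B.d (f (A.ac g x)) (B.ac g (f x)) \<le> 0" if "g \<in> A.G" "x \<in> A.M" for g x
      using equi_lipD(3)[OF conjunct2[OF f] that] B.act_closed[OF that(1) fM[OF conjunct1[OF f] that(2)]] by simp
    then show "f \<in> Cn n" using f equi_lipD(4)[OF conjunct2[OF f]] by (auto simp: Cn_def Eq_def Li_def)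
  qed
  have "(\<Inter>n. Cn n) \<noteq> {}"
  proof (rule compact_space_imp_nest[OF compX])
    show "closedin X (Cn n)" for n
      unfolding Cn_def
    proof (rule closedin_Inter)
      show "Eq \<union> Li n \<noteq> {}" using x0 by (auto simp: Li_def)
      fix U assume "U \<in> Eq \<union> Li n"
      then consider g x where "g \<in> A.G" "x \<in> A.M" "U = {f \<in> topspace X. B.d (f (A.ac g x)) (B.ac g (f x)) \<le> 0}"
        | x y where "x \<in> A.M" "y \<in> A.M" "U = {f \<in> topspace X. B.d (f x) (f y) \<le> l n * A.d x y}"
        by (auto simp: Eq_def Li_def)
      then show "closedin X U"
      proof cases
        case 1
        have "continuous_map X T (B.ac g \<circ> (\<lambda>f. f x))"
          by (rule continuous_map_compose[OF proj[OF 1(2)] cont_act[OF 1(1)]])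
        then show ?thesis unfolding 1(3) using closed_le[OF proj[OF A.act_closed[OF 1(1,2)]], of "B.ac g \<circ> (\<lambda>f. f x)" 0]
          by (simp add: o_def)
      next
        case 2
        show ?thesis unfolding 2(3) by (rule closed_le[OF proj[OF 2(1)] proj[OF 2(2)]])
      qed
    qed
    show "Cn n \<noteq> {}" for n
    proof -
      obtain L f where L: "L < l n" "equi_lip F \<Gamma> \<Gamma>' L f" using ex[of "1 / real (Suc n)"] by (auto simp: l_def)
      have "equi_lip F \<Gamma> \<Gamma>' (l n) f" using equi_lip_mono[OF L(2)] L(1) by simp
      then obtain f' where f': "equi_lip F \<Gamma> \<Gamma>' (l n) f'" "B.d v0 (f' x0) \<le> R" using R[OF l(2)] by blast
      have "f' x \<in> K x" if x: "x \<in> A.M" for x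
      proof -
        have "B.d v0 (f' x) \<le> B.d v0 (f' x0) + B.d (f' x0) (f' x)"
          using B.tri[OF v0M] equi_lipD(2)[OF f'(1)] x x0 by blast
        also have "\<dots> \<le> R + l n * A.d x0 x" using f'(2) equi_lipD(4)[OF f'(1) x0 x] by linarith
        also have "\<dots> \<le> R + 2 * A.d x0 x" using l(2)[of n] by (intro add_left_mono mult_right_mono) auto
        finally show ?thesis using equi_lipD(2)[OF f'(1) x] by (simp add: K_def)
      qed
      then have "restrict f' A.M \<in> topspace X" using topX by auto
      then have "restrict f' A.M \<in> Cn n" using Cn_iff equi_lip_restrict[OF f'(1)] by blast
      then show ?thesis by blast
    qed
    show "decseq Cn"
    proof (rule decseq_SucI)
      fix n
      have "l (Suc n) \<le> l n" by (simp add: l_def frac_le)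
      then show "Cn (Suc n) \<subseteq> Cn n" using Cn_iff equi_lip_mono by blast
    qed
  qed
  then obtain f where f: "\<And>n. f \<in> Cn n" by blast
  have lip: "equi_lip F \<Gamma> \<Gamma>' (l n) f" for n using f Cn_iff by blast
  have "B.d (f x) (f y) \<le> 1 * A.d x y" if xy: "x \<in> A.M" "y \<in> A.M" for x y
  proof (rule LIMSEQ_le_const)
    have "l \<longlonglongrightarrow> 1 + 0" unfolding l_def by (intro tendsto_add tendsto_const LIMSEQ_Suc lim_1_over_n)
    then show "(\<lambda>n. l n * A.d x y) \<longlonglongrightarrow> 1 * A.d x y" by (intro tendsto_mult tendsto_const) simp
    show "\<exists>N. \<forall>n\<ge>N. B.d (f x) (f y) \<le> l n * A.d x y" using equi_lipD(4)[OF lip xy] by blast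
  qed
  then have "equi_lip F \<Gamma> \<Gamma>' 1 f" using equi_lipD[OF lip[of 0]] unfolding equi_lip_def by blast
  then show ?thesis by blast
qed

lemma Lip_eq: "Lip F \<Gamma> \<Gamma>' = Inf {L. L \<ge> 0 \<and> (\<exists>f. equi_lip F \<Gamma> \<Gamma>' L f)}"
  by (simp add: Lip_def equi_lip_def)

lemma Lip_le: "equi_lip F \<Gamma> \<Gamma>' L f \<Longrightarrow> L \<ge> 0 \<Longrightarrow> Lip F \<Gamma> \<Gamma>' \<le> L"
  unfolding Lip_eq by (intro cInf_lower bdd_belowI[of _ 0]) auto

text \<open>Rests on \<open>ex_equi_lip\<close>, as the infimum of an empty set of reals is
  unspecified.\<close>

lemma Lip_greatest:
  assumes "\<And>L f. L \<ge> 0 \<Longrightarrow> equi_lip F \<Gamma> \<Gamma>' L f \<Longrightarrow> k \<le> L" shows "k \<le> Lip F \<Gamma> \<Gamma>'"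
  unfolding Lip_eq using ex_equi_lip assms by (intro cInf_greatest) auto

lemma Lip_less:
  assumes "Lip F \<Gamma> \<Gamma>' < k" shows "\<exists>L f. L < k \<and> equi_lip F \<Gamma> \<Gamma>' L f"
proof -
  have "{L. L \<ge> 0 \<and> (\<exists>f. equi_lip F \<Gamma> \<Gamma>' L f)} \<noteq> {}" using ex_equi_lip by blast
  from cInf_lessD[OF this] assms show ?thesis unfolding Lip_eq by blast
qed

end

lemma equi_lip_compose:
  assumes f: "equi_lip F \<Gamma> \<Gamma>' L f" and h: "equi_lip F \<Gamma>' \<Gamma>'' L' h" and "L' \<ge> 0"
  shows "equi_lip F \<Gamma> \<Gamma>'' (L' * L) (h \<circ> f)"
  unfolding equi_lip_def
proof (intro conjI ballI)
  show "h \<circ> f \<in> points \<Gamma> \<rightarrow> points \<Gamma>''" using equi_lipD(2)[OF f] equi_lipD(2)[OF h] by simp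
  show "(h \<circ> f) (act \<Gamma> g x) = act \<Gamma>'' g ((h \<circ> f) x)" if "g \<in> carrier F" "x \<in> points \<Gamma>" for g x
    using equi_lipD(3)[OF f that] equi_lipD(3)[OF h that(1) equi_lipD(2)[OF f that(2)]] by simp
  fix x y assume xy: "x \<in> points \<Gamma>" "y \<in> points \<Gamma>"
  have "mdist (metr \<Gamma>'') (h (f x)) (h (f y)) \<le> L' * mdist (metr \<Gamma>') (f x) (f y)"
    using equi_lipD(4)[OF h] equi_lipD(2)[OF f] xy by blast
  also have "\<dots> \<le> L' * (L * mdist (metr \<Gamma>) x y)"
    using equi_lipD(4)[OF f xy] assms(3) by (rule mult_left_mono)
  finally show "mdist (metr \<Gamma>'') ((h \<circ> f) x) ((h \<circ> f) y) \<le> L' * L * mdist (metr \<Gamma>) x y" by (simp add: mult.assoc)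
qed

section \<open>The Lipschitz metric\<close>

lemma gtree_if_unit_outer_tree:
  "group F \<Longrightarrow> finitely_generated F \<Longrightarrow> \<Gamma> \<in> unit_outer_trees F \<Longrightarrow> gtree F \<Gamma>"
  by (simp add: gtree_def unit_outer_trees_def)

theorem proposition1p1:
  fixes F :: "('g, 'm) monoid_scheme"
    and \<Gamma> :: "('g, 'a) acted_tree"
    and \<Gamma>' :: "('g, 'b) acted_tree"
    and \<Gamma>'' :: "('g, 'c) acted_tree"
  assumes "group F" and "finitely_generated F" and "virtually_nonabelian_free F"
    and "\<Gamma> \<in> unit_outer_trees F"
    and "\<Gamma>' \<in> unit_outer_trees F"
    and "\<Gamma>'' \<in> unit_outer_trees F"
  shows "(lip_dist F \<Gamma> \<Gamma>' \<ge> 0 \<and>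
          (lip_dist F \<Gamma> \<Gamma>' = 0 \<longrightarrow> equivariantly_isometric F \<Gamma> \<Gamma>')) \<and>
         lip_dist F \<Gamma> \<Gamma>'' \<le> lip_dist F \<Gamma> \<Gamma>' + lip_dist F \<Gamma>' \<Gamma>''"
proof -
  have trees: "gtree F \<Gamma>" "gtree F \<Gamma>'" "gtree F \<Gamma>''"
    using assms gtree_if_unit_outer_tree by auto
  have vols: "vol F \<Gamma> = 1" "vol F \<Gamma>' = 1" "vol F \<Gamma>'' = 1"
    using assms by (simp_all add: unit_outer_trees_def)
  interpret X: unit_pair F \<Gamma> \<Gamma>'
    using trees vols by (simp add: unit_pair_def gtree_pair_def unit_pair_axioms_def)
  interpret Y: unit_pair F \<Gamma>' \<Gamma>''
    using trees vols by (simp add: unit_pair_def gtree_pair_def unit_pair_axioms_def)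
  interpret Z: unit_pair F \<Gamma> \<Gamma>''
    using trees vols by (simp add: unit_pair_def gtree_pair_def unit_pair_axioms_def)
  \<comment> \<open>Besides nonnegativity, these bounds keep every argument of \<open>ln\<close>
    positive.\<close>
  have X1: "1 \<le> Lip F \<Gamma> \<Gamma>'" using X.lip_ge1 by (intro X.Lip_greatest)
  have Y1: "1 \<le> Lip F \<Gamma>' \<Gamma>''" using Y.lip_ge1 by (intro Y.Lip_greatest)
  have Z1: "1 \<le> Lip F \<Gamma> \<Gamma>''" using Z.lip_ge1 by (intro Z.Lip_greatest)
  have iso: "equivariantly_isometric F \<Gamma> \<Gamma>'" if "lip_dist F \<Gamma> \<Gamma>' = 0"
  proof -
    have "Lip F \<Gamma> \<Gamma>' = 1" using that X1 by (simp add: lip_dist_def)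
    then have "\<exists>L f. L < 1 + \<epsilon> \<and> equi_lip F \<Gamma> \<Gamma>' L f" if "\<epsilon> > 0" for \<epsilon>
      using X.Lip_less[of "1 + \<epsilon>"] that by simp
    then obtain f where "equi_lip F \<Gamma> \<Gamma>' 1 f" using X.ex_1_lip by blast
    then show ?thesis by (rule X.equivariantly_isometric_if_1_lip)
  qed
  have product: "Lip F \<Gamma> \<Gamma>'' \<le> L' * L"
    if "equi_lip F \<Gamma> \<Gamma>' L f" "equi_lip F \<Gamma>' \<Gamma>'' L' h" "L \<ge> 0" "L' \<ge> 0" for L L' f h
    using Z.Lip_le[OF equi_lip_compose[OF that(1,2,4)]] that(3,4) by simp
  \<comment> \<open>The two infima are taken one after the other, the inner one for a fixed second
    map; dividing turns each into an application of \<open>Lip_greatest\<close>, without nearly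
    optimal maps.\<close>
  have "Lip F \<Gamma> \<Gamma>'' / Lip F \<Gamma> \<Gamma>' \<le> Lip F \<Gamma>' \<Gamma>''"
  proof (rule Y.Lip_greatest)
    fix L' h assume h: "L' \<ge> 0" "equi_lip F \<Gamma>' \<Gamma>'' L' h"
    have L': "L' > 0" using Y.lip_ge1[OF h(2)] by linarith
    have "Lip F \<Gamma> \<Gamma>'' / L' \<le> Lip F \<Gamma> \<Gamma>'"
    proof (rule X.Lip_greatest)
      fix L f assume "L \<ge> 0" "equi_lip F \<Gamma> \<Gamma>' L f"
      then have "Lip F \<Gamma> \<Gamma>'' \<le> L' * L" using product h by blast
      then show "Lip F \<Gamma> \<Gamma>'' / L' \<le> L" using L' by (simp add: divide_le_eq mult.commute)
    qed
    then show "Lip F \<Gamma> \<Gamma>'' / Lip F \<Gamma> \<Gamma>' \<le> L'" using L' X1 by (simp add: field_simps)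
  qed
  then have "Lip F \<Gamma> \<Gamma>'' \<le> Lip F \<Gamma> \<Gamma>' * Lip F \<Gamma>' \<Gamma>''" using X1 by (simp add: field_simps)
  then have "ln (Lip F \<Gamma> \<Gamma>'') \<le> ln (Lip F \<Gamma> \<Gamma>' * Lip F \<Gamma>' \<Gamma>'')" using X1 Y1 Z1 by simp
  also have "\<dots> = ln (Lip F \<Gamma> \<Gamma>') + ln (Lip F \<Gamma>' \<Gamma>'')" using X1 Y1 by (intro ln_mult_pos) auto
  finally show ?thesis using X1 iso by (simp add: lip_dist_def)
qed

end
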